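(* Let $F$ be a graph such that $F$ is not isomorphic to $pK_1$ for any $p\geq 1$ and not isomorphic to $pK_1+K_2$ for any $p\geq 0$. Then \textsc{Strong $F$-closure} is fixed-parameter tractable when parameterized by $|V(F)|+k$; that is, it can be solved in time $f(|V(F)|+k)\cdot n^{O(1)}$ for some computable function $f$, where $n$ is the number of vertices of the input graph.
   Context: All graphs are finite, simple and undirected. For graphs $H,F$, $H\simeq F$ means $H$ is isomorphic to $F$. Given a graph $G$ and a graph $F$, a (not necessarily induced) spanning subgraph $H$ of $G$ satisfies the $F$-closure if for every $S\subseteq V(H)$ with $H[S]\simeq F$ we have $G[S]\not\simeq F$. \textsc{Strong $F$-closure}: given a graph $G$ and a nonnegative integer $k$, decide whether $G$ has a spanning subgraph $H$ satisfying the $F$-closure with $|E(H)|\ge k$. $pK_1$ is the edgeless graph on $p$ vertices; $pK_1+K_2$ is the disjoint union of $p$ isolated vertices and one edge. *)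

theory Defs
  imports Main
begin

section \<open>Finite simple undirected graphs\<close>

record 'v graph =
  verts :: "'v set"
  edges :: "'v set set"

definition is_graph :: "'v graph \<Rightarrow> bool" where
  "is_graph G \<longleftrightarrow> finite (verts G) \<and> edges G \<subseteq> {e. e \<subseteq> verts G \<and> card e = 2}"

definition isomorphic :: "'a graph \<Rightarrow> 'b graph \<Rightarrow> bool" (infix "\<simeq>" 50) where
  "G \<simeq> H \<longleftrightarrow> (\<exists>\<phi>. bij_betw \<phi> (verts G) (verts H) \<and>
     (\<forall>u\<in>verts G. \<forall>v\<in>verts G. {u, v} \<in> edges G \<longleftrightarrow> {\<phi> u, \<phi> v} \<in> edges H))"

definition induced :: "'v graph \<Rightarrow> 'v set \<Rightarrow> 'v graph" where
  "induced G S = \<lparr>verts = S, edges = {e \<in> edges G. e \<subseteq> S}\<rparr>"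

definition spanning_subgraph :: "'v graph \<Rightarrow> 'v graph \<Rightarrow> bool" where
  "spanning_subgraph H G \<longleftrightarrow> is_graph H \<and> verts H = verts G \<and> edges H \<subseteq> edges G"

definition pK1 :: "nat \<Rightarrow> nat graph" where
  "pK1 p = \<lparr>verts = {..<p}, edges = {}\<rparr>"

definition pK1_plus_K2 :: "nat \<Rightarrow> nat graph" where
  "pK1_plus_K2 p = \<lparr>verts = {..<p + 2}, edges = {{p, p + 1}}\<rparr>"

section \<open>Strong closure\<close>

definition satisfies_closure :: "'b graph \<Rightarrow> 'v graph \<Rightarrow> 'v graph \<Rightarrow> bool" where
  "satisfies_closure F G H \<longleftrightarrow>
     (\<forall>S \<subseteq> verts H. induced H S \<simeq> F \<longrightarrow> \<not> induced G S \<simeq> F)"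

definition strong_closure :: "'b graph \<Rightarrow> 'v graph \<Rightarrow> nat \<Rightarrow> bool" where
  "strong_closure F G k \<longleftrightarrow>
     (\<exists>H. spanning_subgraph H G \<and> satisfies_closure F G H \<and> k \<le> card (edges H))"

section \<open>Model of computation\<close>

text \<open>
  A random access machine with structured control. The memory is divided into
  banks, and \<^term>\<open>s a i\<close> is the content of cell \<^term>\<open>i\<close> of bank \<^term>\<open>a\<close>.
  Addresses inside a bank are computed at run time (indirect addressing), whereas the
  bank is fixed in the program text, so that a program uses only finitely many banks.
  Every operation costs one unit of time. The arithmetic is restricted to addition and
  truncated subtraction: after \<open>t\<close> steps all numbers have at most \<open>t\<close> bits more than the
  initial ones and the program constants, hence unit cost is polynomially equivalent to
  logarithmic cost and to Turing machine time.
\<close>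

type_synonym state = "nat \<Rightarrow> nat \<Rightarrow> nat"

datatype aexp =
    Const nat
  | Cell nat aexp
  | Add aexp aexp
  | Sub aexp aexp

datatype com =
    SKIP
  | Store nat aexp aexp
  | Seq com com
  | IF aexp com com
  | WHILE aexp com

fun eval :: "aexp \<Rightarrow> state \<Rightarrow> nat" where
  "eval (Const c) s = c"
| "eval (Cell a i) s = s a (eval i s)"
| "eval (Add x y) s = eval x s + eval y s"
| "eval (Sub x y) s = eval x s - eval y s"

fun cost :: "aexp \<Rightarrow> nat" where
  "cost (Const c) = 1"
| "cost (Cell a i) = 1 + cost i"
| "cost (Add x y) = 1 + cost x + cost y"
| "cost (Sub x y) = 1 + cost x + cost y"

text \<open>
  \<open>exec c s t s'\<close>: started in state \<open>s\<close>, the program \<open>c\<close> halts in state \<open>s'\<close> after exactly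
  \<open>t\<close> units of time. A test succeeds iff its value is not zero.
\<close>

inductive exec :: "com \<Rightarrow> state \<Rightarrow> nat \<Rightarrow> state \<Rightarrow> bool" where
  Skip: "exec SKIP s 1 s"
| Store: "exec (Store a i x) s (1 + cost i + cost x) (s(a := (s a)(eval i s := eval x s)))"
| Seq: "exec c1 s t1 s1 \<Longrightarrow> exec c2 s1 t2 s2 \<Longrightarrow> exec (Seq c1 c2) s (t1 + t2) s2"
| IfTrue: "eval b s \<noteq> 0 \<Longrightarrow> exec c1 s t s1 \<Longrightarrow> exec (IF b c1 c2) s (1 + cost b + t) s1"
| IfFalse: "eval b s = 0 \<Longrightarrow> exec c2 s t s1 \<Longrightarrow> exec (IF b c1 c2) s (1 + cost b + t) s1"
| WhileFalse: "eval b s = 0 \<Longrightarrow> exec (WHILE b c) s (1 + cost b) s"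
| WhileTrue: "eval b s \<noteq> 0 \<Longrightarrow> exec c s t1 s1 \<Longrightarrow> exec (WHILE b c) s1 t2 s2 \<Longrightarrow>
    exec (WHILE b c) s (1 + cost b + t1 + t2) s2"

lemma exec_deterministic:
  "exec c s t s1 \<Longrightarrow> exec c s t' s2 \<Longrightarrow> t' = t \<and> s2 = s1"
proof (induction c s t s1 arbitrary: t' s2 rule: exec.induct)
  case (Skip s)
  from Skip.prems show ?case by cases auto
next
  case (Store a i x s)
  from Store.prems show ?case by cases auto
next
  case (Seq c1 s t1 s1 c2 t2 s2)
  from Seq.prems obtain t1' s1' t2' where
    "exec c1 s t1' s1'" "exec c2 s1' t2' s2" "t' = t1' + t2'"
    by cases auto
  with Seq.IH(1)[of t1' s1'] Seq.IH(2)[of t2' s2] show ?case by simp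
next
  case (IfTrue b s c1 t s1 c2)
  from IfTrue.prems show ?case by cases (use IfTrue.hyps in \<open>auto dest: IfTrue.IH\<close>)
next
  case (IfFalse b s c2 t s1 c1)
  from IfFalse.prems show ?case by cases (use IfFalse.hyps in \<open>auto dest: IfFalse.IH\<close>)
next
  case (WhileFalse b s c)
  from WhileFalse.prems show ?case by cases (use WhileFalse.hyps in auto)
next
  case (WhileTrue b s c t1 s1 t2 s2)
  from WhileTrue.prems WhileTrue.hyps obtain t1' s1' t2' where
    "exec c s t1' s1'" "exec (WHILE b c) s1' t2' s2" "t' = 1 + cost b + t1' + t2'"
    by cases auto
  with WhileTrue.IH(1)[of t1' s1'] WhileTrue.IH(2)[of t2' s2] show ?case by simp
qed

text \<open>Results are returned in cell 0 of bank 0.\<close>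

definition computable :: "(nat \<Rightarrow> nat) \<Rightarrow> bool" where
  "computable f \<longleftrightarrow> (\<exists>prog. \<forall>x. \<exists>t s.
     exec prog (\<lambda>a i. if a = 0 \<and> i = 0 then x else 0) t s \<and> s 0 0 = f x)"

text \<open>
  \<open>fpt I P enc \<kappa> len\<close>: on the instances in \<open>I\<close>, presented to the machine by \<open>enc\<close>, the
  predicate \<open>P\<close> is decidable in time \<open>f (\<kappa> x) \<cdot> n\<^sup>c\<close> with \<open>f\<close> computable, where \<open>n = len x\<close>.
  The maximum only matters for \<open>n = 0\<close>, where \<open>n\<^sup>c\<close> would leave no time at all.
\<close>

definition fpt ::
  "'i set \<Rightarrow> ('i \<Rightarrow> bool) \<Rightarrow> ('i \<Rightarrow> state) \<Rightarrow> ('i \<Rightarrow> nat) \<Rightarrow> ('i \<Rightarrow> nat) \<Rightarrow> bool" where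
  "fpt I P enc \<kappa> len \<longleftrightarrow> (\<exists>prog f c. computable f \<and>
     (\<forall>x\<in>I. \<exists>t s. exec prog (enc x) t s \<and>
        s 0 0 = (if P x then 1 else 0) \<and>
        t \<le> f (\<kappa> x) * max 1 (len x) ^ c))"

section \<open>Presentation of instances\<close>

text \<open>Graphs given to a program have the vertices \<open>0, \<dots>, n - 1\<close>.\<close>

definition is_input_graph :: "nat graph \<Rightarrow> bool" where
  "is_input_graph G \<longleftrightarrow> is_graph G \<and> verts G = {..<card (verts G)}"

text \<open>The adjacency matrix, row by row.\<close>

definition adj_matrix :: "nat graph \<Rightarrow> nat \<Rightarrow> nat" where
  "adj_matrix G i = (let n = card (verts G) in
     if i < n * n \<and> {i div n, i mod n} \<in> edges G then 1 else 0)"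

definition encode :: "nat graph \<times> nat graph \<times> nat \<Rightarrow> state" where
  "encode = (\<lambda>(F, G, k) a i.
     if a = 0 \<and> i = 0 then card (verts F)
     else if a = 0 \<and> i = 1 then card (verts G)
     else if a = 0 \<and> i = 2 then k
     else if a = 1 then adj_matrix F i
     else if a = 2 then adj_matrix G i
     else 0)"

end

theory Submission
  imports Defs "HOL-Combinatorics.Transposition"
begin

text \<open>
  On a common vertex set \<open>S\<close>, induced copies of \<open>F\<close> in \<open>G\<close> and in a subgraph \<open>H\<close> coincide, so the task
  is to find \<open>k\<close> edges of \<open>G\<close> that contain no complete edge set of an induced copy of \<open>F\<close>. The
  excluded graphs are exactly the nonempty graphs with at most one edge.

  If \<open>F\<close> has a vertex of degree at least two, every matching of size \<open>k\<close> is a solution. Of each class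
  of false twins of \<open>G\<close> only boundedly many vertices matter, since solutions and copies can be moved
  between twins. If many vertices are left, then the vertex cover number of \<open>G\<close> is large, and there is
  a matching of size \<open>k\<close>.

  Otherwise the edges of \<open>F\<close> form a matching with at least two edges, and a star with \<open>k\<close> edges is a
  solution. So let all degrees in \<open>G\<close> be less than \<open>k\<close>. Isolated vertices of \<open>F\<close> can be placed
  anywhere in a large graph, hence a component of a solution can be moved to any isomorphic ball that
  is disjoint from the rest of it, and boundedly many balls of each isomorphism type suffice.

  In both cases the remaining graph is solved by exhaustive search. All numbers involved are bounded
  by a tower of exponentials, and the algorithm is written with loops that all run \<open>L\<close> times, where
  \<open>L\<close> is such a tower plus the number of vertices. So the running time is polynomial in \<open>L\<close>.
\<close>

section \<open>Loop programs\<close>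

text \<open>The two reductions differ in kind. Swapping false twins is an automorphism of
  \<open>G\<close>, so it carries solutions and copies of all of \<open>F\<close>. Moving a
  component to another ball is only a local isomorphism, and the isolated vertices of a copy may lie
  anywhere. They are therefore stripped off, the move is made for the rest of \<open>F\<close>, and
  they are put back greedily, which takes a vertex set with more than \<open>|F| * k\<close>
  elements; a supply of arbitrary vertices is added to the kernel for this purpose.

  The machine can only add and subtract, and \<open>F\<close> is part of the input. Fixed-length
  loops make the running time a function of the syntax and \<open>L\<close> alone, so correctness
  can be argued about plain HOL functions. Kernels are never built in memory: membership is a
  predicate decided by counting. Sets, walks and maps are numbers read digit by digit, so
  \<open>L\<close> must exceed all their codes. The estimates are generous on purpose: each product
  or power is paid for by one more exponential.\<close>

datatype tm =
    TConst nat
  | TVar nat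
  | TIn nat tm
  | TAdd tm tm
  | TSub tm tm
  | TIf tm tm tm
  | TLet tm tm
  | TRec tm tm

fun push :: "nat \<Rightarrow> (nat \<Rightarrow> nat) \<Rightarrow> nat \<Rightarrow> nat" where
  "push x e 0 = x"
| "push x e (Suc j) = e j"

text \<open>De Bruijn indices: \<open>TLet\<close> binds variable 0, \<open>TRec\<close> binds 0 to
  the iteration number and 1 to the accumulator. The test \<open>a < 3\<close> hides bank 3, the
  stack of the compiled code, so that a value depends only on the input banks.\<close>

primrec tval :: "tm \<Rightarrow> nat \<Rightarrow> state \<Rightarrow> (nat \<Rightarrow> nat) \<Rightarrow> nat" where
  "tval (TConst c) L s e = c"
| "tval (TVar i) L s e = e i"
| "tval (TIn a t) L s e = (if a < 3 then s a (tval t L s e) else 0)"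
| "tval (TAdd t u) L s e = tval t L s e + tval u L s e"
| "tval (TSub t u) L s e = tval t L s e - tval u L s e"
| "tval (TIf c t u) L s e = (if tval c L s e \<noteq> 0 then tval t L s e else tval u L s e)"
| "tval (TLet t u) L s e = tval u L s (push (tval t L s e) e)"
| "tval (TRec z b) L s e =
     rec_nat (tval z L s e) (\<lambda>i a. tval b L s (push i (push a e))) L"

text \<open>
  \<open>compile t \<pi> d\<close> leaves the value of \<open>t\<close> in cell \<open>d\<close> of bank 3, which serves as a stack;
  \<open>\<pi>\<close> maps each variable to its cell, and cell 0 holds the number of iterations of all loops.
\<close>

primrec compile :: "tm \<Rightarrow> (nat \<Rightarrow> nat) \<Rightarrow> nat \<Rightarrow> com" where
  "compile (TConst c) \<pi> d = Store 3 (Const d) (Const c)"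
| "compile (TVar i) \<pi> d = Store 3 (Const d) (Cell 3 (Const (\<pi> i)))"
| "compile (TIn a t) \<pi> d = Seq (compile t \<pi> d)
     (Store 3 (Const d) (if a < 3 then Cell a (Cell 3 (Const d)) else Const 0))"
| "compile (TAdd t u) \<pi> d = Seq (compile t \<pi> d) (Seq (compile u \<pi> (Suc d))
     (Store 3 (Const d) (Add (Cell 3 (Const d)) (Cell 3 (Const (Suc d))))))"
| "compile (TSub t u) \<pi> d = Seq (compile t \<pi> d) (Seq (compile u \<pi> (Suc d))
     (Store 3 (Const d) (Sub (Cell 3 (Const d)) (Cell 3 (Const (Suc d))))))"
| "compile (TIf c t u) \<pi> d = Seq (compile c \<pi> d)
     (IF (Cell 3 (Const d)) (compile t \<pi> d) (compile u \<pi> d))"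
| "compile (TLet t u) \<pi> d = Seq (compile t \<pi> d) (Seq (compile u (push d \<pi>) (Suc d))
     (Store 3 (Const d) (Cell 3 (Const (Suc d)))))"
| "compile (TRec z b) \<pi> d = Seq (compile z \<pi> d)
     (Seq (Store 3 (Const (d + 1)) (Const 0))
     (Seq (Store 3 (Const (d + 2)) (Cell 3 (Const 0)))
       (WHILE (Cell 3 (Const (d + 2)))
         (Seq (compile b (push (d + 1) (push d \<pi>)) (d + 3))
         (Seq (Store 3 (Const d) (Cell 3 (Const (d + 3))))
         (Seq (Store 3 (Const (d + 1)) (Add (Cell 3 (Const (d + 1))) (Const 1)))
              (Store 3 (Const (d + 2)) (Sub (Cell 3 (Const (d + 2))) (Const 1)))))))))"

text \<open>Only an upper bound: both branches of a conditional are charged.\<close>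

primrec tcost :: "tm \<Rightarrow> nat \<Rightarrow> nat" where
  "tcost (TConst c) L = 3"
| "tcost (TVar i) L = 4"
| "tcost (TIn a t) L = tcost t L + 5"
| "tcost (TAdd t u) L = tcost t L + tcost u L + 7"
| "tcost (TSub t u) L = tcost t L + tcost u L + 7"
| "tcost (TIf c t u) L = tcost c L + tcost t L + tcost u L + 3"
| "tcost (TLet t u) L = tcost t L + tcost u L + 4"
| "tcost (TRec z b) L = tcost z L + 10 + L * (tcost b L + 19)"

text \<open>A total-correctness triple with a time budget; since \<open>t\<close> is only an upper
  bound, budgets may be rounded up when programs are composed.\<close>

definition runs :: "com \<Rightarrow> state \<Rightarrow> nat \<Rightarrow> (state \<Rightarrow> bool) \<Rightarrow> bool" where
  "runs c s t Q \<longleftrightarrow> (\<exists>t' s'. exec c s t' s' \<and> t' \<le> t \<and> Q s')"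

lemma runs_Store:
  "Q (s(a := (s a)(eval i s := eval x s))) \<Longrightarrow> 1 + cost i + cost x \<le> t \<Longrightarrow> runs (Store a i x) s t Q"
  unfolding runs_def using exec.Store by blast

lemma runs_Seq:
  assumes "runs c1 s t1 R" and "\<And>s1. R s1 \<Longrightarrow> runs c2 s1 t2 Q" and "t1 + t2 \<le> t"
  shows "runs (Seq c1 c2) s t Q"
proof -
  obtain t' s1 where 1: "exec c1 s t' s1" "t' \<le> t1" "R s1" using assms(1) by (auto simp: runs_def)
  obtain t'' s2 where 2: "exec c2 s1 t'' s2" "t'' \<le> t2" "Q s2"
    using assms(2)[OF 1(3)] by (auto simp: runs_def)
  have "exec (Seq c1 c2) s (t' + t'') s2" by (rule exec.Seq[OF 1(1) 2(1)])
  then show ?thesis unfolding runs_def using 1 2 assms(3) by (meson add_mono order_trans)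
qed

lemma runs_Store_Seq:
  assumes "runs c (s(a := (s a)(eval i s := eval x s))) t' Q" and "1 + cost i + cost x + t' \<le> t"
  shows "runs (Seq (Store a i x) c) s t Q"
proof -
  have st: "runs (Store a i x) s (1 + cost i + cost x) (\<lambda>s'. s' = s(a := (s a)(eval i s := eval x s)))"
    by (rule runs_Store) auto
  show ?thesis by (rule runs_Seq[OF st _ assms(2)]) (use assms(1) in simp)
qed

lemma runs_IF:
  assumes "eval b s \<noteq> 0 \<Longrightarrow> runs c1 s t1 Q" and "eval b s = 0 \<Longrightarrow> runs c2 s t1 Q"
    and "1 + cost b + t1 \<le> t"
  shows "runs (IF b c1 c2) s t Q"
proof (cases "eval b s = 0")
  case True
  then obtain t' s' where "exec c2 s t' s'" "t' \<le> t1" "Q s'" using assms(2) by (auto simp: runs_def)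
  then show ?thesis unfolding runs_def using exec.IfFalse[OF True, of c2 t' s' c1] assms(3)
    by (intro exI[of _ "1 + cost b + t'"] exI[of _ s']) simp
next
  case False
  then obtain t' s' where "exec c1 s t' s'" "t' \<le> t1" "Q s'" using assms(1) by (auto simp: runs_def)
  then show ?thesis unfolding runs_def using exec.IfTrue[OF False, of c1 t' s' c2] assms(3)
    by (intro exI[of _ "1 + cost b + t'"] exI[of _ s']) simp
qed

text \<open>The invariant is indexed by the rounds done and determines the loop test, so exactly
  \<open>m\<close> rounds are executed.\<close>

lemma runs_WHILE:
  assumes "Inv 0 s"
    and "\<And>i s. Inv i s \<Longrightarrow> i < m \<Longrightarrow> eval b s \<noteq> 0 \<and> runs c s tc (Inv (Suc i))"
    and "\<And>s. Inv m s \<Longrightarrow> eval b s = 0"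
    and "m * (1 + cost b + tc) + 1 + cost b \<le> t"
  shows "runs (WHILE b c) s t (Inv m)"
proof -
  have "Inv i s \<Longrightarrow> i \<le> m \<Longrightarrow> runs (WHILE b c) s ((m - i) * (1 + cost b + tc) + 1 + cost b) (Inv m)"
    for i s
  proof (induction "m - i" arbitrary: i s)
    case 0
    then have "i = m" by simp
    then show ?case using 0 assms(3) exec.WhileFalse[of b s c] by (auto simp: runs_def)
  next
    case (Suc j)
    then have im: "i < m" by simp
    from assms(2)[OF Suc(3) im] obtain t1 s1 where
      1: "eval b s \<noteq> 0" "exec c s t1 s1" "t1 \<le> tc" "Inv (Suc i) s1" by (auto simp: runs_def)
    have j: "j = m - Suc i" using Suc(2) by simp
    from Suc(1)[OF j 1(4)] im obtain t2 s2 where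
      2: "exec (WHILE b c) s1 t2 s2" "t2 \<le> (m - Suc i) * (1 + cost b + tc) + 1 + cost b" "Inv m s2"
      by (auto simp: runs_def)
    have e: "m - i = Suc (m - Suc i)" using im by simp
    have "exec (WHILE b c) s (1 + cost b + t1 + t2) s2" by (rule exec.WhileTrue[OF 1(1,2) 2(1)])
    moreover have "1 + cost b + t1 + t2 \<le> (m - i) * (1 + cost b + tc) + 1 + cost b"
      using 1(3) 2(2) unfolding e by simp
    ultimately show ?case using 2(3) unfolding runs_def by blast
  qed
  from this[of 0 s] assms(1) have "runs (WHILE b c) s (m * (1 + cost b + tc) + 1 + cost b) (Inv m)"
    by simp
  then show ?thesis using assms(4) unfolding runs_def by (meson order_trans)
qed

lemma runs_weaken: "runs c s t Q \<Longrightarrow> (\<And>s. Q s \<Longrightarrow> Q' s) \<Longrightarrow> t \<le> t' \<Longrightarrow> runs c s t' Q'"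
  unfolding runs_def by (meson order_trans)

lemma push_comp: "(\<lambda>i. f (push x \<pi> i)) = push (f x) (\<lambda>i. f (\<pi> i))"
  by (rule ext, case_tac i) auto

abbreviation keeps :: "nat \<Rightarrow> state \<Rightarrow> state \<Rightarrow> bool" where
  "keeps d s s' \<equiv> (\<forall>j<d. s' 3 j = s 3 j) \<and> (\<forall>a. a \<noteq> 3 \<longrightarrow> s' a = s a)"

text \<open>\<open>keeps d\<close> carries the induction: a subterm compiled at a deeper cell
  changes neither the variables, which lie below \<open>d\<close>, nor the intermediate results on
  the stack. The input banks are compared with a fixed \<open>s0\<close> because the induction
  hypothesis is applied at intermediate states. \<open>0 < d\<close> protects \<open>L\<close> in
  cell 0.\<close>

lemma compile_correct:
  assumes "\<forall>i. \<pi> i < d" and "s 3 0 = L" and "0 < d" and "\<forall>a<3. s a = s0 a"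
  shows "runs (compile t \<pi> d) s (tcost t L)
    (\<lambda>s'. s' 3 d = tval t L s0 (\<lambda>i. s 3 (\<pi> i)) \<and> keeps d s s')"
  using assms
proof (induction t arbitrary: \<pi> d s)
  case (TConst c)
  then show ?case by (auto intro!: runs_Store)
next
  case (TVar i)
  then show ?case by (auto intro!: runs_Store)
next
  case (TIn a t)
  show ?case
    unfolding compile.simps
    by (rule runs_Seq[OF TIn.IH[OF TIn.prems] runs_Store]) (use TIn.prems in auto)
next
  case (TAdd t u)
  have p: "\<forall>i. \<pi> i < Suc d" using TAdd.prems(1) by (simp add: less_SucI)
  show ?case
    unfolding compile.simps
    apply (rule runs_Seq[OF TAdd.IH(1)[OF TAdd.prems], where ?t2.0 = "tcost u L + 7"])
     apply (rule runs_Seq[where ?t1.0 = "tcost u L" and ?t2.0 = 7])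
       apply (rule TAdd.IH(2)[OF p])
         apply (use TAdd.prems in auto)[3]
      apply (rule runs_Store)
       apply (use TAdd.prems in \<open>auto simp: less_SucI\<close>)
    done
next
  case (TSub t u)
  have p: "\<forall>i. \<pi> i < Suc d" using TSub.prems(1) by (simp add: less_SucI)
  show ?case
    unfolding compile.simps
    apply (rule runs_Seq[OF TSub.IH(1)[OF TSub.prems], where ?t2.0 = "tcost u L + 7"])
     apply (rule runs_Seq[where ?t1.0 = "tcost u L" and ?t2.0 = 7])
       apply (rule TSub.IH(2)[OF p])
         apply (use TSub.prems in auto)[3]
      apply (rule runs_Store)
       apply (use TSub.prems in \<open>auto simp: less_SucI\<close>)
    done
next
  case (TIf c t u)
  show ?case
    unfolding compile.simps
    apply (rule runs_Seq[OF TIf.IH(1)[OF TIf.prems], where ?t2.0 = "tcost t L + tcost u L + 3"])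
     apply (rule runs_IF[where ?t1.0 = "tcost t L + tcost u L"])
       apply (rule runs_weaken[OF TIf.IH(2)[of \<pi> d]])
            apply (use TIf.prems in auto)[6]
      apply (rule runs_weaken[OF TIf.IH(3)[of \<pi> d]])
    by (use TIf.prems in auto)
next
  case (TLet t u)
  have p: "\<forall>i. push d \<pi> i < Suc d"
    using TLet.prems(1) by (intro allI, case_tac i) (auto simp: less_SucI)
  show ?case
    unfolding compile.simps
    apply (rule runs_Seq[OF TLet.IH(1)[OF TLet.prems], where ?t2.0 = "tcost u L + 4"])
     apply (rule runs_Seq[where ?t1.0 = "tcost u L" and ?t2.0 = 4])
       apply (rule TLet.IH(2)[OF p])
         apply (use TLet.prems in auto)[3]
      apply (rule runs_Store)
       apply (use TLet.prems in \<open>auto simp: less_SucI push_comp[of "_ 3"]\<close>)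
    done
next
  case (TRec z b)
  define e where "e = (\<lambda>i. s 3 (\<pi> i))"
  define r where "r i = rec_nat (tval z L s0 e) (\<lambda>i a. tval b L s0 (push i (push a e))) i" for i
  \<comment> \<open>Cell \<open>d\<close> holds the accumulator, \<open>d + 1\<close> the iteration
    number, \<open>d + 2\<close> the remaining rounds; the body is compiled at
    \<open>d + 3\<close>.\<close>
  define Inv where "Inv i s' \<longleftrightarrow> s' 3 d = r i \<and> s' 3 (d + 1) = i \<and> s' 3 (d + 2) = L - i \<and> keeps d s s'"
    for i s'
  have p: "\<forall>i. push (d + 1) (push d \<pi>) i < d + 3"
  proof
    fix i
    show "push (d + 1) (push d \<pi>) i < d + 3"
      using TRec.prems(1) by (cases i; cases "i - 1") (auto simp: trans_less_add1)
  qed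
  have step: "runs (Seq (compile b (push (d + 1) (push d \<pi>)) (d + 3))
         (Seq (Store 3 (Const d) (Cell 3 (Const (d + 3))))
         (Seq (Store 3 (Const (d + 1)) (Add (Cell 3 (Const (d + 1))) (Const 1)))
              (Store 3 (Const (d + 2)) (Sub (Cell 3 (Const (d + 2))) (Const 1))))))
         s1 (tcost b L + 16) (Inv (Suc i))" if "Inv i s1" "i < L" for i s1
  proof -
    have e1: "(\<lambda>j. s1 3 (\<pi> j)) = e" using that TRec.prems(1) by (auto simp: Inv_def e_def)
    have s1: "s1 3 0 = L" "\<forall>a<3. s1 a = s0 a" using that TRec.prems by (auto simp: Inv_def)
    have ih: "runs (compile b (push (d + 1) (push d \<pi>)) (d + 3)) s1 (tcost b L)
      (\<lambda>s'. s' 3 (d + 3) = r (Suc i) \<and> keeps (d + 3) s1 s')"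
      using TRec.IH(2)[of "push (d + 1) (push d \<pi>)" "d + 3" s1, OF p s1(1) _ s1(2)] that e1
      by (simp add: push_comp[of "s1 3"] Inv_def r_def)
    show ?thesis
      apply (rule runs_Seq[OF ih, where ?t2.0 = 16])
       apply (rule runs_Store_Seq[where t' = 12])
        apply (rule runs_Store_Seq[where t' = 6])
         apply (rule runs_Store)
          apply (use that TRec.prems in \<open>auto simp: Inv_def\<close>)
      done
  qed
  have loop: "runs (WHILE (Cell 3 (Const (d + 2)))
         (Seq (compile b (push (d + 1) (push d \<pi>)) (d + 3))
         (Seq (Store 3 (Const d) (Cell 3 (Const (d + 3))))
         (Seq (Store 3 (Const (d + 1)) (Add (Cell 3 (Const (d + 1))) (Const 1)))
              (Store 3 (Const (d + 2)) (Sub (Cell 3 (Const (d + 2))) (Const 1)))))))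
         s1 (L * (tcost b L + 19) + 3) (Inv L)" if "Inv 0 s1" for s1
    by (rule runs_WHILE[where Inv = Inv and m = L and tc = "tcost b L + 16", OF that])
       (use step in \<open>auto simp: Inv_def\<close>)
  have fin: "runs (WHILE (Cell 3 (Const (d + 2)))
         (Seq (compile b (push (d + 1) (push d \<pi>)) (d + 3))
         (Seq (Store 3 (Const d) (Cell 3 (Const (d + 3))))
         (Seq (Store 3 (Const (d + 1)) (Add (Cell 3 (Const (d + 1))) (Const 1)))
              (Store 3 (Const (d + 2)) (Sub (Cell 3 (Const (d + 2))) (Const 1)))))))
         s1 (L * (tcost b L + 19) + 3) (\<lambda>s'. s' 3 d = r L \<and> keeps d s s')" if "Inv 0 s1" for s1
    by (rule runs_weaken[OF loop[OF that]]) (auto simp: Inv_def)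
  show ?case
    unfolding compile.simps
    apply (rule runs_Seq[OF TRec.IH(1)[OF TRec.prems]])
     apply (rule runs_Store_Seq[where t' = "7 + L * (tcost b L + 19)"])
      apply (rule runs_Store_Seq[where t' = "3 + L * (tcost b L + 19)"])
       apply (rule runs_weaken[OF fin])
         apply (use TRec.prems in \<open>auto simp: Inv_def r_def e_def\<close>)
    done
qed

section \<open>Loop-computable functions\<close>

definition poly_bounded :: "(nat \<Rightarrow> nat) \<Rightarrow> bool" where
  "poly_bounded g \<longleftrightarrow> (\<exists>K m. \<forall>L. g L \<le> K * (L + 1) ^ m)"

lemma poly_bounded_const: "poly_bounded (\<lambda>L. c)"
  unfolding poly_bounded_def by (intro exI[of _ c] exI[of _ 0]) simp

lemma poly_bounded_id: "poly_bounded (\<lambda>L. L)"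
  unfolding poly_bounded_def by (intro exI[of _ 1] exI[of _ 1]) simp

lemma poly_bounded_add:
  assumes "poly_bounded g" "poly_bounded h"
  shows "poly_bounded (\<lambda>L. g L + h L)"
proof -
  obtain K m K' m' where 1: "\<And>L. g L \<le> K * (L + 1) ^ m" "\<And>L. h L \<le> K' * (L + 1) ^ m'"
    using assms by (auto simp: poly_bounded_def)
  have "g L + h L \<le> (K + K') * (L + 1) ^ (m + m')" for L
  proof -
    have "(L + 1) ^ m \<le> (L + 1) ^ (m + m')" "(L + 1) ^ m' \<le> (L + 1) ^ (m + m')"
      by (rule power_increasing; simp)+
    then have "K * (L + 1) ^ m \<le> K * (L + 1) ^ (m + m')" "K' * (L + 1) ^ m' \<le> K' * (L + 1) ^ (m + m')"
      by (auto intro: mult_le_mono2)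
    then show ?thesis using 1[of L] by (simp only: distrib_right)
  qed
  then show ?thesis unfolding poly_bounded_def by blast
qed

lemma poly_bounded_mult:
  assumes "poly_bounded g" "poly_bounded h"
  shows "poly_bounded (\<lambda>L. g L * h L)"
proof -
  obtain K m K' m' where 1: "\<And>L. g L \<le> K * (L + 1) ^ m" "\<And>L. h L \<le> K' * (L + 1) ^ m'"
    using assms by (auto simp: poly_bounded_def)
  have "g L * h L \<le> (K * K') * (L + 1) ^ (m + m')" for L
    using mult_le_mono[OF 1(1)[of L] 1(2)[of L]] by (simp add: power_add mult_ac)
  then show ?thesis unfolding poly_bounded_def by blast
qed

lemma tcost_poly_bounded: "poly_bounded (\<lambda>L. tcost t L)"
  by (induction t; simp only: tcost.simps)
     (assumption | rule poly_bounded_add poly_bounded_mult poly_bounded_id poly_bounded_const)+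

primrec rename :: "(nat \<Rightarrow> nat) \<Rightarrow> tm \<Rightarrow> tm" where
  "rename \<rho> (TConst c) = TConst c"
| "rename \<rho> (TVar i) = TVar (\<rho> i)"
| "rename \<rho> (TIn a t) = TIn a (rename \<rho> t)"
| "rename \<rho> (TAdd t u) = TAdd (rename \<rho> t) (rename \<rho> u)"
| "rename \<rho> (TSub t u) = TSub (rename \<rho> t) (rename \<rho> u)"
| "rename \<rho> (TIf c t u) = TIf (rename \<rho> c) (rename \<rho> t) (rename \<rho> u)"
| "rename \<rho> (TLet t u) = TLet (rename \<rho> t) (rename (push 0 (\<lambda>i. Suc (\<rho> i))) u)"
| "rename \<rho> (TRec z b) =
     TRec (rename \<rho> z) (rename (push 0 (push 1 (\<lambda>i. Suc (Suc (\<rho> i))))) b)"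

lemma tval_rename: "tval (rename \<rho> t) L s e = tval t L s (\<lambda>i. e (\<rho> i))"
proof (induction t arbitrary: \<rho> e)
  case (TLet t u)
  show ?case by (simp add: TLet push_comp[of "push _ _"])
next
  case (TRec z b)
  have "(\<lambda>i. push x (push y e) (push 0 (push 1 (\<lambda>i. Suc (Suc (\<rho> i)))) i)) =
    push x (push y (\<lambda>i. e (\<rho> i)))" for x y
    by (simp add: push_comp[of "push _ _"])
  then show ?case by (simp add: TRec)
qed simp_all

text \<open>A semantic notion: the algorithm is written as HOL functions of \<open>L\<close>, the
  input state and the environment, and the closure rules below supply the term of type
  \<open>tm\<close>.\<close>

definition loopable :: "(nat \<Rightarrow> state \<Rightarrow> (nat \<Rightarrow> nat) \<Rightarrow> nat) \<Rightarrow> bool" where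
  "loopable f \<longleftrightarrow> (\<exists>t. \<forall>L s e. tval t L s e = f L s e)"

definition loopable_pred :: "(nat \<Rightarrow> state \<Rightarrow> (nat \<Rightarrow> nat) \<Rightarrow> bool) \<Rightarrow> bool" where
  "loopable_pred P \<longleftrightarrow> loopable (\<lambda>L s e. if P L s e then 1 else 0)"

lemma loopableI: "(\<And>L s e. tval t L s e = f L s e) \<Longrightarrow> loopable f"
  unfolding loopable_def by blast

lemma loopableE:
  assumes "loopable f"
  obtains t where "tval t = f"
  using assms unfolding loopable_def by (metis ext)

lemma loopable_const: "loopable (\<lambda>L s e. c)"
  by (rule loopableI[of "TConst c"]) simp

lemma loopable_var: "loopable (\<lambda>L s e. e i)"
  by (rule loopableI[of "TVar i"]) simp

lemma loopable_in: "a < 3 \<Longrightarrow> loopable f \<Longrightarrow> loopable (\<lambda>L s e. s a (f L s e))"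
  by (erule loopableE, rule_tac t = "TIn a t" in loopableI) simp

lemma loopable_add: "loopable f \<Longrightarrow> loopable g \<Longrightarrow> loopable (\<lambda>L s e. f L s e + g L s e)"
  by (elim loopableE, rule_tac t = "TAdd t ta" in loopableI) simp

lemma loopable_sub: "loopable f \<Longrightarrow> loopable g \<Longrightarrow> loopable (\<lambda>L s e. f L s e - g L s e)"
  by (elim loopableE, rule_tac t = "TSub t ta" in loopableI) simp

lemma loopable_weaken: "loopable f \<Longrightarrow> loopable (\<lambda>L s e. f L s (\<lambda>i. e (\<rho> i)))"
  by (elim loopableE, rule_tac t = "rename \<rho> t" in loopableI) (simp add: tval_rename)

text \<open>In the premise the new argument is variable 0 and the old environment is shifted by one;
  in the conclusion it is an ordinary HOL argument. This matches HOL abstraction with de Bruijn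
  binders.\<close>

lemma loopable_let:
  assumes "loopable (\<lambda>L s e. g L s (\<lambda>i. e (Suc i)) (e 0))" "loopable f"
  shows "loopable (\<lambda>L s e. g L s e (f L s e))"
proof -
  from assms obtain t u where "tval t = (\<lambda>L s e. g L s (\<lambda>i. e (Suc i)) (e 0))" "tval u = f"
    by (elim loopableE) blast
  then show ?thesis by (intro loopableI[of "TLet u t"]) simp
qed

lemma loopable_rec:
  assumes "loopable (\<lambda>L s e. b L s (\<lambda>i. e (Suc (Suc i))) (e 0) (e 1))" "loopable z"
  shows "loopable (\<lambda>L s e. rec_nat (z L s e) (b L s e) L)"
proof -
  from assms obtain t u where "tval t = (\<lambda>L s e. b L s (\<lambda>i. e (Suc (Suc i))) (e 0) (e 1))" "tval u = z"
    by (elim loopableE) blast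
  then show ?thesis by (intro loopableI[of "TRec u t"]) simp
qed

lemma loopable_if:
  assumes "loopable_pred P" "loopable f" "loopable g"
  shows "loopable (\<lambda>L s e. if P L s e then f L s e else g L s e)"
proof -
  from assms obtain c t u where "tval c = (\<lambda>L s e. if P L s e then 1 else 0)" "tval t = f" "tval u = g"
    unfolding loopable_pred_def by (elim loopableE) blast
  then show ?thesis by (intro loopableI[of "TIf c t u"]) simp
qed

text \<open>The shift is by two because the sum is run by \<open>TRec\<close>, which binds the
  partial sum as variable 1 next to the index.\<close>

lemma loopable_sum:
  assumes "loopable (\<lambda>L s e. g L s (\<lambda>i. e (Suc (Suc i))) (e 0))"
  shows "loopable (\<lambda>L s e. \<Sum>i<L. g L s e i)"
proof -
  have "(\<Sum>i<n. g L s e i) = rec_nat 0 (\<lambda>i a. a + g L s e i) n" for L s e n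
    by (induction n) auto
  then show ?thesis
    using loopable_rec[of "\<lambda>L s e i a. a + g L s e i", OF loopable_add[OF loopable_var assms]
      loopable_const[of 0]] by simp
qed

lemma loopable_pred_not:
  assumes "loopable_pred P" shows "loopable_pred (\<lambda>L s e. \<not> P L s e)"
proof -
  have "(if \<not> P L s e then 1 else 0 :: nat) = (if P L s e then 0 else 1)" for L s e by simp
  then show ?thesis
    using loopable_if[OF assms loopable_const[of 0] loopable_const[of 1]]
    unfolding loopable_pred_def by simp
qed

lemma loopable_pred_conj:
  assumes "loopable_pred P" "loopable_pred Q" shows "loopable_pred (\<lambda>L s e. P L s e \<and> Q L s e)"
proof -
  have "(if P L s e \<and> Q L s e then 1 else 0 :: nat) =
    (if P L s e then if Q L s e then 1 else 0 else 0)" for L s e by simp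
  then show ?thesis
    using loopable_if[OF assms(1) assms(2)[unfolded loopable_pred_def] loopable_const[of 0]]
    unfolding loopable_pred_def by simp
qed

lemma loopable_pred_disj:
  assumes "loopable_pred P" "loopable_pred Q" shows "loopable_pred (\<lambda>L s e. P L s e \<or> Q L s e)"
  using loopable_pred_not[OF loopable_pred_conj[OF assms[THEN loopable_pred_not]]]
  by (simp only: de_Morgan_conj not_not)

lemma loopable_pred_imp:
  assumes "loopable_pred P" "loopable_pred Q" shows "loopable_pred (\<lambda>L s e. P L s e \<longrightarrow> Q L s e)"
  using loopable_pred_disj[OF assms(1)[THEN loopable_pred_not] assms(2)] by (simp only: imp_conv_disj)

lemma loopable_pred_iff:
  assumes "loopable_pred P" "loopable_pred Q" shows "loopable_pred (\<lambda>L s e. P L s e = Q L s e)"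
  using loopable_pred_conj[OF loopable_pred_imp[OF assms] loopable_pred_imp[OF assms(2,1)]]
  by (simp only: iff_conv_conj_imp)

lemma loopable_pred_le:
  assumes "loopable f" "loopable g" shows "loopable_pred (\<lambda>L s e. f L s e \<le> g L s e)"
proof -
  have "(if f L s e \<le> g L s e then 1 else 0) = (1 - (f L s e - g L s e))" for L s e by simp
  then show ?thesis
    using loopable_sub[OF loopable_const[of 1] loopable_sub[OF assms]]
    unfolding loopable_pred_def by simp
qed

lemma loopable_pred_less:
  assumes "loopable f" "loopable g" shows "loopable_pred (\<lambda>L s e. f L s e < g L s e)"
  using loopable_pred_not[OF loopable_pred_le[OF assms(2,1)]] by (simp add: not_le)

lemma loopable_pred_eq:
  assumes "loopable f" "loopable g" shows "loopable_pred (\<lambda>L s e. f L s e = g L s e)"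
  using loopable_pred_conj[OF loopable_pred_le[OF assms] loopable_pred_le[OF assms(2,1)]]
  by (simp add: eq_iff)

lemma loopable_pred_ex:
  assumes "loopable_pred (\<lambda>L s e. P L s (\<lambda>i. e (Suc (Suc i))) (e 0))"
  shows "loopable_pred (\<lambda>L s e. \<exists>i<L. P L s e i)"
proof -
  have "(\<exists>i<L. P L s e i) \<longleftrightarrow> 0 < (\<Sum>i<L. if P L s e i then 1 else 0 :: nat)" for L s e
  proof -
    have "(\<Sum>i<L. if P L s e i then 1 else 0 :: nat) = 0 \<longleftrightarrow> (\<forall>i<L. \<not> P L s e i)"
      by (subst sum_eq_0_iff) auto
    then show ?thesis by (metis gr0I less_numeral_extra(3))
  qed
  moreover have "loopable_pred (\<lambda>L s e. 0 < (\<Sum>i<L. if P L s e i then 1 else 0 :: nat))"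
    by (intro loopable_pred_less loopable_const loopable_sum assms[unfolded loopable_pred_def])
  ultimately show ?thesis by simp
qed

lemma loopable_pred_all:
  assumes "loopable_pred (\<lambda>L s e. P L s (\<lambda>i. e (Suc (Suc i))) (e 0))"
  shows "loopable_pred (\<lambda>L s e. \<forall>i<L. P L s e i)"
  using loopable_pred_not[OF loopable_pred_ex[OF loopable_pred_not[OF assms]]] by simp

text \<open>\<open>g\<close> has no access to the environment, so it is enough to treat it on bare
  variables. Each function of the algorithm is analysed once and then applied to arbitrary
  arguments.\<close>

lemma loopable_comp1:
  assumes "loopable (\<lambda>L s e. g L s (e 0))" "loopable f1"
  shows "loopable (\<lambda>L s e. g L s (f1 L s e))"
  by (rule loopable_let[OF assms])

lemma loopable_comp2:
  assumes "loopable (\<lambda>L s e. g L s (e 0) (e 1))" "loopable f1" "loopable f2"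
  shows "loopable (\<lambda>L s e. g L s (f1 L s e) (f2 L s e))"
  by (rule loopable_let[OF loopable_let[where g = "\<lambda>L s e x. g L s x (e 0)", OF _
        loopable_weaken[OF assms(2), of Suc]] assms(3)]) (use assms(1) in simp)

lemma loopable_comp3:
  assumes "loopable (\<lambda>L s e. g L s (e 0) (e 1) (e 2))" "loopable f1" "loopable f2" "loopable f3"
  shows "loopable (\<lambda>L s e. g L s (f1 L s e) (f2 L s e) (f3 L s e))"
proof -
  have "loopable (\<lambda>L s e. g L s (f1 L s (\<lambda>i. e (Suc (Suc i)))) (e 0) (e 1))"
    by (rule loopable_let[where g = "\<lambda>L s e x. g L s x (e 0) (e 1)"])
       (use assms(1) loopable_weaken[OF assms(2), of "\<lambda>i. Suc (Suc i)"]
        in \<open>simp_all add: numeral_2_eq_2\<close>)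
  then have "loopable (\<lambda>L s e. g L s (f1 L s (\<lambda>i. e (Suc i))) (f2 L s (\<lambda>i. e (Suc i))) (e 0))"
    by (intro loopable_let[where g = "\<lambda>L s e x. g L s (f1 L s (\<lambda>i. e (Suc i))) x (e 0)"])
       (use loopable_weaken[OF assms(3), of Suc] in simp_all)
  then show ?thesis by (rule loopable_let[OF _ assms(4)])
qed

lemmas loopable_pred_comp1 =
  loopable_comp1[where g = "\<lambda>L s x. if P L s x then 1 else 0" for P, folded loopable_pred_def]
lemmas loopable_pred_comp2 =
  loopable_comp2[where g = "\<lambda>L s x y. if P L s x y then 1 else 0" for P, folded loopable_pred_def]

section \<open>Running time\<close>

primrec tower :: "nat \<Rightarrow> nat \<Rightarrow> nat" where
  "tower 0 x = x"
| "tower (Suc m) x = 2 ^ tower m x"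

text \<open>Repeated doubling, as the machine has no multiplication. The result replaces cell 0 of
  bank 3, where \<open>compile\<close> expects the loop length.\<close>

definition exp_prog :: com where
  "exp_prog = Seq (Store 3 (Const 1) (Cell 3 (Const 0)))
     (Seq (Store 3 (Const 0) (Const 1))
       (WHILE (Cell 3 (Const 1))
         (Seq (Store 3 (Const 0) (Add (Cell 3 (Const 0)) (Cell 3 (Const 0))))
              (Store 3 (Const 1) (Sub (Cell 3 (Const 1)) (Const 1))))))"

primrec tower_prog :: "nat \<Rightarrow> com" where
  "tower_prog 0 = SKIP"
| "tower_prog (Suc m) = Seq (tower_prog m) exp_prog"

lemma runs_exp_prog:
  "runs exp_prog s (16 * s 3 0 + 10) (\<lambda>s'. s' 3 0 = 2 ^ s 3 0 \<and> (\<forall>a. a \<noteq> 3 \<longrightarrow> s' a = s a))"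
proof -
  define x where "x = s 3 0"
  define Inv where "Inv i s' \<longleftrightarrow> s' 3 0 = 2 ^ i \<and> s' 3 1 = x - i \<and> (\<forall>a. a \<noteq> 3 \<longrightarrow> s' a = s a)" for i s'
  have loop: "runs (WHILE (Cell 3 (Const 1))
         (Seq (Store 3 (Const 0) (Add (Cell 3 (Const 0)) (Cell 3 (Const 0))))
              (Store 3 (Const 1) (Sub (Cell 3 (Const 1)) (Const 1))))) s1 (16 * x + 3) (Inv x)"
    if "Inv 0 s1" for s1
  proof (rule runs_WHILE[where Inv = Inv and m = x and tc = 13, OF that])
    fix i s' assume "Inv i s'" "i < x"
    moreover have "runs (Seq (Store 3 (Const 0) (Add (Cell 3 (Const 0)) (Cell 3 (Const 0))))
              (Store 3 (Const 1) (Sub (Cell 3 (Const 1)) (Const 1)))) s' 13 (Inv (Suc i))"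
      by (rule runs_Store_Seq[where t' = 6], rule runs_Store)
         (use calculation in \<open>auto simp: Inv_def\<close>)
    ultimately show "eval (Cell 3 (Const 1)) s' \<noteq> 0 \<and>
      runs (Seq (Store 3 (Const 0) (Add (Cell 3 (Const 0)) (Cell 3 (Const 0))))
              (Store 3 (Const 1) (Sub (Cell 3 (Const 1)) (Const 1)))) s' 13 (Inv (Suc i))"
      by (auto simp: Inv_def)
  qed (auto simp: Inv_def)
  show ?thesis
    unfolding exp_prog_def x_def[symmetric]
    apply (rule runs_Store_Seq[where t' = "16 * x + 6"])
     apply (rule runs_Store_Seq[where t' = "16 * x + 3"])
      apply (rule runs_weaken[OF loop])
        apply (auto simp: Inv_def x_def)
    done
qed

lemma tower_le_Suc: "tower m x \<le> tower (Suc m) x"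
  using less_exp[of "tower m x"] by simp

text \<open>Moves a constant into the argument, so that the time bound gets the form accepted by
  \<open>computable_tower\<close>.\<close>

lemma tower_add: "tower m x + c \<le> tower m (x + c)"
proof (induction m)
  case (Suc m)
  have "2 ^ tower m x + c \<le> 2 ^ tower m x * 2 ^ c"
  proof -
    have "1 + c \<le> 2 ^ c" using Suc_leI[OF less_exp[of c]] by simp
    then have "2 ^ tower m x * (1 + c) \<le> 2 ^ tower m x * 2 ^ c" by (rule mult_le_mono2)
    moreover have "2 ^ tower m x + c \<le> 2 ^ tower m x * (1 + c)" by simp
    ultimately show ?thesis by (rule order_trans[rotated])
  qed
  also have "\<dots> = 2 ^ (tower m x + c)" by (simp add: power_add)
  also have "\<dots> \<le> 2 ^ tower m (x + c)" using Suc by simp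
  finally show ?case by simp
qed simp

lemma runs_tower_prog:
  "runs (tower_prog m) s (m * (16 * tower m (s 3 0) + 10) + 1)
     (\<lambda>s'. s' 3 0 = tower m (s 3 0) \<and> (\<forall>a. a \<noteq> 3 \<longrightarrow> s' a = s a))"
proof (induction m)
  case 0
  have "exec SKIP s 1 s" by (rule exec.Skip)
  then show ?case by (auto simp: runs_def)
next
  case (Suc m)
  show ?case
    unfolding tower_prog.simps
  proof (rule runs_Seq[OF Suc])
    fix s1 assume s1: "s1 3 0 = tower m (s 3 0) \<and> (\<forall>a. a \<noteq> 3 \<longrightarrow> s1 a = s a)"
    show "runs exp_prog s1 (16 * tower m (s 3 0) + 10)
      (\<lambda>s'. s' 3 0 = tower (Suc m) (s 3 0) \<and> (\<forall>a. a \<noteq> 3 \<longrightarrow> s' a = s a))"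
      by (rule runs_weaken[OF runs_exp_prog]) (use s1 in auto)
  next
    have "(m + 1) * (16 * tower m (s 3 0) + 10) \<le> (m + 1) * (16 * tower (Suc m) (s 3 0) + 10)"
      by (intro mult_le_mono2 add_le_mono1) (use tower_le_Suc in auto)
    then show "m * (16 * tower m (s 3 0) + 10) + 1 + (16 * tower m (s 3 0) + 10)
      \<le> Suc m * (16 * tower (Suc m) (s 3 0) + 10) + 1" by simp
  qed
qed

lemma computable_tower: "computable (\<lambda>x. tower m (x + c))"
proof -
  let ?p = "Seq (Store 3 (Const 0) (Add (Cell 0 (Const 0)) (Const c)))
    (Seq (tower_prog m) (Store 0 (Const 0) (Cell 3 (Const 0))))"
  let ?s = "\<lambda>x a i. if a = 0 \<and> i = 0 then x else 0 :: nat"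
  have "runs ?p (?s x) (5 + 1 + (m * (16 * tower m (x + c) + 10) + 1 + 4))
    (\<lambda>s. s 0 0 = tower m (x + c))" for x
    apply (rule runs_Store_Seq[where t' = "m * (16 * tower m (x + c) + 10) + 1 + 4"])
     apply (rule runs_Seq[where ?t1.0 = "m * (16 * tower m (x + c) + 10) + 1" and ?t2.0 = 4])
       apply (rule runs_weaken[OF runs_tower_prog])
        apply assumption
       apply simp
      apply (rule runs_Store)
       apply auto
    done
  then show ?thesis unfolding computable_def runs_def by blast
qed

text \<open>\<open>(y + 3) ^ m\<close> is at most \<open>2 ^ ((y + 2) * m)\<close>, and the second
  exponential absorbs the product in the exponent. So a polynomial in a tower is bounded by a tower
  with two more levels.\<close>

lemma poly_le_double_exp:
  "\<exists>c. \<forall>y. K * (y + 3) ^ m \<le> 2 ^ (2 ^ (y + c :: nat) :: nat)" for K m :: nat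
proof (intro exI allI)
  fix y :: nat
  have s: "Suc z \<le> 2 ^ z" for z :: nat by (rule Suc_leI[OF less_exp])
  have "K * (y + 3) ^ m \<le> 2 ^ K * (2 ^ (y + 2)) ^ m"
    using s[of "y + 2"] by (intro mult_le_mono power_mono) (auto intro: less_imp_le[OF less_exp])
  also have "\<dots> = 2 ^ (K + (y + 2) * m)" by (simp only: power_add power_mult)
  also have "\<dots> \<le> 2 ^ (2 ^ (y + (K + m + 2)))"
  proof (rule power_increasing)
    have "K + (y + 2) * m \<le> Suc K * (Suc (y + 2) * Suc m)" by (simp add: algebra_simps)
    also have "\<dots> \<le> 2 ^ K * (2 ^ (y + 2) * 2 ^ m)" using s by (intro mult_le_mono)
    also have "\<dots> = 2 ^ (y + (K + m + 2))" by (simp add: power_add algebra_simps)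
    finally show "K + (y + 2) * m \<le> 2 ^ (y + (K + m + 2))" .
  qed simp
  finally show "K * (y + 3) ^ m \<le> 2 ^ (2 ^ (y + (K + m + 2)))" .
qed

text \<open>The program first computes the loop length and then runs the compiled term, in time
  polynomial in that length. The length is a sum of a parameter part and \<open>len x\<close>;
  bounding this sum by a product of the two separates the factors of the fpt bound.\<close>

lemma fpt_loopable:
  assumes alg: "loopable (\<lambda>L s e. alg L s)"
    and enc: "\<And>x. x \<in> I \<Longrightarrow> enc x 0 0 + enc x 0 2 = \<kappa> x" "\<And>x. x \<in> I \<Longrightarrow> enc x 0 1 = len x"
    and correct: "\<And>x. x \<in> I \<Longrightarrow> alg (tower m (\<kappa> x + c0) + len x + 1) (enc x) = (if P x then 1 else 0)"
  shows "fpt I P enc \<kappa> len"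
proof -
  obtain t where t: "tval t = (\<lambda>L s e. alg L s)" using alg by (rule loopableE)
  obtain K d where Kd: "\<And>L. tcost t L \<le> K * (L + 1) ^ d"
    using tcost_poly_bounded[of t] by (auto simp: poly_bounded_def)
  \<comment> \<open>\<open>alg\<close> does not read the environment, so every variable may point to
    cell 0. The value appears in cell 1 and is copied to the output cell.\<close>
  let ?prog = "Seq (Store 3 (Const 0) (Add (Cell 0 (Const 0)) (Add (Cell 0 (Const 2)) (Const c0))))
    (Seq (tower_prog m)
    (Seq (Store 3 (Const 0) (Add (Cell 3 (Const 0)) (Add (Cell 0 (Const 1)) (Const 1))))
    (Seq (compile t (\<lambda>_. 0) 1) (Store 0 (Const 0) (Cell 3 (Const 1))))))"
  \<comment> \<open>The sum of all coefficients in the running time. With exponent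
    \<open>d + 1\<close> the bound covers the term linear in \<open>y\<close> even if
    \<open>d = 0\<close>.\<close>
  define M where "M = 16 * m + 10 * m + 34 + K"
  obtain c where c: "\<And>y. M * (y + 3) ^ (d + 1) \<le> 2 ^ (2 ^ (y + c :: nat) :: nat)"
    using poly_le_double_exp by blast
  show ?thesis
    unfolding fpt_def
  proof (rule exI[of _ ?prog], rule exI[of _ "\<lambda>x. tower (m + 2) (x + (c0 + c))"],
      rule exI[of _ "d + 1"], intro conjI ballI)
    show "computable (\<lambda>x. tower (m + 2) (x + (c0 + c)))" by (rule computable_tower)
  next
    fix x assume x: "x \<in> I"
    define y where "y = tower m (\<kappa> x + c0)"
    define L where "L = y + len x + 1"
    have k: "enc x 0 0 + (enc x 0 2 + c0) = \<kappa> x + c0" using enc[OF x] by simp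
    define r :: nat where r: "r = (if P x then 1 else 0)"
    have enc1: "enc x 0 (Suc 0) = len x" using enc(2)[OF x] by simp
    have run: "runs ?prog (enc x) (9 + (m * (16 * y + 10) + 1 + (9 + (tcost t L + 4))))
      (\<lambda>s. s 0 0 = r)"
      apply (rule runs_Store_Seq[where t' = "m * (16 * y + 10) + 1 + (9 + (tcost t L + 4))"])
       apply (rule runs_Seq[where ?t1.0 = "m * (16 * y + 10) + 1" and ?t2.0 = "9 + (tcost t L + 4)"])
         apply (rule runs_weaken[OF runs_tower_prog])
          apply assumption
         apply (simp add: k y_def)
        apply (rule runs_Store_Seq[where t' = "tcost t L + 4"])
         apply (rule runs_Seq[where ?t1.0 = "tcost t L" and ?t2.0 = 4])
           apply (rule compile_correct[where L = L and ?s0.0 = "enc x"])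
              apply (simp_all add: k enc1 L_def y_def)
      apply (rule runs_Store)
       apply (simp_all add: t r correct[OF x, simplified])
      done
    let ?N = "max 1 (len x)"
    have "9 + (m * (16 * y + 10) + 1 + (9 + (tcost t L + 4)))
      \<le> (16 * m * (y + 3) + 10 * m + 34) + K * (L + 1) ^ d"
      using Kd[of L] by (simp add: algebra_simps)
    also have "\<dots> \<le> M * ((y + 3) * ?N) ^ (d + 1)"
    proof -
      let ?Y = "((y + 3) * ?N) ^ (d + 1)"
      have N1: "1 \<le> ?N" by simp
      have yN: "y + 3 \<le> (y + 3) * ?N" using mult_le_mono2[OF N1, of "y + 3"] by simp
      have a: "y + 3 \<le> ?Y"
        using yN self_le_power[of "(y + 3) * ?N" "d + 1"] by simp
      have "L + 1 \<le> (y + 3) * ?N"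
      proof -
        have "(y + 2) * 1 \<le> (y + 2) * ?N" by (rule mult_le_mono2[OF N1])
        then show ?thesis unfolding L_def by (simp only: add_mult_distrib)
      qed
      then have "(L + 1) ^ d \<le> ((y + 3) * ?N) ^ d" by (rule power_mono) simp
      also have "\<dots> \<le> ?Y" by (rule power_increasing) (use yN in auto)
      finally have b: "K * (L + 1) ^ d \<le> K * ?Y" by (rule mult_le_mono2)
      have "16 * m * (y + 3) \<le> 16 * m * ?Y" using a by (rule mult_le_mono2)
      moreover have "10 * m + 34 \<le> (10 * m + 34) * ?Y" using a by simp
      ultimately show ?thesis using b unfolding M_def by (simp only: add_mult_distrib)
    qed
    also have "\<dots> = M * (y + 3) ^ (d + 1) * ?N ^ (d + 1)" by (simp only: power_mult_distrib mult.assoc)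
    also have "\<dots> \<le> tower (m + 2) (\<kappa> x + (c0 + c)) * ?N ^ (d + 1)"
    proof (rule mult_le_mono1)
      have "M * (y + 3) ^ (d + 1) \<le> 2 ^ (2 ^ (y + c))" by (rule c)
      also have "\<dots> \<le> 2 ^ (2 ^ tower m (\<kappa> x + c0 + c))"
        unfolding y_def using tower_add[of m "\<kappa> x + c0" c] by simp
      finally show "M * (y + 3) ^ (d + 1) \<le> tower (m + 2) (\<kappa> x + (c0 + c))"
        by (simp add: add.assoc)
    qed
    finally have le: "9 + (m * (16 * y + 10) + 1 + (9 + (tcost t L + 4)))
      \<le> tower (m + 2) (\<kappa> x + (c0 + c)) * ?N ^ (d + 1)" .
    show "\<exists>t s. exec ?prog (enc x) t s \<and> s 0 0 = (if P x then 1 else 0) \<and>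
      t \<le> tower (m + 2) (\<kappa> x + (c0 + c)) * ?N ^ (d + 1)"
      using run le unfolding runs_def r by (meson order_trans)
  qed
qed

section \<open>Avoiding copies\<close>

text \<open>One map serves both graphs: for \<open>M \<subseteq> E\<close> it is an induced copy in
  \<open>E\<close> and in \<open>M\<close> at once. The vertex set \<open>T\<close> and the
  adjacency \<open>A\<close> are separate arguments because \<open>T\<close> is later cut down to
  the non-isolated vertices.\<close>

definition copy ::
  "'a set \<Rightarrow> ('a \<Rightarrow> 'a \<Rightarrow> bool) \<Rightarrow> 'v set set \<Rightarrow> 'v set set \<Rightarrow> 'v set \<Rightarrow> ('a \<Rightarrow> 'v) \<Rightarrow> bool" where
  "copy T A E M V \<phi> \<longleftrightarrow> \<phi> ` T \<subseteq> V \<and> inj_on \<phi> T \<and>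
     (\<forall>i\<in>T. \<forall>j\<in>T. {\<phi> i, \<phi> j} \<in> E \<longleftrightarrow> A i j) \<and> (\<forall>i\<in>T. \<forall>j\<in>T. A i j \<longrightarrow> {\<phi> i, \<phi> j} \<in> M)"

definition avoids ::
  "'a set \<Rightarrow> ('a \<Rightarrow> 'a \<Rightarrow> bool) \<Rightarrow> 'v set set \<Rightarrow> 'v set \<Rightarrow> 'v set set \<Rightarrow> bool" where
  "avoids T A E V M \<longleftrightarrow> \<not> (\<exists>\<phi>. copy T A E M V \<phi>)"

text \<open>Asking for exactly \<open>k\<close> edges is justified because subsets of solutions are
  solutions. \<open>V\<close> bounds both the selected edges and the copies while \<open>E\<close>
  stays fixed, so passing to a kernel only shrinks \<open>V\<close>.\<close>

definition solvable ::
  "'a set \<Rightarrow> ('a \<Rightarrow> 'a \<Rightarrow> bool) \<Rightarrow> 'v set set \<Rightarrow> nat \<Rightarrow> 'v set \<Rightarrow> bool" where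
  "solvable T A E k V \<longleftrightarrow> (\<exists>M \<subseteq> {e \<in> E. e \<subseteq> V}. card M = k \<and> avoids T A E V M)"

lemma avoids_mono: "avoids T A E V M \<Longrightarrow> M' \<subseteq> M \<Longrightarrow> V' \<subseteq> V \<Longrightarrow> avoids T A E V' M'"
  unfolding avoids_def copy_def by (meson subset_iff)

lemma finite_edges: "is_graph G \<Longrightarrow> finite (edges G)"
  unfolding is_graph_def by (rule finite_subset[of _ "Pow (verts G)"]) auto

lemma is_graph_induced: "is_graph G \<Longrightarrow> S \<subseteq> verts G \<Longrightarrow> is_graph (induced G S)"
  unfolding is_graph_def induced_def by (auto dest: finite_subset)

lemma isomorphic_card_edges:
  assumes "G \<simeq> H" "is_graph G" "is_graph H"
  shows "card (edges G) = card (edges H)"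
proof -
  obtain \<phi> where bij: "bij_betw \<phi> (verts G) (verts H)"
    and e: "\<forall>u\<in>verts G. \<forall>v\<in>verts G. {u, v} \<in> edges G \<longleftrightarrow> {\<phi> u, \<phi> v} \<in> edges H"
    using assms(1) by (auto simp: isomorphic_def)
  have G: "edges G \<subseteq> Pow (verts G)" "edges H \<subseteq> Pow (verts H)"
    using assms by (auto simp: is_graph_def)
  have "(`) \<phi> ` edges G = edges H"
  proof (intro equalityI subsetI)
    fix x assume "x \<in> (`) \<phi> ` edges G"
    then obtain y where y: "y \<in> edges G" "x = \<phi> ` y" by auto
    then have "card y = 2" "y \<subseteq> verts G" using assms(2) by (auto simp: is_graph_def)
    then obtain u v where "y = {u, v}" "u \<in> verts G" "v \<in> verts G" by (auto simp: card_2_iff)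
    then show "x \<in> edges H" using e y by auto
  next
    fix x assume x: "x \<in> edges H"
    then have "card x = 2" "x \<subseteq> verts H" using assms(3) by (auto simp: is_graph_def)
    then obtain u v where uv: "x = {u, v}" "u \<in> \<phi> ` verts G" "v \<in> \<phi> ` verts G"
      using bij by (auto simp: card_2_iff bij_betw_def)
    then obtain u' v' where "u = \<phi> u'" "v = \<phi> v'" "u' \<in> verts G" "v' \<in> verts G" by auto
    then show "x \<in> (`) \<phi> ` edges G" using e x uv(1)
      by (intro image_eqI[of _ _ "{u', v'}"]) auto
  qed
  moreover have "inj_on ((`) \<phi>) (edges G)"
    by (rule inj_on_subset[OF inj_on_image_Pow G(1)]) (use bij in \<open>auto simp: bij_betw_def\<close>)
  ultimately show ?thesis by (metis card_image)
qed

text \<open>\<open>H\<close> may lie anywhere between \<open>M\<close> and \<open>E\<close>, so the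
  lemma yields the copy in the subgraph and the copy in \<open>G\<close> alike.\<close>

lemma induced_isomorphic_if_copy:
  assumes F: "is_graph F" and c: "copy (verts F) (\<lambda>i j. {i, j} \<in> edges F) E M V \<phi>"
    and "M \<subseteq> edges H" "edges H \<subseteq> E"
  shows "induced H (\<phi> ` verts F) \<simeq> F"
proof -
  have bij: "bij_betw \<phi> (verts F) (\<phi> ` verts F)" using c by (auto simp: copy_def bij_betw_def)
  have inj: "inj_on \<phi> (verts F)" using c by (auto simp: copy_def)
  show ?thesis
    unfolding isomorphic_def
  proof (intro exI[of _ "inv_into (verts F) \<phi>"] conjI ballI)
    show "bij_betw (inv_into (verts F) \<phi>) (verts (induced H (\<phi> ` verts F))) (verts F)"
      using bij_betw_inv_into[OF bij] by (simp add: induced_def)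
  next
    fix u v assume "u \<in> verts (induced H (\<phi> ` verts F))" "v \<in> verts (induced H (\<phi> ` verts F))"
    then obtain i j where ij: "i \<in> verts F" "j \<in> verts F" "u = \<phi> i" "v = \<phi> j"
      by (auto simp: induced_def)
    moreover have "{\<phi> i, \<phi> j} \<in> edges H \<longleftrightarrow> {i, j} \<in> edges F"
      using c assms(3,4) ij unfolding copy_def by blast
    ultimately show "{u, v} \<in> edges (induced H (\<phi> ` verts F)) \<longleftrightarrow>
      {inv_into (verts F) \<phi> u, inv_into (verts F) \<phi> v} \<in> edges F"
      using inj by (simp add: induced_def)
  qed
qed

text \<open>
  If \<open>H \<subseteq> G\<close> and both induce copies of \<open>F\<close> on \<open>S\<close>, then these copies have equally many edges and
  hence coincide. So the closure condition is inherited by subsets of the edge set.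
\<close>

lemma strong_closure_iff_solvable:
  assumes F: "is_graph F" and G: "is_graph G"
  shows "strong_closure F G k \<longleftrightarrow>
    solvable (verts F) (\<lambda>i j. {i, j} \<in> edges F) (edges G) k (verts G)"
proof
  assume "strong_closure F G k"
  then obtain H where H: "spanning_subgraph H G" "satisfies_closure F G H" "k \<le> card (edges H)"
    by (auto simp: strong_closure_def)
  obtain M where M: "M \<subseteq> edges H" "card M = k" using H(3) by (meson obtain_subset_with_card_n)
  have HG: "edges H \<subseteq> edges G" "verts H = verts G" using H(1) by (auto simp: spanning_subgraph_def)
  have "avoids (verts F) (\<lambda>i j. {i, j} \<in> edges F) (edges G) (verts G) M"
    unfolding avoids_def
  proof
    assume "\<exists>\<phi>. copy (verts F) (\<lambda>i j. {i, j} \<in> edges F) (edges G) M (verts G) \<phi>"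
    then obtain \<phi> where \<phi>: "copy (verts F) (\<lambda>i j. {i, j} \<in> edges F) (edges G) M (verts G) \<phi>" by auto
    have "induced H (\<phi> ` verts F) \<simeq> F" "induced G (\<phi> ` verts F) \<simeq> F"
      using induced_isomorphic_if_copy[OF F \<phi>] M HG by auto
    moreover have "\<phi> ` verts F \<subseteq> verts H" using \<phi> HG by (auto simp: copy_def)
    ultimately show False using H(2) by (auto simp: satisfies_closure_def)
  qed
  moreover have "M \<subseteq> {e \<in> edges G. e \<subseteq> verts G}"
    using M HG G unfolding is_graph_def by blast
  ultimately show "solvable (verts F) (\<lambda>i j. {i, j} \<in> edges F) (edges G) k (verts G)"
    using M(2) by (auto simp: solvable_def)
next
  assume "solvable (verts F) (\<lambda>i j. {i, j} \<in> edges F) (edges G) k (verts G)"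
  then obtain M where M: "M \<subseteq> edges G" "card M = k"
    "avoids (verts F) (\<lambda>i j. {i, j} \<in> edges F) (edges G) (verts G) M" by (auto simp: solvable_def)
  define H where "H = \<lparr>verts = verts G, edges = M\<rparr>"
  have H: "is_graph H" "spanning_subgraph H G" "k \<le> card (edges H)" "verts H = verts G"
    using M G by (auto simp: H_def is_graph_def spanning_subgraph_def)
  have "satisfies_closure F G H"
    unfolding satisfies_closure_def
  proof (intro allI impI notI)
    fix S assume S: "S \<subseteq> verts H" "induced H S \<simeq> F" "induced G S \<simeq> F"
    have gr: "is_graph (induced H S)" "is_graph (induced G S)"
      using is_graph_induced[OF H(1) S(1)] is_graph_induced[OF G] S(1) H(4) by auto
    have "edges (induced H S) \<subseteq> edges (induced G S)" using M(1) by (auto simp: induced_def H_def)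
    moreover have "card (edges (induced H S)) = card (edges (induced G S))"
      using isomorphic_card_edges[OF S(2) gr(1) F] isomorphic_card_edges[OF S(3) gr(2) F] by simp
    ultimately have eq: "edges (induced H S) = edges (induced G S)"
      using card_subset_eq[OF finite_edges[OF gr(2)]] by blast
    obtain \<psi> where bij: "bij_betw \<psi> S (verts F)"
      and e: "\<forall>u\<in>S. \<forall>v\<in>S. {u, v} \<in> edges (induced G S) \<longleftrightarrow> {\<psi> u, \<psi> v} \<in> edges F"
      using S(3) by (auto simp: isomorphic_def induced_def)
    define \<phi> where "\<phi> = inv_into S \<psi>"
    have \<phi>: "bij_betw \<phi> (verts F) S" unfolding \<phi>_def by (rule bij_betw_inv_into[OF bij])
    have \<psi>\<phi>: "\<psi> (\<phi> i) = i" "\<phi> i \<in> S" if "i \<in> verts F" for i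
      using bij that \<phi> by (auto simp: \<phi>_def bij_betw_inv_into_right bij_betwE)
    have "copy (verts F) (\<lambda>i j. {i, j} \<in> edges F) (edges G) M (verts G) \<phi>"
      unfolding copy_def
    proof (intro conjI ballI impI)
      show "\<phi> ` verts F \<subseteq> verts G" using \<psi>\<phi> S(1) H(4) by auto
      show "inj_on \<phi> (verts F)" using \<phi> by (auto simp: bij_betw_def)
    next
      fix i j assume ij: "i \<in> verts F" "j \<in> verts F"
      show "{\<phi> i, \<phi> j} \<in> edges G \<longleftrightarrow> {i, j} \<in> edges F"
        using e[rule_format, of "\<phi> i" "\<phi> j"] \<psi>\<phi> ij by (simp add: induced_def)
      assume "{i, j} \<in> edges F"
      then have "{\<phi> i, \<phi> j} \<in> edges (induced H S)"
        using e[rule_format, of "\<phi> i" "\<phi> j"] \<psi>\<phi> ij eq by simp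
      then show "{\<phi> i, \<phi> j} \<in> M" by (simp add: induced_def H_def)
    qed
    then show False using M(3) by (auto simp: avoids_def)
  qed
  then show "strong_closure F G k" using H by (auto simp: strong_closure_def)
qed

text \<open>Without edges \<open>F\<close> is \<open>pK1 f\<close>; with one edge, sending its ends
  to \<open>p\<close> and \<open>p + 1\<close> gives \<open>pK1_plus_K2 p\<close>. The graph without
  vertices is ruled out by \<open>n0\<close>, since \<open>pK1 p\<close> is excluded only for
  \<open>p \<ge> 1\<close>.\<close>

lemma two_edges_if_excluded:
  assumes F: "is_input_graph F" and n0: "card (verts F) \<noteq> 0"
    and 1: "\<forall>p\<ge>1. \<not> F \<simeq> pK1 p" and 2: "\<forall>p. \<not> F \<simeq> pK1_plus_K2 p"
  shows "\<exists>e\<in>edges F. \<exists>e'\<in>edges F. e \<noteq> e'"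
proof (rule ccontr)
  assume "\<not> ?thesis"
  then have uniq: "\<And>e e'. e \<in> edges F \<Longrightarrow> e' \<in> edges F \<Longrightarrow> e = e'" by blast
  define f where "f = card (verts F)"
  have V: "verts F = {..<f}" "edges F \<subseteq> {e. e \<subseteq> {..<f} \<and> card e = 2}"
    using F by (auto simp: is_input_graph_def is_graph_def f_def)
  show False
  proof (cases "edges F = {}")
    case True
    have "F \<simeq> pK1 f" unfolding isomorphic_def
      by (intro exI[of _ id]) (auto simp: pK1_def V True)
    then show False using 1 n0 by (auto simp: f_def)
  next
    case False
    then obtain e where e: "edges F = {e}" using uniq by blast
    then obtain a b where ab: "e = {a, b}" "a \<noteq> b" "a < f" "b < f" using V by (auto simp: card_2_iff)
    define p where "p = f - 2"
    have fp: "f = p + 2" using ab by (auto simp: p_def)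
    have "card ({..<f} - {a, b}) = card {..<p}" using ab fp by (simp add: card_Diff_subset)
    then obtain g where g: "bij_betw g ({..<f} - {a, b}) {..<p}"
      using finite_same_card_bij[of "{..<f} - {a, b}" "{..<p}"] by auto
    define h where "h x = (if x = a then p else if x = b then p + 1 else g x)" for x
    have "bij_betw h ({..<f} - {a, b}) {..<p}"
      using g by (rule bij_betw_cong[THEN iffD1, rotated]) (auto simp: h_def)
    moreover have "bij_betw h {a, b} {p, p + 1}" using ab by (auto simp: bij_betw_def h_def inj_on_def)
    ultimately have "bij_betw h (({..<f} - {a, b}) \<union> {a, b}) ({..<p} \<union> {p, p + 1})"
      by (rule bij_betw_combine) auto
    moreover have "({..<f} - {a, b}) \<union> {a, b} = {..<f}" "{..<p} \<union> {p, p + 1} = {..<p + 2}"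
      using ab by auto
    ultimately have h: "bij_betw h {..<f} {..<p + 2}" by simp
    have "F \<simeq> pK1_plus_K2 p" unfolding isomorphic_def
    proof (intro exI[of _ h] conjI ballI)
      show "bij_betw h (verts F) (verts (pK1_plus_K2 p))" using h V by (simp add: pK1_plus_K2_def)
    next
      fix u v assume uv: "u \<in> verts F" "v \<in> verts F"
      have gl: "g x < p" if "x < f" "x \<noteq> a" "x \<noteq> b" for x using g that by (auto simp: bij_betw_def)
      have "h x = p \<longleftrightarrow> x = a" "h x = p + 1 \<longleftrightarrow> x = b" if "x < f" for x
        using gl[of x] that ab(2) by (auto simp: h_def)
      then show "{u, v} \<in> edges F \<longleftrightarrow> {h u, h v} \<in> edges (pK1_plus_K2 p)"
        using uv V unfolding e ab(1) by (simp add: pK1_plus_K2_def doubleton_eq_iff)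
    qed
    then show False using 2 by blast
  qed
qed

section \<open>The first representatives of each type\<close>

text \<open>The representatives are chosen by the vertex order, so that membership can be decided by
  counting.\<close>

definition kept :: "('v \<Rightarrow> 't) \<Rightarrow> nat \<Rightarrow> 'v set \<Rightarrow> 'v::linorder \<Rightarrow> bool" where
  "kept ty D V v \<longleftrightarrow> card {u \<in> V. u < v \<and> ty u = ty v} < D"

lemma card_first:
  "finite (S :: 'v::linorder set) \<Longrightarrow> card {u \<in> S. card {w \<in> S. w < u} < D} = min D (card S)"
proof (induction S rule: finite_linorder_max_induct)
  case (insert b A)
  have "{u \<in> insert b A. card {w \<in> insert b A. w < u} < D} =
    {u \<in> A. card {w \<in> A. w < u} < D} \<union> (if card A < D then {b} else {})"
  proof -
    have "{w \<in> insert b A. w < u} = {w \<in> A. w < u}" if "u \<in> insert b A" for u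
      using insert(2) that by auto
    moreover have "{w \<in> A. w < b} = A" using insert(2) by auto
    ultimately show ?thesis by (auto cong: conj_cong)
  qed
  moreover have "b \<notin> A" using insert(2) by auto
  ultimately show ?case using insert by (auto simp: min_def)
qed simp

lemma kept_class:
  assumes "finite V"
  shows "card {u \<in> V. ty u = t \<and> kept ty D V u} = min D (card {u \<in> V. ty u = t})"
proof -
  have "{u \<in> V. ty u = t \<and> kept ty D V u} =
    {u \<in> {u \<in> V. ty u = t}. card {w \<in> {u \<in> V. ty u = t}. w < u} < D}"
  proof -
    have "{w \<in> {u \<in> V. ty u = t}. w < u} = {w \<in> V. w < u \<and> ty w = t}" for u by auto
    then show ?thesis by (auto simp: kept_def)
  qed
  then show ?thesis using card_first[of "{u \<in> V. ty u = t}" D] assms by simp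
qed

text \<open>The pool for exchanges: a dropped vertex has \<open>D\<close> kept vertices of its type
  that may take its place.\<close>

lemma card_kept_same_type:
  assumes "finite V" "v \<in> V" "\<not> kept ty D V v"
  shows "card {u \<in> V. ty u = ty v \<and> kept ty D V u} = D"
proof -
  have "D \<le> card {u \<in> V. u < v \<and> ty u = ty v}" using assms(3) by (simp add: kept_def)
  also have "\<dots> \<le> card {u \<in> V. ty u = ty v}" by (rule card_mono) (use assms in auto)
  finally show ?thesis using kept_class[OF assms(1), of ty "ty v" D] by simp
qed

lemma card_kept:
  assumes "finite V"
  shows "card {v \<in> V. kept ty D V v} \<le> D * card (ty ` V)"
proof -
  have "{v \<in> V. kept ty D V v} = (\<Union>t \<in> ty ` V. {u \<in> V. ty u = t \<and> kept ty D V u})" by auto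
  also have "card \<dots> \<le> (\<Sum>t \<in> ty ` V. card {u \<in> V. ty u = t \<and> kept ty D V u})"
    by (rule card_UN_le) (use assms in auto)
  also have "\<dots> \<le> (\<Sum>t \<in> ty ` V. D)" by (rule sum_mono) (simp add: kept_class[OF assms])
  finally show ?thesis by (simp add: mult.commute)
qed

section \<open>Patterns with a vertex of degree at least two\<close>

locale finite_graph =
  fixes V :: "'v::linorder set" and E :: "'v set set"
  assumes finite_V: "finite V" and E_subset: "E \<subseteq> {e. e \<subseteq> V \<and> card e = 2}"
begin

lemma finite_E: "finite E"
  by (rule finite_subset[of _ "Pow V"]) (use E_subset finite_V in auto)

lemma no_loop: "{v} \<notin> E"
  using E_subset by force

lemma edge_verts: "{u, v} \<in> E \<Longrightarrow> u \<in> V \<and> v \<in> V \<and> u \<noteq> v"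
  using E_subset by force

lemma edgeE:
  assumes "e \<in> E" obtains u v where "e = {u, v}" "u \<in> V" "v \<in> V" "u \<noteq> v"
  using assms E_subset by (auto simp: card_2_iff)

lemma card_Union_edges: "M \<subseteq> E \<Longrightarrow> card (\<Union>M) \<le> 2 * card M"
proof -
  assume M: "M \<subseteq> E"
  have "card (\<Union>M) \<le> sum card M" by (rule card_Union_le_sum_card)
  also have "\<dots> = (\<Sum>e\<in>M. 2)" by (rule sum.cong) (use M E_subset in auto)
  finally show ?thesis by simp
qed

lemma finite_Union_edges: "M \<subseteq> E \<Longrightarrow> finite (\<Union>M)"
  by (rule finite_subset[OF _ finite_V]) (use E_subset in auto)

lemma solvableI:
  assumes "M \<subseteq> E" "card M = k" "avoids T A E V M"
  shows "solvable T A E k V"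
proof -
  have "M \<subseteq> {e \<in> E. e \<subseteq> V}" using assms(1) E_subset by auto
  then show ?thesis using assms(2,3) by (auto simp: solvable_def)
qed

section \<open>Neighbourhoods and exchange of false twins\<close>

definition nbrs :: "'v \<Rightarrow> 'v set" where
  "nbrs v = {u \<in> V. {u, v} \<in> E}"

lemma in_nbrs_iff: "u \<in> nbrs v \<longleftrightarrow> {u, v} \<in> E"
  using edge_verts by (auto simp: nbrs_def)

lemma finite_nbrs: "finite (nbrs v)"
  using finite_V by (auto simp: nbrs_def)

lemma twin_adjacent: "nbrs v = nbrs w \<Longrightarrow> {u, v} \<in> E \<longleftrightarrow> {u, w} \<in> E"
  using in_nbrs_iff by blast

text \<open>Without loops, adjacent vertices have different neighbourhoods. So twins are
  non-adjacent and swapping them is an automorphism.\<close>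

lemma transpose_twins:
  assumes "nbrs v = nbrs w"
  shows "{transpose v w x, transpose v w y} \<in> E \<longleftrightarrow> {x, y} \<in> E"
proof -
  have a: "{x, v} \<in> E \<longleftrightarrow> {x, w} \<in> E" for x by (rule twin_adjacent[OF assms])
  have b: "{v, y} \<in> E \<longleftrightarrow> {w, y} \<in> E" for y using a[of y] by (simp only: insert_commute)
  have "{v, w} \<notin> E" "{w, v} \<notin> E" "{v, v} \<notin> E" "{w, w} \<notin> E"
    using a[of v] a[of w] no_loop by simp_all
  then show ?thesis unfolding transpose_def using a[of x] b[of y] by (smt (verit))
qed

definition twin_kernel :: "nat \<Rightarrow> 'v set" where
  "twin_kernel D = {v \<in> V. kept nbrs D V v}"

text \<open>A touched vertex outside the kernel is swapped with a kept twin that no selected edge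
  meets. An automorphism creates no copies, and one vertex fewer is touched outside the
  kernel.\<close>

lemma solution_into_twin_kernel:
  assumes "M \<subseteq> E" "avoids T A E V M" "2 * card M \<le> D"
  shows "\<exists>M' \<subseteq> E. card M' = card M \<and> avoids T A E V M' \<and> \<Union>M' \<subseteq> twin_kernel D"
  using assms
proof (induction "card (\<Union>M - twin_kernel D)" arbitrary: M rule: less_induct)
  case less
  show ?case
  proof (cases "\<Union>M \<subseteq> twin_kernel D")
    case True
    then show ?thesis using less.prems by blast
  next
    case False
    then obtain v where v: "v \<in> \<Union>M" "v \<notin> twin_kernel D" by blast
    then have vV: "v \<in> V" using less.prems E_subset by auto
    then have nk: "\<not> kept nbrs D V v" using v by (auto simp: twin_kernel_def)
    define Tw where "Tw = {u \<in> V. nbrs u = nbrs v \<and> kept nbrs D V u}"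
    have Tw: "card Tw = D" unfolding Tw_def by (rule card_kept_same_type[OF finite_V vV nk])
    have finU: "finite (\<Union>M)" by (rule finite_Union_edges[OF less.prems(1)])
    \<comment> \<open>\<open>v\<close> is touched and not in \<open>Tw\<close>. If all
      \<open>D\<close> kept twins were touched too, more than \<open>D \<ge> 2 * card M\<close>
      vertices would be.\<close>
    have "\<not> Tw \<subseteq> \<Union>M"
    proof
      assume "Tw \<subseteq> \<Union>M"
      moreover have "v \<notin> Tw" using nk by (auto simp: Tw_def)
      ultimately have "Tw \<subset> \<Union>M" using v by auto
      then have "card Tw < card (\<Union>M)" by (rule psubset_card_mono[OF finU])
      then show False using Tw card_Union_edges[OF less.prems(1)] less.prems(3) by simp
    qed
    then obtain w where w: "w \<in> Tw" "w \<notin> \<Union>M" by blast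
    then have wK: "w \<in> twin_kernel D" and wv: "nbrs v = nbrs w"
      by (auto simp: Tw_def twin_kernel_def)
    define \<tau> where "\<tau> = transpose v w"
    have inv: "\<tau> (\<tau> x) = x" for x by (simp add: \<tau>_def)
    have inv': "\<tau> ` \<tau> ` X = X" for X by (simp add: image_image inv)
    define M' where "M' = (`) \<tau> ` M"
    have M'E: "M' \<subseteq> E"
    proof
      fix e assume "e \<in> M'"
      then obtain e' where e': "e' \<in> E" "e = \<tau> ` e'" using less.prems(1) by (auto simp: M'_def)
      then obtain x y where "e' = {x, y}" by (auto elim: edgeE)
      then show "e \<in> E" using e' transpose_twins[OF wv, of x y] by (simp add: \<tau>_def)
    qed
    have card: "card M' = card M" unfolding M'_def
      by (rule card_image) (metis inj_onI inv')
    have "avoids T A E V M'"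
      unfolding avoids_def
    proof
      assume "\<exists>\<phi>. copy T A E M' V \<phi>"
      then obtain \<phi> where \<phi>: "copy T A E M' V \<phi>" by auto
      have "copy T A E M V (\<tau> \<circ> \<phi>)"
        unfolding copy_def
      proof (intro conjI ballI impI)
        show "(\<tau> \<circ> \<phi>) ` T \<subseteq> V"
          using \<phi> vV w by (auto simp: copy_def \<tau>_def transpose_def Tw_def)
        show "inj_on (\<tau> \<circ> \<phi>) T"
          using \<phi> inv unfolding copy_def inj_on_def o_def by metis
      next
        fix i j assume ij: "i \<in> T" "j \<in> T"
        show "{(\<tau> \<circ> \<phi>) i, (\<tau> \<circ> \<phi>) j} \<in> E \<longleftrightarrow> A i j"
          using \<phi> ij transpose_twins[OF wv, of "\<phi> i" "\<phi> j"] by (simp add: copy_def \<tau>_def)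
        assume "A i j"
        then have "{\<phi> i, \<phi> j} \<in> M'" using \<phi> ij by (auto simp: copy_def)
        then obtain e where e: "e \<in> M" "{\<phi> i, \<phi> j} = \<tau> ` e" by (auto simp: M'_def)
        have "{\<tau> (\<phi> i), \<tau> (\<phi> j)} = \<tau> ` {\<phi> i, \<phi> j}" by simp
        also have "\<dots> = e" unfolding e(2) by (rule inv')
        finally show "{(\<tau> \<circ> \<phi>) i, (\<tau> \<circ> \<phi>) j} \<in> M" using e(1) by simp
      qed
      then show False using less.prems(2) by (auto simp: avoids_def)
    qed
    moreover have "card (\<Union>M' - twin_kernel D) < card (\<Union>M - twin_kernel D)"
    proof (rule psubset_card_mono)
      show "finite (\<Union>M - twin_kernel D)" using finU by auto
      have "\<Union>M' \<subseteq> insert w (\<Union>M - {v})"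
        using w(2) by (auto simp: M'_def \<tau>_def transpose_def)
      then show "\<Union>M' - twin_kernel D \<subset> \<Union>M - twin_kernel D" using wK v by blast
    qed
    ultimately show ?thesis using less.hyps[of M'] M'E card less.prems(3) by metis
  qed
qed

text \<open>Edges of the pattern go to \<open>M\<close>, hence into the kernel. Only isolated
  vertices can be mapped outside; each moves to a kept twin that is not occupied by the rest of the
  copy, which has fewer than \<open>D\<close> vertices.\<close>

lemma copy_into_twin_kernel:
  assumes "copy T A E M V \<phi>" "finite T" "card T \<le> D" "\<Union>M \<subseteq> twin_kernel D"
  shows "\<exists>\<phi>. copy T A E M (twin_kernel D) \<phi>"
  using assms(1)
proof (induction "card {i \<in> T. \<phi> i \<notin> twin_kernel D}" arbitrary: \<phi> rule: less_induct)
  case less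
  show ?case
  proof (cases "\<phi> ` T \<subseteq> twin_kernel D")
    case True
    then show ?thesis using less.prems by (auto simp: copy_def)
  next
    case False
    then obtain i where i: "i \<in> T" "\<phi> i \<notin> twin_kernel D" by blast
    have iso: "\<not> A i j" "\<not> A j i" if "j \<in> T" for j
      using less.prems i that assms(4) unfolding copy_def by blast+
    have vV: "\<phi> i \<in> V" using less.prems i by (auto simp: copy_def)
    define Tw where "Tw = {u \<in> V. nbrs u = nbrs (\<phi> i) \<and> kept nbrs D V u}"
    have Tw: "card Tw = D"
      unfolding Tw_def by (rule card_kept_same_type[OF finite_V vV])
        (use i vV in \<open>auto simp: twin_kernel_def\<close>)
    have TwK: "Tw \<subseteq> twin_kernel D" by (auto simp: Tw_def twin_kernel_def)
    have "\<not> Tw \<subseteq> \<phi> ` (T - {i})"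
    proof
      assume "Tw \<subseteq> \<phi> ` (T - {i})"
      then have "card Tw \<le> card (\<phi> ` (T - {i}))" by (rule card_mono[rotated]) (use assms in auto)
      also have "\<dots> \<le> card (T - {i})" by (rule card_image_le) (use assms in auto)
      also have "\<dots> < card T" using i assms(2) by (meson card_Diff1_less)
      finally show False using Tw assms(3) by simp
    qed
    then obtain w where w: "w \<in> Tw" "w \<notin> \<phi> ` (T - {i})" by blast
    then have wv: "nbrs w = nbrs (\<phi> i)" by (auto simp: Tw_def)
    have "copy T A E M V (\<phi>(i := w))"
      unfolding copy_def
    proof (intro conjI ballI impI)
      show "\<phi>(i := w) ` T \<subseteq> V" using less.prems w by (auto simp: copy_def Tw_def)
      show "inj_on (\<phi>(i := w)) T"
        using less.prems w unfolding copy_def inj_on_def by (auto simp: image_iff)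
    next
      fix a b assume ab: "a \<in> T" "b \<in> T"
      have "{x, w} \<in> E \<longleftrightarrow> {x, \<phi> i} \<in> E" "{w, x} \<in> E \<longleftrightarrow> {\<phi> i, x} \<in> E" for x
        using twin_adjacent[OF wv, of x] by (simp_all add: insert_commute)
      then show "{(\<phi>(i := w)) a, (\<phi>(i := w)) b} \<in> E \<longleftrightarrow> A a b"
        using less.prems ab iso no_loop[of "\<phi> i"] i(1) unfolding copy_def by auto
      assume "A a b"
      then show "{(\<phi>(i := w)) a, (\<phi>(i := w)) b} \<in> M"
        using less.prems ab iso unfolding copy_def by auto
    qed
    moreover have "card {j \<in> T. (\<phi>(i := w)) j \<notin> twin_kernel D} < card {j \<in> T. \<phi> j \<notin> twin_kernel D}"
      by (rule psubset_card_mono) (use i w TwK assms(2) in auto)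
    ultimately show ?thesis using less.hyps by blast
  qed
qed

lemma twin_kernel_solvable_iff:
  assumes "finite T" "card T \<le> D" "2 * k \<le> D"
  shows "solvable T A E k (twin_kernel D) \<longleftrightarrow> solvable T A E k V"
proof
  assume "solvable T A E k (twin_kernel D)"
  then obtain M where M: "M \<subseteq> {e \<in> E. e \<subseteq> twin_kernel D}" "card M = k" "avoids T A E (twin_kernel D) M"
    by (auto simp: solvable_def)
  then have "avoids T A E V M"
    using copy_into_twin_kernel[OF _ assms(1,2), of A M] unfolding avoids_def by blast
  then show "solvable T A E k V" using M by (intro solvableI[of M]) auto
next
  assume "solvable T A E k V"
  then obtain M where M: "M \<subseteq> E" "card M = k" "avoids T A E V M" by (auto simp: solvable_def)
  then obtain M' where "M' \<subseteq> E" "card M' = k" "avoids T A E V M'" "\<Union>M' \<subseteq> twin_kernel D"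
    using solution_into_twin_kernel[of M T A D] assms by auto
  moreover from this have "avoids T A E (twin_kernel D) M'"
    by (elim avoids_mono) (auto simp: twin_kernel_def)
  ultimately show "solvable T A E k (twin_kernel D)"
    unfolding solvable_def by (intro exI[of _ M']) auto
qed

text \<open>Two edges at \<open>i\<close> would become two different selected edges that share
  \<open>\<phi> i\<close>.\<close>

lemma solvable_if_matching:
  assumes "M \<subseteq> E" "pairwise disjnt M" "k \<le> card M"
    and "i \<in> T" "j \<in> T" "j' \<in> T" "A i j" "A i j'" "j \<noteq> j'"
  shows "solvable T A E k V"
proof -
  obtain M' where M': "M' \<subseteq> M" "card M' = k" using assms(3) by (meson obtain_subset_with_card_n)
  have "avoids T A E V M'"
    unfolding avoids_def
  proof
    assume "\<exists>\<phi>. copy T A E M' V \<phi>"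
    then obtain \<phi> where \<phi>: "copy T A E M' V \<phi>" by auto
    then have "{\<phi> i, \<phi> j} \<in> M" "{\<phi> i, \<phi> j'} \<in> M" "\<phi> j \<noteq> \<phi> j'"
      using assms M' unfolding copy_def inj_on_def by blast+
    then show False using assms(2) unfolding pairwise_def disjnt_def
      by (metis IntI doubleton_eq_iff empty_iff insertI1)
  qed
  then show ?thesis using M' assms(1) by (intro solvableI[of M']) auto
qed

text \<open>Otherwise a maximum matching has fewer than \<open>k\<close> edges, and its at most
  \<open>2 * k\<close> ends cover all edges. Every other vertex has its neighbourhood inside the
  cover, so there are at most \<open>2 * k + 2 ^ (2 * k)\<close> twin classes with at most
  \<open>D\<close> kept vertices each.\<close>

lemma solvable_if_large_twin_kernel:
  assumes "D * (2 * k + 2 ^ (2 * k)) < card (twin_kernel D)"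
    and "i \<in> T" "j \<in> T" "j' \<in> T" "A i j" "A i j'" "j \<noteq> j'"
  shows "solvable T A E k V"
proof (rule ccontr)
  assume no: "\<not> solvable T A E k V"
  define \<M> where "\<M> = {M. M \<subseteq> E \<and> pairwise disjnt M}"
  have small: "card M < k" if "M \<in> \<M>" for M
    using solvable_if_matching[of M k i T j j' A] that no assms(2-) by (force simp: \<M>_def)
  have "finite (card ` \<M>)" "card ` \<M> \<noteq> {}"
    using finite_E by (auto simp: \<M>_def intro!: exI[of _ "{}"])
  then obtain M where M: "M \<in> \<M>" "card M = Max (card ` \<M>)" using Max_in by (metis imageE)
  then have max: "card M' \<le> card M" if "M' \<in> \<M>" for M'
    using \<open>finite (card ` \<M>)\<close> that by simp
  have ME: "M \<subseteq> E" and dis: "pairwise disjnt M" using M by (auto simp: \<M>_def)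
  have hit: "e \<inter> \<Union>M \<noteq> {}" if e: "e \<in> E" for e
  proof
    assume d: "e \<inter> \<Union>M = {}"
    have "e \<noteq> {}" using e E_subset by auto
    then have "e \<notin> M" using d by auto
    then have "card (insert e M) = Suc (card M)" using finite_subset[OF ME finite_E] by simp
    moreover have "insert e M \<in> \<M>"
      using ME e dis d by (auto simp: \<M>_def pairwise_insert disjnt_def)
    ultimately show False using max[of "insert e M"] by simp
  qed
  have Z: "finite (\<Union>M)" "card (\<Union>M) \<le> 2 * k"
    using card_Union_edges[OF ME] small[OF M(1)] finite_Union_edges[OF ME] by auto
  have "nbrs ` V \<subseteq> nbrs ` (\<Union>M) \<union> Pow (\<Union>M)"
  proof
    fix N assume "N \<in> nbrs ` V"
    then obtain v where v: "N = nbrs v" by auto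
    show "N \<in> nbrs ` (\<Union>M) \<union> Pow (\<Union>M)"
    proof (cases "v \<in> \<Union>M")
      case False
      then have "nbrs v \<subseteq> \<Union>M" using hit in_nbrs_iff[of _ v] by blast
      then show ?thesis using v by auto
    qed (use v in auto)
  qed
  then have "card (nbrs ` V) \<le> card (nbrs ` (\<Union>M) \<union> Pow (\<Union>M))"
    by (rule card_mono[rotated]) (use Z in auto)
  also have "\<dots> \<le> card (nbrs ` (\<Union>M)) + card (Pow (\<Union>M))" by (rule card_Un_le)
  also have "\<dots> \<le> 2 * k + 2 ^ (2 * k)"
  proof (rule add_mono)
    show "card (nbrs ` (\<Union>M)) \<le> 2 * k" using card_image_le[OF Z(1), of nbrs] Z(2) by simp
    show "card (Pow (\<Union>M)) \<le> 2 ^ (2 * k)" using Z by (simp add: card_Pow)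
  qed
  finally have "card (twin_kernel D) \<le> D * (2 * k + 2 ^ (2 * k))"
    unfolding twin_kernel_def using card_kept[OF finite_V, of nbrs D]
    by (meson mult_le_mono2 order_trans)
  then show False using assms(1) by simp
qed

text \<open>All edges of a star at \<open>u\<close> contain \<open>u\<close>. In a copy, two edges
  of the pattern would share the preimage of \<open>u\<close>, which \<open>deg\<close>
  forbids.\<close>

lemma solvable_if_large_degree:
  assumes u: "u \<in> V" "k \<le> card (nbrs u)"
    and deg: "\<And>i j j'. i \<in> T \<Longrightarrow> j \<in> T \<Longrightarrow> j' \<in> T \<Longrightarrow> A i j \<Longrightarrow> A i j' \<Longrightarrow> j = j'"
    and sym: "\<And>i j. A i j \<Longrightarrow> A j i"
    and two: "i \<in> T" "j \<in> T" "A i j" "i' \<in> T" "j' \<in> T" "A i' j'" "{i, j} \<noteq> {i', j'}"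
  shows "solvable T A E k V"
proof -
  obtain W where W: "W \<subseteq> nbrs u" "card W = k" using u by (meson obtain_subset_with_card_n)
  define M where "M = (\<lambda>w. {w, u}) ` W"
  have "card M = k" unfolding M_def using W(2)
    by (subst card_image) (auto simp: inj_on_def doubleton_eq_iff)
  moreover have "M \<subseteq> E" using W(1) by (auto simp: M_def in_nbrs_iff)
  moreover have "avoids T A E V M"
    unfolding avoids_def
  proof
    assume "\<exists>\<phi>. copy T A E M V \<phi>"
    then obtain \<phi> where \<phi>: "copy T A E M V \<phi>" by auto
    have "{\<phi> i, \<phi> j} \<in> M" "{\<phi> i', \<phi> j'} \<in> M" using \<phi> two unfolding copy_def by blast+
    then have "\<phi> i = u \<or> \<phi> j = u" "\<phi> i' = u \<or> \<phi> j' = u" by (auto simp: M_def doubleton_eq_iff)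
    then have "i = i' \<or> i = j' \<or> j = i' \<or> j = j'"
      using \<phi> two unfolding copy_def inj_on_def by metis
    then show False
      using deg[of i j j'] deg[of i j i'] deg[of j i j'] deg[of j i i'] sym[of i j] sym[of i' j'] two
      unfolding doubleton_eq_iff by blast
  qed
  ultimately show ?thesis by (intro solvableI)
qed

end

section \<open>Graphs of bounded degree\<close>

context finite_graph
begin

text \<open>A step may stand still, so this is distance at most \<open>r\<close>.\<close>

primrec reach :: "nat \<Rightarrow> 'v \<Rightarrow> 'v \<Rightarrow> bool" where
  "reach 0 u v \<longleftrightarrow> u = v"
| "reach (Suc r) u v \<longleftrightarrow> (\<exists>w. reach r u w \<and> (w = v \<or> {w, v} \<in> E))"

lemma reach_in_V: "reach r u v \<Longrightarrow> u \<in> V \<Longrightarrow> v \<in> V"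
  by (induction r arbitrary: v) (auto dest: edge_verts)

lemma reach_mono: "reach r u v \<Longrightarrow> r \<le> r' \<Longrightarrow> reach r' u v"
  by (induction r' rule: nat_induct) (auto simp: le_Suc_eq)

lemma reach_refl: "reach r u u"
  by (induction r) auto

lemma reach_Suc_left: "{u, w} \<in> E \<or> u = w \<Longrightarrow> reach r w v \<Longrightarrow> reach (Suc r) u v"
proof (induction r arbitrary: v)
  case 0
  then show ?case by auto
next
  case (Suc r)
  then obtain x where "reach r w x" "x = v \<or> {x, v} \<in> E" by auto
  then show ?case using Suc.IH[OF Suc.prems(1)] by (auto simp del: reach.simps(2) simp: reach.simps(2)[of "Suc r"])
qed

lemma reach_sym: "reach r u v \<Longrightarrow> reach r v u"
proof (induction r arbitrary: v)
  case (Suc r)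
  then obtain w where "reach r u w" "w = v \<or> {w, v} \<in> E" by auto
  then show ?case using Suc.IH[of w] by (intro reach_Suc_left[of v w]) (auto simp: insert_commute)
qed simp

text \<open>Connectivity by all edges of \<open>E\<close> inside \<open>U\<close>, selected or not:
  copies are induced, so a part may be moved only if no edge of \<open>E\<close> joins it to the
  rest of \<open>U\<close>.\<close>

definition component :: "'v set \<Rightarrow> 'v \<Rightarrow> 'v set" where
  "component U x = {y. (x, y) \<in> {(a, b). a \<in> U \<and> b \<in> U \<and> {a, b} \<in> E}\<^sup>*}"

lemma component_self: "x \<in> component U x"
  by (simp add: component_def)

lemma component_subset:
  assumes "x \<in> U" shows "component U x \<subseteq> U"
proof
  fix y assume "y \<in> component U x"
  then have "(x, y) \<in> {(a, b). a \<in> U \<and> b \<in> U \<and> {a, b} \<in> E}\<^sup>*" by (simp add: component_def)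
  then show "y \<in> U" by (induction rule: rtrancl_induct) (use assms in auto)
qed

lemma component_closed:
  assumes "x \<in> U" "a \<in> component U x" "b \<in> U" "{a, b} \<in> E"
  shows "b \<in> component U x"
proof -
  have "a \<in> U" using component_subset assms by auto
  then have "(a, b) \<in> {(a, b). a \<in> U \<and> b \<in> U \<and> {a, b} \<in> E}" using assms by auto
  then show ?thesis using assms(2) unfolding component_def by (simp add: rtrancl_into_rtrancl)
qed

text \<open>A path needs no more steps than the relation has pairs. This is the origin of
  \<open>(2 * k) * (2 * k) \<le> R\<close> below, where \<open>U\<close> consists of the at most
  \<open>2 * k\<close> touched vertices.\<close>

lemma component_reach:
  assumes "finite U" "y \<in> component U x"
  shows "reach (card U * card U) x y"
proof -
  let ?R = "{(a, b). a \<in> U \<and> b \<in> U \<and> {a, b} \<in> E}"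
  have sub: "?R \<subseteq> U \<times> U" by auto
  then have fin: "finite ?R" using assms(1) finite_subset by blast
  have card: "card ?R \<le> card U * card U"
    using card_mono[OF _ sub] assms(1) by (simp add: card_cartesian_product)
  obtain n where n: "n \<le> card ?R" "(x, y) \<in> ?R ^^ n"
    using assms(2) unfolding component_def rtrancl_finite_eq_relpow[OF fin] by auto
  have "(x, y) \<in> ?R ^^ n \<Longrightarrow> reach n x y" for n y
  proof (induction n arbitrary: y)
    case (Suc n)
    then show ?case by auto
  qed simp
  from this[OF n(2)] show ?thesis by (rule reach_mono) (use n(1) card in simp)
qed

lemma copy_subset:
  assumes "copy T A E M W \<phi>" "S \<subseteq> T" "\<phi> ` S \<subseteq> W'"
  shows "copy S A E M W' \<phi>"
proof -
  have "inj_on \<phi> S" using assms inj_on_subset[of \<phi> T S] by (simp add: copy_def)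
  then show ?thesis using assms(1,3) subsetD[OF assms(2)] by (simp add: copy_def)
qed

text \<open>Greedy placement: a placed vertex blocks itself and its fewer than \<open>k\<close>
  neighbours, so at most \<open>card T * k\<close> vertices are ever blocked.\<close>

lemma extend_copy:
  assumes T: "finite T" "S \<subseteq> T" and \<phi>: "copy S A E M W \<phi>" and W: "W \<subseteq> V" "card T * k < card W"
    and deg: "\<And>v. v \<in> V \<Longrightarrow> card (nbrs v) < k"
    and iso: "\<And>i j. i \<in> T - S \<Longrightarrow> j \<in> T \<Longrightarrow> \<not> A i j \<and> \<not> A j i"
  shows "\<exists>\<phi>. copy T A E M W \<phi>"
proof -
  have "finite U \<Longrightarrow> U \<subseteq> T - S \<Longrightarrow> \<exists>\<phi>. copy (S \<union> U) A E M W \<phi>" for U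
  proof (induction U rule: finite_induct)
    case empty
    then show ?case using \<phi> by auto
  next
    case (insert i U)
    then obtain \<phi> where \<phi>: "copy (S \<union> U) A E M W \<phi>" by auto
    define B where "B = (\<Union>x\<in>\<phi> ` (S \<union> U). insert x (nbrs x))"
    have sub: "S \<union> U \<subseteq> T" using insert.prems T by auto
    have fin: "finite (S \<union> U)" by (rule finite_subset[OF sub T(1)])
    have im: "\<phi> ` (S \<union> U) \<subseteq> V" using \<phi> W(1) by (auto simp: copy_def)
    have "card B \<le> (\<Sum>x\<in>\<phi> ` (S \<union> U). card (insert x (nbrs x)))"
      unfolding B_def by (rule card_UN_le) (use fin in auto)
    also have "\<dots> \<le> (\<Sum>x\<in>\<phi> ` (S \<union> U). k)"
    proof (rule sum_mono)
      fix x assume "x \<in> \<phi> ` (S \<union> U)"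
      then have "card (nbrs x) < k" using deg im by blast
      then show "card (insert x (nbrs x)) \<le> k" using finite_nbrs[of x] by (simp add: card_insert_if)
    qed
    also have "\<dots> \<le> card T * k"
      using card_image_le[OF fin, of \<phi>] card_mono[OF T(1) sub] by simp
    finally have "card B < card W" using W(2) by simp
    moreover have "finite B" using fin finite_nbrs by (auto simp: B_def)
    ultimately have "\<not> W \<subseteq> B" by (meson card_mono leD)
    then obtain w where w: "w \<in> W" "w \<notin> B" by blast
    have i: "i \<notin> S \<union> U" "i \<in> T - S" using insert by auto
    have nadj: "{w, \<phi> j} \<notin> E" "{\<phi> j, w} \<notin> E" "\<phi> j \<noteq> w" if "j \<in> S \<union> U" for j
    proof -
      have "w \<noteq> \<phi> j" "w \<notin> nbrs (\<phi> j)" using w(2) that by (auto simp: B_def)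
      then show "{w, \<phi> j} \<notin> E" "{\<phi> j, w} \<notin> E" "\<phi> j \<noteq> w"
        using in_nbrs_iff[of w "\<phi> j"] by (auto simp: insert_commute)
    qed
    have "copy (insert i (S \<union> U)) A E M W (\<phi>(i := w))"
      unfolding copy_def
    proof (intro conjI ballI impI)
      show "\<phi>(i := w) ` insert i (S \<union> U) \<subseteq> W" using \<phi> w i by (auto simp: copy_def)
      show "inj_on (\<phi>(i := w)) (insert i (S \<union> U))"
        using \<phi> nadj(3) i unfolding copy_def inj_on_def by auto
    next
      fix a b assume ab: "a \<in> insert i (S \<union> U)" "b \<in> insert i (S \<union> U)"
      have niso: "\<not> A i j" "\<not> A j i" if "j \<in> insert i (S \<union> U)" for j
        using iso[OF i(2), of j] that sub i by auto
      consider "a \<in> S \<union> U" "b \<in> S \<union> U" | "a = i" | "b = i" using ab by auto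
      then have "({(\<phi>(i := w)) a, (\<phi>(i := w)) b} \<in> E \<longleftrightarrow> A a b) \<and>
        (A a b \<longrightarrow> {(\<phi>(i := w)) a, (\<phi>(i := w)) b} \<in> M)"
      proof cases
        case 1
        then have "a \<noteq> i" "b \<noteq> i" using i by auto
        then show ?thesis using \<phi> 1 by (simp add: copy_def)
      next
        case 2
        then show ?thesis using niso[OF ab(2)] nadj[of b] ab(2) no_loop[of w] by auto
      next
        case 3
        then show ?thesis using niso[OF ab(1)] nadj[of a] ab(1) no_loop[of w] by auto
      qed
      then show "{(\<phi>(i := w)) a, (\<phi>(i := w)) b} \<in> E \<longleftrightarrow> A a b"
        and "A a b \<Longrightarrow> {(\<phi>(i := w)) a, (\<phi>(i := w)) b} \<in> M" by auto
    qed
    then show ?case by auto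
  qed
  from this[of "T - S"] T show ?thesis by (simp add: Un_absorb1)
qed

text \<open>
  A copy in the moved solution is pulled back along the inverse of \<open>\<theta>\<close>. Edges between \<open>\<theta> ` X\<close> and the
  rest do no harm, as they are not selected, so the copy does not use them.
\<close>

lemma transplant:
  assumes M: "M \<subseteq> E" and X: "X \<subseteq> \<Union>M" and closed: "\<And>a b. a \<in> X \<Longrightarrow> b \<in> \<Union>M \<Longrightarrow> {a, b} \<in> E \<Longrightarrow> b \<in> X"
    and \<theta>: "inj_on \<theta> X" "\<theta> ` X \<inter> \<Union>M = {}"
      "\<And>x y. x \<in> X \<Longrightarrow> y \<in> X \<Longrightarrow> {\<theta> x, \<theta> y} \<in> E \<longleftrightarrow> {x, y} \<in> E"
    and S: "\<And>i. i \<in> S \<Longrightarrow> \<exists>j\<in>S. A i j" and av: "avoids S A E V M"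
  shows "\<exists>M' \<subseteq> E. card M' = card M \<and> avoids S A E V M' \<and> \<Union>M' \<subseteq> (\<Union>M - X) \<union> \<theta> ` X"
proof -
  define M1 where "M1 = {e \<in> M. \<not> e \<subseteq> X}"
  define M2 where "M2 = {e \<in> M. e \<subseteq> X}"
  define M' where "M' = M1 \<union> (`) \<theta> ` M2"
  \<comment> \<open>As \<open>X\<close> is closed within \<open>\<Union>M\<close>, a selected edge
    that meets \<open>X\<close> lies inside \<open>X\<close>.\<close>
  have M1: "e \<inter> X = {}" if e: "e \<in> M1" for e
  proof -
    have "e \<in> E" using e M by (auto simp: M1_def)
    then obtain a b where ab: "e = {a, b}" "{a, b} \<in> E" "{b, a} \<in> E"
      by (metis edgeE insert_commute)
    then have "a \<in> \<Union>M" "b \<in> \<Union>M" using e by (auto simp: M1_def)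
    then show ?thesis using closed[of a b] closed[of b a] ab e by (auto simp: M1_def)
  qed
  have M'E: "M' \<subseteq> E"
  proof
    fix e assume "e \<in> M'"
    then consider "e \<in> M1" | e' where "e' \<in> M2" "e = \<theta> ` e'" by (auto simp: M'_def)
    then show "e \<in> E"
    proof cases
      case 1 then show ?thesis using M by (auto simp: M1_def)
    next
      case 2
      then have "e' \<in> E" "e' \<subseteq> X" using M by (auto simp: M2_def)
      then obtain a b where "e' = {a, b}" "{a, b} \<in> E" "a \<in> X" "b \<in> X"
        by (metis edgeE insert_subset)
      then show ?thesis using 2 \<theta>(3)[of a b] by simp
    qed
  qed
  have fin: "finite M1" "finite M2"
    using finite_subset[OF M finite_E] by (auto simp: M1_def M2_def)
  have ne: "e \<noteq> {}" if "e \<in> M" for e using that M E_subset by auto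
  have "card M' = card M1 + card ((`) \<theta> ` M2)"
    unfolding M'_def
  proof (rule card_Un_disjoint)
    have "\<theta> ` e \<notin> M1" if "e \<in> M2" for e
    proof
      assume "\<theta> ` e \<in> M1"
      then have "\<theta> ` e \<subseteq> \<Union>M" by (auto simp: M1_def)
      moreover have "e \<noteq> {}" "\<theta> ` e \<subseteq> \<theta> ` X" using that ne by (auto simp: M2_def)
      ultimately show False using \<theta>(2) by blast
    qed
    then show "M1 \<inter> (`) \<theta> ` M2 = {}" by auto
  qed (use fin in auto)
  also have "card ((`) \<theta> ` M2) = card M2"
    by (rule card_image, rule inj_on_subset[OF inj_on_image_Pow[OF \<theta>(1)]]) (auto simp: M2_def)
  also have "card M1 + card M2 = card (M1 \<union> M2)"
    by (rule card_Un_disjoint[symmetric]) (use fin in \<open>auto simp: M1_def M2_def\<close>)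
  also have "M1 \<union> M2 = M" by (auto simp: M1_def M2_def)
  finally have card: "card M' = card M" .
  have UM': "\<Union>M' \<subseteq> (\<Union>M - X) \<union> \<theta> ` X"
    using M1 by (auto simp: M'_def M2_def) (auto simp: M1_def)
  define \<beta> where "\<beta> x = (if x \<in> \<theta> ` X then inv_into X \<theta> x else x)" for x
  have \<beta>\<theta>: "\<beta> (\<theta> x) = x" if "x \<in> X" for x using that \<theta>(1) by (simp add: \<beta>_def)
  have \<beta>U: "\<beta> x = x" if "x \<in> \<Union>M - X" for x using that \<theta>(2) by (auto simp: \<beta>_def)
  have "avoids S A E V M'"
    unfolding avoids_def
  proof
    assume "\<exists>\<phi>. copy S A E M' V \<phi>"
    then obtain \<phi> where \<phi>: "copy S A E M' V \<phi>" by auto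
    \<comment> \<open>No vertex of \<open>S\<close> is isolated, so the whole copy lies on selected
      edges, where \<open>\<beta>\<close> is injective.\<close>
    have im: "\<phi> i \<in> (\<Union>M - X) \<union> \<theta> ` X" if i: "i \<in> S" for i
    proof -
      obtain j where "j \<in> S" "A i j" using S[OF i] by blast
      then have "{\<phi> i, \<phi> j} \<in> M'" using \<phi> i by (auto simp: copy_def)
      then show ?thesis using UM' by auto
    qed
    have "copy S A E M V (\<beta> \<circ> \<phi>)"
      unfolding copy_def
    proof (intro conjI ballI)
      have "\<Union>M \<subseteq> V" using M E_subset by auto
      then show "(\<beta> \<circ> \<phi>) ` S \<subseteq> V" using im \<beta>\<theta> \<beta>U X by fastforce
    next
      have "inj_on \<beta> ((\<Union>M - X) \<union> \<theta> ` X)"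
      proof (rule inj_on_inverseI[where g = "\<lambda>z. if z \<in> X then \<theta> z else z"])
        fix x assume "x \<in> (\<Union>M - X) \<union> \<theta> ` X"
        then consider "x \<in> \<Union>M - X" | y where "y \<in> X" "x = \<theta> y" by blast
        then show "(if \<beta> x \<in> X then \<theta> (\<beta> x) else \<beta> x) = x"
          by cases (simp_all add: \<beta>U \<beta>\<theta> del: Union_iff)
      qed
      moreover have "\<phi> ` S \<subseteq> (\<Union>M - X) \<union> \<theta> ` X" using im by blast
      ultimately have "inj_on \<beta> (\<phi> ` S)" by (rule inj_on_subset)
      then show "inj_on (\<beta> \<circ> \<phi>) S" using \<phi> unfolding copy_def by (intro comp_inj_on) auto
    next
      fix i j assume ij: "i \<in> S" "j \<in> S"
      have c: "{\<phi> i, \<phi> j} \<in> E \<longleftrightarrow> A i j" "A i j \<Longrightarrow> {\<phi> i, \<phi> j} \<in> M'"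
        using \<phi> ij by (auto simp: copy_def)
      \<comment> \<open>In the mixed cases this gives \<open>\<not> A i j\<close>; the pulled-back
        pair is then non-adjacent because \<open>X\<close> is closed.\<close>
      have mixed: "{x, \<theta> y} \<notin> M' \<and> {\<theta> y, x} \<notin> M'" if "x \<in> \<Union>M - X" "y \<in> X" for x y
      proof -
        have "x \<notin> \<theta> ` X" "\<theta> y \<notin> \<Union>M" using that \<theta>(2) by auto
        moreover have "e \<subseteq> \<Union>M \<or> e \<subseteq> \<theta> ` X" if "e \<in> M'" for e
          using that unfolding M'_def M1_def M2_def by blast
        ultimately show ?thesis by (metis insert_subset)
      qed
      have "({(\<beta> \<circ> \<phi>) i, (\<beta> \<circ> \<phi>) j} \<in> E \<longleftrightarrow> A i j) \<and> (A i j \<longrightarrow> {(\<beta> \<circ> \<phi>) i, (\<beta> \<circ> \<phi>) j} \<in> M)"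
      proof -
        consider (UU) "\<phi> i \<in> \<Union>M - X" "\<phi> j \<in> \<Union>M - X"
          | (UX) y where "\<phi> i \<in> \<Union>M - X" "\<phi> j = \<theta> y" "y \<in> X"
          | (XU) x where "\<phi> i = \<theta> x" "x \<in> X" "\<phi> j \<in> \<Union>M - X"
          | (XX) x y where "\<phi> i = \<theta> x" "x \<in> X" "\<phi> j = \<theta> y" "y \<in> X"
          using im[OF ij(1)] im[OF ij(2)] by blast
        then show ?thesis
        proof cases
          case UU
          have "{\<phi> i, \<phi> j} \<notin> (`) \<theta> ` M2"
          proof
            assume "{\<phi> i, \<phi> j} \<in> (`) \<theta> ` M2"
            then obtain e where "e \<subseteq> X" "{\<phi> i, \<phi> j} = \<theta> ` e" by (auto simp: M2_def)
            then have "\<phi> i \<in> \<theta> ` X" by blast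
            then show False using UU \<theta>(2) by blast
          qed
          then have "{\<phi> i, \<phi> j} \<in> M' \<Longrightarrow> {\<phi> i, \<phi> j} \<in> M" by (auto simp: M'_def M1_def)
          then show ?thesis using UU c \<beta>U by simp
        next
          case UX
          then have "\<not> A i j" using c mixed by metis
          moreover have "{\<phi> i, y} \<notin> E" using closed[of y "\<phi> i"] UX by (auto simp: insert_commute)
          ultimately show ?thesis using UX \<beta>U \<beta>\<theta> by simp
        next
          case XU
          then have "\<not> A i j" using c mixed by metis
          moreover have "{x, \<phi> j} \<notin> E" using closed[of x "\<phi> j"] XU by auto
          ultimately show ?thesis using XU \<beta>U \<beta>\<theta> by simp
        next
          case XX
          have "{x, y} \<in> M" if xy: "{\<theta> x, \<theta> y} \<in> M'"
          proof -
            have "{\<theta> x, \<theta> y} \<notin> M1" using XX \<theta>(2) by (auto simp: M1_def)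
            then obtain e where e: "e \<in> M2" "\<theta> ` {x, y} = \<theta> ` e" using xy by (auto simp: M'_def)
            then have "{x, y} = e"
              using inj_on_image_eq_iff[OF \<theta>(1), of "{x, y}" e] XX by (auto simp: M2_def)
            then show ?thesis using e by (auto simp: M2_def)
          qed
          then show ?thesis using XX c \<beta>\<theta> \<theta>(3)[of x y] by auto
        qed
      qed
      then show "{(\<beta> \<circ> \<phi>) i, (\<beta> \<circ> \<phi>) j} \<in> E \<longleftrightarrow> A i j"
        and "A i j \<longrightarrow> {(\<beta> \<circ> \<phi>) i, (\<beta> \<circ> \<phi>) j} \<in> M" by auto
    qed
    then show False using av by (auto simp: avoids_def)
  qed
  then show ?thesis using M'E card UM' by blast
qed

end

text \<open>
  The balls of radius \<open>R\<close> are enumerated by codes \<open>c \<in> C\<close> of walks. Two vertices have the same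
  type if matching codes give an isomorphism between the balls around them.
\<close>

locale bounded_degree_graph = finite_graph V E
  for V :: "'v::linorder set" and E :: "'v set set" +
  fixes k R :: nat and C :: "'c set" and walk :: "'v \<Rightarrow> 'c \<Rightarrow> 'v"
  assumes finite_C: "finite C"
    and ball: "\<And>w. w \<in> V \<Longrightarrow> walk w ` C = {v. reach R w v}"
    and degree: "\<And>v. v \<in> V \<Longrightarrow> card (nbrs v) < k"
    and radius: "(2 * k) * (2 * k) \<le> R"
begin

definition walk_type :: "'v \<Rightarrow> ('c \<times> 'c) set \<times> ('c \<times> 'c) set" where
  "walk_type w = ({(c, c') \<in> C \<times> C. walk w c = walk w c'}, {(c, c') \<in> C \<times> C. {walk w c, walk w c'} \<in> E})"

lemma walk_type_eq_iff:
  "walk_type u = walk_type w \<longleftrightarrow> (\<forall>c\<in>C. \<forall>c'\<in>C. (walk u c = walk u c' \<longleftrightarrow> walk w c = walk w c') \<and>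
    ({walk u c, walk u c'} \<in> E \<longleftrightarrow> {walk w c, walk w c'} \<in> E))"
  unfolding walk_type_def by (auto simp: set_eq_iff)

text \<open>A vertex may have several codes. Codes coincide around \<open>u\<close> exactly if they
  do around \<open>w\<close>, so sending the end of a walk to the end of the walk with the same code
  is well defined and injective.\<close>

lemma isomorphic_balls:
  assumes "walk_type u = walk_type w"
  obtains \<theta> where "bij_betw \<theta> (walk u ` C) (walk w ` C)"
    "\<And>x y. x \<in> walk u ` C \<Longrightarrow> y \<in> walk u ` C \<Longrightarrow> {\<theta> x, \<theta> y} \<in> E \<longleftrightarrow> {x, y} \<in> E"
proof -
  define \<theta> where "\<theta> x = walk w (SOME c. c \<in> C \<and> walk u c = x)" for x
  have \<theta>: "\<theta> (walk u c) = walk w c" if "c \<in> C" for c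
  proof -
    have "(SOME c'. c' \<in> C \<and> walk u c' = walk u c) \<in> C \<and>
      walk u (SOME c'. c' \<in> C \<and> walk u c' = walk u c) = walk u c"
      by (rule someI[of _ c]) (use that in auto)
    then show ?thesis using assms that unfolding \<theta>_def walk_type_eq_iff by blast
  qed
  show thesis
  proof (rule that[of \<theta>])
    show "bij_betw \<theta> (walk u ` C) (walk w ` C)"
      unfolding bij_betw_def
    proof
      show "inj_on \<theta> (walk u ` C)"
      proof (rule inj_onI)
        fix x y assume "x \<in> walk u ` C" "y \<in> walk u ` C" "\<theta> x = \<theta> y"
        then obtain c c' where "x = walk u c" "y = walk u c'" "c \<in> C" "c' \<in> C" "walk w c = walk w c'"
          using \<theta> by auto
        then show "x = y" using assms unfolding walk_type_eq_iff by blast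
      qed
      show "\<theta> ` walk u ` C = walk w ` C" using \<theta> by (auto simp: image_iff)
    qed
  next
    fix x y assume "x \<in> walk u ` C" "y \<in> walk u ` C"
    then obtain c c' where "x = walk u c" "y = walk u c'" "c \<in> C" "c' \<in> C" by auto
    then show "{\<theta> x, \<theta> y} \<in> E \<longleftrightarrow> {x, y} \<in> E"
      using assms \<theta> unfolding walk_type_eq_iff by simp
  qed
qed

text \<open>\<open>V0\<close> is the supply of arbitrary vertices for the isolated vertices of the
  pattern.\<close>

definition ball_kernel :: "'v set \<Rightarrow> nat \<Rightarrow> 'v set" where
  "ball_kernel V0 D = {v \<in> V. v \<in> V0 \<or> (\<exists>w\<in>V. kept walk_type D V w \<and> (\<exists>c\<in>C. walk w c = v))}"

lemma ball_subset_kernel: "w \<in> V \<Longrightarrow> kept walk_type D V w \<Longrightarrow> walk w ` C \<subseteq> ball_kernel V0 D"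
  using ball reach_in_V unfolding ball_kernel_def by blast

text \<open>A touched vertex \<open>x\<close> outside the kernel is not kept, since kept vertices
  bring their whole ball along. Its component fits into the ball of \<open>x\<close> and moves as a
  whole into the ball of a kept \<open>w\<close>, so fewer touched vertices lie outside.\<close>

lemma solution_into_ball_kernel:
  assumes "M \<subseteq> E" "avoids S A E V M" "card M \<le> k" "2 * k * card C < D"
    and S: "\<And>i. i \<in> S \<Longrightarrow> \<exists>j\<in>S. A i j"
  shows "\<exists>M' \<subseteq> E. card M' = card M \<and> avoids S A E V M' \<and> \<Union>M' \<subseteq> ball_kernel V0 D"
  using assms(1-3)
proof (induction "card (\<Union>M - ball_kernel V0 D)" arbitrary: M rule: less_induct)
  case less
  let ?K = "ball_kernel V0 D"
  show ?case
  proof (cases "\<Union>M \<subseteq> ?K")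
    case True
    then show ?thesis using less.prems by blast
  next
    case False
    then obtain x where x: "x \<in> \<Union>M" "x \<notin> ?K" by blast
    then have xV: "x \<in> V" using less.prems E_subset by auto
    have "x \<in> walk x ` C" using ball[OF xV] reach_refl by auto
    then have nk: "\<not> kept walk_type D V x" using x ball_subset_kernel[OF xV] by blast
    define Tw where "Tw = {u \<in> V. walk_type u = walk_type x \<and> kept walk_type D V u}"
    have Tw: "card Tw = D" unfolding Tw_def by (rule card_kept_same_type[OF finite_V xV nk])
    have finU: "finite (\<Union>M)" by (rule finite_Union_edges[OF less.prems(1)])
    have UV: "\<Union>M \<subseteq> V" using less.prems E_subset by auto
    have cardU: "card (\<Union>M) \<le> 2 * k" using card_Union_edges[OF less.prems(1)] less.prems(3) by simp
    \<comment> \<open>Fewer than \<open>D\<close> vertices are within distance \<open>R\<close> of a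
      touched one, so some kept vertex of the type of \<open>x\<close> is far from all of
      them.\<close>
    have "\<not> Tw \<subseteq> (\<Union>u\<in>\<Union>M. walk u ` C)"
    proof
      assume sub: "Tw \<subseteq> (\<Union>u\<in>\<Union>M. walk u ` C)"
      have "card Tw \<le> card (\<Union>u\<in>\<Union>M. walk u ` C)"
        by (rule card_mono[OF finite_UN_I[OF finU finite_imageI[OF finite_C]] sub])
      also have "\<dots> \<le> (\<Sum>u\<in>\<Union>M. card (walk u ` C))" by (rule card_UN_le[OF finU])
      also have "\<dots> \<le> (\<Sum>u\<in>\<Union>M. card C)" by (rule sum_mono) (use finite_C card_image_le in auto)
      also have "\<dots> \<le> 2 * k * card C" using cardU by simp
      finally show False using Tw assms(4) by simp
    qed
    then obtain w where w: "w \<in> Tw" "w \<notin> (\<Union>u\<in>\<Union>M. walk u ` C)" by blast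
    then have wV: "w \<in> V" and wk: "kept walk_type D V w" and tw: "walk_type x = walk_type w"
      by (auto simp: Tw_def)
    \<comment> \<open>By symmetry of \<open>reach\<close>: \<open>w\<close> is in no ball around a
      touched vertex, so its own ball contains none.\<close>
    have disj: "walk w ` C \<inter> \<Union>M = {}"
    proof (rule ccontr)
      assume "walk w ` C \<inter> \<Union>M \<noteq> {}"
      then obtain u where u: "u \<in> walk w ` C" "u \<in> \<Union>M" by blast
      then have "reach R u w" using ball[OF wV] reach_sym by auto
      then have "w \<in> walk u ` C" using ball[of u] u UV by auto
      then show False using w(2) u by blast
    qed
    obtain \<theta> where \<theta>: "bij_betw \<theta> (walk x ` C) (walk w ` C)"
      "\<And>a b. a \<in> walk x ` C \<Longrightarrow> b \<in> walk x ` C \<Longrightarrow> {\<theta> a, \<theta> b} \<in> E \<longleftrightarrow> {a, b} \<in> E"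
      using isomorphic_balls[OF tw] by blast
    define X where "X = component (\<Union>M) x"
    have XU: "X \<subseteq> \<Union>M" and xX: "x \<in> X"
      unfolding X_def using component_subset[OF x(1)] component_self by auto
    have XB: "X \<subseteq> walk x ` C"
    proof
      fix y assume "y \<in> X"
      then have "reach (card (\<Union>M) * card (\<Union>M)) x y" unfolding X_def by (rule component_reach[OF finU])
      moreover have "card (\<Union>M) * card (\<Union>M) \<le> R"
        using mult_le_mono[OF cardU cardU] radius by linarith
      ultimately show "y \<in> walk x ` C" using ball[OF xV] reach_mono by auto
    qed
    have "\<theta> ` X \<subseteq> \<theta> ` walk x ` C" by (rule image_mono[OF XB])
    then have im: "\<theta> ` X \<subseteq> walk w ` C" using \<theta>(1) by (simp add: bij_betw_def)
    have "\<exists>M' \<subseteq> E. card M' = card M \<and> avoids S A E V M' \<and> \<Union>M' \<subseteq> (\<Union>M - X) \<union> \<theta> ` X"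
    proof (rule transplant[OF less.prems(1) XU])
      show "\<And>a b. a \<in> X \<Longrightarrow> b \<in> \<Union>M \<Longrightarrow> {a, b} \<in> E \<Longrightarrow> b \<in> X"
        unfolding X_def by (rule component_closed[OF x(1)])
      show "inj_on \<theta> X" by (rule inj_on_subset[OF bij_betw_imp_inj_on[OF \<theta>(1)] XB])
      show "\<theta> ` X \<inter> \<Union>M = {}" using im disj by blast
      show "\<And>a b. a \<in> X \<Longrightarrow> b \<in> X \<Longrightarrow> {\<theta> a, \<theta> b} \<in> E \<longleftrightarrow> {a, b} \<in> E"
        by (rule \<theta>(2)) (use XB in auto)
    qed (use S less.prems in auto)
    then obtain M' where M': "M' \<subseteq> E" "card M' = card M" "avoids S A E V M'"
      "\<Union>M' \<subseteq> (\<Union>M - X) \<union> \<theta> ` X" by blast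
    have "\<theta> ` X \<subseteq> ?K" using im ball_subset_kernel[OF wV wk] by blast
    then have "\<Union>M' - ?K \<subset> \<Union>M - ?K" using M'(4) xX x by blast
    then have "card (\<Union>M' - ?K) < card (\<Union>M - ?K)" by (rule psubset_card_mono[rotated]) (use finU in auto)
    from less.hyps[OF this M'(1,3)] M'(2) less.prems(3) show ?thesis by simp
  qed
qed

text \<open>Unless \<open>V0 = V\<close>, both the kernel and \<open>V\<close> have more than
  \<open>card T * k\<close> vertices, so in either a copy of the non-isolated part \<open>S\<close>
  extends to a copy of \<open>T\<close>. This transfers the exchange from \<open>S\<close> to
  \<open>T\<close>.\<close>

lemma ball_kernel_solvable_iff:
  assumes T: "finite T" and sym: "\<And>i j. A i j \<Longrightarrow> A j i" and D: "2 * k * card C < D"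
    and V0: "V0 \<subseteq> V" "V0 = V \<or> card T * k < card V0"
  shows "solvable T A E k (ball_kernel V0 D) \<longleftrightarrow> solvable T A E k V"
proof (cases "V0 = V")
  case True
  then have "ball_kernel V0 D = V" by (auto simp: ball_kernel_def)
  then show ?thesis by simp
next
  case False
  let ?K = "ball_kernel V0 D"
  have KV: "V0 \<subseteq> ?K" "?K \<subseteq> V" using V0 by (auto simp: ball_kernel_def)
  have "card V0 \<le> card ?K" "card ?K \<le> card V"
    using KV finite_V by (meson card_mono finite_subset)+
  then have cardK: "card T * k < card ?K" "card T * k < card V" using V0 False by auto
  define S where "S = {i \<in> T. \<exists>j\<in>T. A i j}"
  have S: "\<exists>j\<in>S. A i j" if "i \<in> S" for i using that sym by (auto simp: S_def)
  have iso: "\<not> A i j \<and> \<not> A j i" if "i \<in> T - S" "j \<in> T" for i j using that sym by (auto simp: S_def)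
  have ST: "S \<subseteq> T" by (auto simp: S_def)
  have extend: "\<exists>\<phi>. copy T A E M W \<phi>"
    if "copy S A E M W \<phi>" "W \<subseteq> V" "card T * k < card W" for M W \<phi>
    by (rule extend_copy[OF T ST that degree iso])
  have restrict: "copy S A E M W \<phi>" if c: "copy T A E M V \<phi>" and W: "\<Union>M \<subseteq> W" for M W \<phi>
  proof (rule copy_subset[OF c ST])
    show "\<phi> ` S \<subseteq> W"
    proof
      fix x assume "x \<in> \<phi> ` S"
      then obtain i j where "x = \<phi> i" "i \<in> T" "j \<in> T" "A i j" by (auto simp: S_def)
      then have "{x, \<phi> j} \<in> M" using c by (simp add: copy_def)
      then show "x \<in> W" using W by auto
    qed
  qed
  show ?thesis
  proof
    assume "solvable T A E k ?K"
    then obtain M where M: "M \<subseteq> {e \<in> E. e \<subseteq> ?K}" "card M = k" "avoids T A E ?K M"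
      by (auto simp: solvable_def)
    have "avoids T A E V M"
      unfolding avoids_def
    proof
      assume "\<exists>\<phi>. copy T A E M V \<phi>"
      then obtain \<phi> where "copy S A E M ?K \<phi>" using restrict[of M _ ?K] M(1) by blast
      from extend[OF this KV(2) cardK(1)] show False using M(3) by (simp add: avoids_def)
    qed
    then show "solvable T A E k V" using M by (intro solvableI[of M]) auto
  next
    assume "solvable T A E k V"
    then obtain M where M: "M \<subseteq> E" "card M = k" "avoids T A E V M" by (auto simp: solvable_def)
    have "avoids S A E V M"
      using extend[OF _ order_refl cardK(2)] M(3) unfolding avoids_def by blast
    then obtain M' where M': "M' \<subseteq> E" "card M' = k" "avoids S A E V M'" "\<Union>M' \<subseteq> ?K"
      using solution_into_ball_kernel[where ?V0.0 = V0, OF M(1) \<open>avoids S A E V M\<close> _ D S] M(2) by auto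
    have "avoids T A E ?K M'"
      unfolding avoids_def
    proof
      assume "\<exists>\<phi>. copy T A E M' ?K \<phi>"
      then obtain \<phi> where \<phi>: "copy T A E M' ?K \<phi>" by auto
      have "copy S A E M' V \<phi>"
        by (rule copy_subset[OF \<phi> ST]) (use ST KV(2) \<phi> in \<open>auto simp: copy_def\<close>)
      then show False using M'(3) by (auto simp: avoids_def)
    qed
    then show "solvable T A E k ?K" using M' unfolding solvable_def by (intro exI[of _ M']) auto
  qed
qed

text \<open>A type is a pair of subsets of \<open>C \<times> C\<close>, and a ball has at most
  \<open>card C\<close> vertices.\<close>

lemma card_ball_kernel:
  "card (ball_kernel V0 D) \<le> card (V0 \<inter> V) + D * (2 ^ (card C * card C) * 2 ^ (card C * card C)) * card C"
proof -
  let ?K = "{v \<in> V. kept walk_type D V v}"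
  have "ball_kernel V0 D \<subseteq> (V0 \<inter> V) \<union> (\<Union>w\<in>?K. walk w ` C)" by (auto simp: ball_kernel_def)
  then have "card (ball_kernel V0 D) \<le> card ((V0 \<inter> V) \<union> (\<Union>w\<in>?K. walk w ` C))"
    by (rule card_mono[rotated]) (use finite_V finite_C in auto)
  also have "\<dots> \<le> card (V0 \<inter> V) + card (\<Union>w\<in>?K. walk w ` C)" by (rule card_Un_le)
  also have "card (\<Union>w\<in>?K. walk w ` C) \<le> (\<Sum>w\<in>?K. card (walk w ` C))"
    by (rule card_UN_le) (use finite_V in auto)
  also have "\<dots> \<le> (\<Sum>w\<in>?K. card C)" by (rule sum_mono) (use finite_C card_image_le in auto)
  also have "\<dots> = card ?K * card C" by simp
  also have "card ?K \<le> D * card (walk_type ` V)" by (rule card_kept[OF finite_V])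
  also have "card (walk_type ` V) \<le> card (Pow (C \<times> C) \<times> Pow (C \<times> C))"
    by (rule card_mono) (use finite_C in \<open>auto simp: walk_type_def\<close>)
  also have "\<dots> = 2 ^ (card C * card C) * 2 ^ (card C * card C)"
    using finite_C by (simp add: card_cartesian_product card_Pow)
  finally show ?thesis by simp
qed

end

section \<open>The algorithm\<close>

text \<open>All loops have length \<open>L\<close>; a shorter one idles after \<open>x\<close>
  rounds. The arithmetic below is therefore proved correct for arguments up to
  \<open>L\<close>.\<close>

definition two_pow :: "nat \<Rightarrow> nat \<Rightarrow> nat" where
  "two_pow L x = rec_nat 1 (\<lambda>i a. if i < x then a + a else a) L"

definition product :: "nat \<Rightarrow> nat \<Rightarrow> nat \<Rightarrow> nat" where
  "product L x y = (\<Sum>i<L. if i < x then y else 0)"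

text \<open>Division, as the number of \<open>q\<close> with
  \<open>(q + 1) * m \<le> c\<close>.\<close>

definition quot :: "nat \<Rightarrow> nat \<Rightarrow> nat \<Rightarrow> nat" where
  "quot L c m = (\<Sum>q<L. if product L q m + m \<le> c then 1 else 0)"

definition shift :: "nat \<Rightarrow> nat \<Rightarrow> nat \<Rightarrow> nat \<Rightarrow> nat" where
  "shift L b c i = rec_nat c (\<lambda>j a. if j < i then quot L a b else a) L"

definition digit :: "nat \<Rightarrow> nat \<Rightarrow> nat \<Rightarrow> nat \<Rightarrow> nat" where
  "digit L b c i = shift L b c i - product L (quot L (shift L b c i) b) b"

definition count :: "nat \<Rightarrow> (nat \<Rightarrow> bool) \<Rightarrow> nat" where
  "count L P = (\<Sum>v<L. if P v then 1 else 0)"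

text \<open>Member number \<open>i\<close> of \<open>P\<close> in increasing order: at most one
  summand is nonzero.\<close>

definition element :: "nat \<Rightarrow> (nat \<Rightarrow> bool) \<Rightarrow> nat \<Rightarrow> nat" where
  "element L P i = (\<Sum>v<L. if P v \<and> count L (\<lambda>w. w < v \<and> P w) = i then v else 0)"

text \<open>
  Level 2 is the length of the walks, level 4 bounds their codes, level 6 is the number of
  representatives kept of each type, level 8 bounds the size of the kernel, and level 10 bounds the
  codes of its edge sets and of the maps into it.
\<close>

primrec level :: "nat \<Rightarrow> nat \<Rightarrow> state \<Rightarrow> nat" where
  "level 0 L s = s 0 0 + s 0 2 + 3"
| "level (Suc m) L s = two_pow L (level m L s)"

definition adj_F :: "nat \<Rightarrow> state \<Rightarrow> nat \<Rightarrow> nat \<Rightarrow> bool" where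
  "adj_F L s i j \<longleftrightarrow> i < s 0 0 \<and> j < s 0 0 \<and> s 1 (product L i (s 0 0) + j) = 1"

definition adj_G :: "nat \<Rightarrow> state \<Rightarrow> nat \<Rightarrow> nat \<Rightarrow> bool" where
  "adj_G L s u v \<longleftrightarrow> u < s 0 1 \<and> v < s 0 1 \<and> s 2 (product L u (s 0 1) + v) = 1"

definition degree_G :: "nat \<Rightarrow> state \<Rightarrow> nat \<Rightarrow> nat" where
  "degree_G L s u = count L (adj_G L s u)"

text \<open>An index beyond the degree means standing still, so that walks of a fixed length also
  end at smaller distances.\<close>

definition neighbour :: "nat \<Rightarrow> state \<Rightarrow> nat \<Rightarrow> nat \<Rightarrow> nat" where
  "neighbour L s u j = (if j < degree_G L s u then element L (adj_G L s u) j else u)"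

text \<open>The base \<open>k + 1\<close> digits of \<open>c\<close> are the successive choices.
  When all degrees are less than \<open>k\<close>, the digits below \<open>k\<close> reach every
  neighbour and the digit \<open>k\<close> stands still.\<close>

definition walk_end :: "nat \<Rightarrow> state \<Rightarrow> nat \<Rightarrow> nat \<Rightarrow> nat" where
  "walk_end L s w c = rec_nat w
     (\<lambda>j a. if j < level 2 L s then neighbour L s a (digit L (s 0 2 + 1) c j) else a) L"

definition same_walk_type :: "nat \<Rightarrow> state \<Rightarrow> nat \<Rightarrow> nat \<Rightarrow> bool" where
  "same_walk_type L s u w \<longleftrightarrow> (\<forall>c<L. \<forall>d<L. c < level 4 L s \<and> d < level 4 L s \<longrightarrow>
     (walk_end L s u c = walk_end L s u d) = (walk_end L s w c = walk_end L s w d) \<and>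
     adj_G L s (walk_end L s u c) (walk_end L s u d) = adj_G L s (walk_end L s w c) (walk_end L s w d))"

text \<open>The first disjunct provides the set \<open>V0\<close> of
  \<open>ball_kernel\<close>.\<close>

definition in_ball_kernel :: "nat \<Rightarrow> state \<Rightarrow> nat \<Rightarrow> bool" where
  "in_ball_kernel L s v \<longleftrightarrow> v < level 4 L s \<or>
     (\<exists>w<L. w < s 0 1 \<and>
        count L (\<lambda>u. u < s 0 1 \<and> u < w \<and> same_walk_type L s u w) < level 6 L s \<and>
        (\<exists>c<L. c < level 4 L s \<and> walk_end L s w c = v))"

definition in_twin_kernel :: "nat \<Rightarrow> state \<Rightarrow> nat \<Rightarrow> bool" where
  "in_twin_kernel L s v \<longleftrightarrow>
     count L (\<lambda>u. u < s 0 1 \<and> u < v \<and> (\<forall>w<L. adj_G L s w u = adj_G L s w v)) < level 6 L s"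

definition max_degree_one_F :: "nat \<Rightarrow> state \<Rightarrow> bool" where
  "max_degree_one_F L s \<longleftrightarrow>
     (\<forall>i<L. \<forall>j<L. \<forall>j'<L. adj_F L s i j \<and> adj_F L s i j' \<longrightarrow> j = j')"

definition in_kernel :: "nat \<Rightarrow> state \<Rightarrow> nat \<Rightarrow> bool" where
  "in_kernel L s v \<longleftrightarrow> v < s 0 1 \<and>
     (max_degree_one_F L s \<and> in_ball_kernel L s v \<or> \<not> max_degree_one_F L s \<and> in_twin_kernel L s v)"

definition kernel_size :: "nat \<Rightarrow> state \<Rightarrow> nat" where
  "kernel_size L s = count L (in_kernel L s)"

definition kernel_vertex :: "nat \<Rightarrow> state \<Rightarrow> nat \<Rightarrow> nat" where
  "kernel_vertex L s i = element L (in_kernel L s) i"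

text \<open>\<open>h\<close> is the bit string of a matrix on kernel positions; only entries with
  \<open>a < b\<close> are consulted.\<close>

definition selected :: "nat \<Rightarrow> state \<Rightarrow> nat \<Rightarrow> nat \<Rightarrow> nat \<Rightarrow> bool" where
  "selected L s h a b \<longleftrightarrow> digit L 2 h (product L a (kernel_size L s) + b) = 1"

definition selected_size :: "nat \<Rightarrow> state \<Rightarrow> nat \<Rightarrow> nat" where
  "selected_size L s h = (\<Sum>a<L. count L (\<lambda>b. a < b \<and> b < kernel_size L s \<and>
     adj_G L s (kernel_vertex L s a) (kernel_vertex L s b) \<and> selected L s h a b))"

text \<open>The digits of \<open>c\<close> are the kernel positions of the vertices of
  \<open>F\<close>. The base \<open>kernel_size L s + 1\<close> is positive even for an empty
  kernel. Each edge of \<open>F\<close> occurs in both orders, so testing \<open>selected\<close>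
  for increasing positions is enough.\<close>

definition coded_copy :: "nat \<Rightarrow> state \<Rightarrow> nat \<Rightarrow> nat \<Rightarrow> bool" where
  "coded_copy L s h c \<longleftrightarrow> (\<forall>i<L. \<forall>j<L. i < s 0 0 \<and> j < s 0 0 \<longrightarrow>
     digit L (kernel_size L s + 1) c i < kernel_size L s \<and>
     (digit L (kernel_size L s + 1) c i = digit L (kernel_size L s + 1) c j \<longrightarrow> i = j) \<and>
     adj_G L s (kernel_vertex L s (digit L (kernel_size L s + 1) c i))
       (kernel_vertex L s (digit L (kernel_size L s + 1) c j)) = adj_F L s i j \<and>
     (adj_F L s i j \<and> digit L (kernel_size L s + 1) c i < digit L (kernel_size L s + 1) c j \<longrightarrow>
       selected L s h (digit L (kernel_size L s + 1) c i) (digit L (kernel_size L s + 1) c j)))"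

text \<open>\<open>level 10\<close> exceeds the number of sets and maps; the surplus codes merely
  repeat them.\<close>

definition kernel_solvable :: "nat \<Rightarrow> state \<Rightarrow> bool" where
  "kernel_solvable L s \<longleftrightarrow> (\<exists>h<L. h < level 10 L s \<and> s 0 2 \<le> selected_size L s h \<and>
     (\<forall>c<L. c < level 10 L s \<longrightarrow> \<not> coded_copy L s h c))"

text \<open>If \<open>F\<close> has no vertices the answer is no, as the empty set induces a copy in
  both graphs. A twin kernel beyond \<open>level 8\<close> certifies a large matching; with all
  degrees below \<open>k\<close>, a ball kernel never gets that large.\<close>

definition decide :: "nat \<Rightarrow> state \<Rightarrow> nat" where
  "decide L s = (if s 0 0 \<noteq> 0 \<and>
     (max_degree_one_F L s \<and> (\<exists>u<L. u < s 0 1 \<and> s 0 2 \<le> degree_G L s u) \<or>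
      level 8 L s < kernel_size L s \<or> kernel_solvable L s) then 1 else 0)"

subsection \<open>Computability\<close>

lemma loopable_inputs:
  assumes "loopable f"
  shows "loopable (\<lambda>L s e. s 0 (f L s e))" "loopable (\<lambda>L s e. s 1 (f L s e))"
    "loopable (\<lambda>L s e. s 2 (f L s e))"
  by (rule loopable_in[OF _ assms]; simp)+

lemmas loopable_basic =
  loopable_const loopable_var loopable_inputs loopable_add loopable_sub loopable_if
  loopable_sum loopable_rec loopable_pred_not loopable_pred_conj loopable_pred_disj
  loopable_pred_imp loopable_pred_iff loopable_pred_le loopable_pred_less loopable_pred_eq
  loopable_pred_ex loopable_pred_all

lemma loopable_two_pow: "loopable f \<Longrightarrow> loopable (\<lambda>L s e. two_pow L (f L s e))"
  by (rule loopable_comp1[of "\<lambda>L s. two_pow L"]) (unfold two_pow_def, intro loopable_basic)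

lemma loopable_product: "loopable f \<Longrightarrow> loopable g \<Longrightarrow> loopable (\<lambda>L s e. product L (f L s e) (g L s e))"
  by (rule loopable_comp2[of "\<lambda>L s. product L"]) (unfold product_def, intro loopable_basic)

lemma loopable_quot: "loopable f \<Longrightarrow> loopable g \<Longrightarrow> loopable (\<lambda>L s e. quot L (f L s e) (g L s e))"
  by (rule loopable_comp2[of "\<lambda>L s. quot L"]) (unfold quot_def, intro loopable_basic loopable_product)

lemma loopable_shift:
  "loopable f \<Longrightarrow> loopable g \<Longrightarrow> loopable h \<Longrightarrow>
     loopable (\<lambda>L s e. shift L (f L s e) (g L s e) (h L s e))"
  by (rule loopable_comp3[of "\<lambda>L s. shift L"]) (unfold shift_def, intro loopable_basic loopable_quot)

lemma loopable_digit:
  "loopable f \<Longrightarrow> loopable g \<Longrightarrow> loopable h \<Longrightarrow>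
     loopable (\<lambda>L s e. digit L (f L s e) (g L s e) (h L s e))"
  by (rule loopable_comp3[of "\<lambda>L s. digit L"])
     (unfold digit_def, intro loopable_basic loopable_quot loopable_product loopable_shift)

lemma loopable_count:
  "loopable_pred (\<lambda>L s e. P L s (\<lambda>i. e (Suc (Suc i))) (e 0)) \<Longrightarrow>
     loopable (\<lambda>L s e. count L (P L s e))"
  unfolding count_def by (intro loopable_basic)

lemma loopable_level: "loopable (\<lambda>L s e. level m L s)"
  by (induction m) (simp_all, (intro loopable_basic loopable_two_pow | assumption)+)

lemmas loopable_arith = loopable_basic loopable_product loopable_digit loopable_level loopable_count

lemma loopable_adj_F:
  "loopable f \<Longrightarrow> loopable g \<Longrightarrow> loopable_pred (\<lambda>L s e. adj_F L s (f L s e) (g L s e))"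
  by (rule loopable_pred_comp2[of adj_F]) (unfold adj_F_def, intro loopable_arith)

lemma loopable_adj_G:
  "loopable f \<Longrightarrow> loopable g \<Longrightarrow> loopable_pred (\<lambda>L s e. adj_G L s (f L s e) (g L s e))"
  by (rule loopable_pred_comp2[of adj_G]) (unfold adj_G_def, intro loopable_arith)

lemma loopable_degree_G: "loopable f \<Longrightarrow> loopable (\<lambda>L s e. degree_G L s (f L s e))"
  by (rule loopable_comp1[of degree_G]) (unfold degree_G_def, intro loopable_arith loopable_adj_G)

lemma loopable_neighbour:
  "loopable f \<Longrightarrow> loopable g \<Longrightarrow> loopable (\<lambda>L s e. neighbour L s (f L s e) (g L s e))"
  by (rule loopable_comp2[of neighbour])
     (unfold neighbour_def element_def, intro loopable_arith loopable_adj_G loopable_degree_G)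

lemma loopable_walk_end:
  "loopable f \<Longrightarrow> loopable g \<Longrightarrow> loopable (\<lambda>L s e. walk_end L s (f L s e) (g L s e))"
  by (rule loopable_comp2[of walk_end]) (unfold walk_end_def, intro loopable_arith loopable_neighbour)

lemma loopable_same_walk_type:
  "loopable f \<Longrightarrow> loopable g \<Longrightarrow> loopable_pred (\<lambda>L s e. same_walk_type L s (f L s e) (g L s e))"
  by (rule loopable_pred_comp2[of same_walk_type])
     (unfold same_walk_type_def, intro loopable_arith loopable_walk_end loopable_adj_G)

lemma loopable_in_ball_kernel:
  "loopable f \<Longrightarrow> loopable_pred (\<lambda>L s e. in_ball_kernel L s (f L s e))"
  by (rule loopable_pred_comp1[of in_ball_kernel])
     (unfold in_ball_kernel_def, intro loopable_arith loopable_walk_end loopable_same_walk_type)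

lemma loopable_in_twin_kernel:
  "loopable f \<Longrightarrow> loopable_pred (\<lambda>L s e. in_twin_kernel L s (f L s e))"
  by (rule loopable_pred_comp1[of in_twin_kernel])
     (unfold in_twin_kernel_def, intro loopable_arith loopable_adj_G)

lemma loopable_max_degree_one_F: "loopable_pred (\<lambda>L s e. max_degree_one_F L s)"
  unfolding max_degree_one_F_def by (intro loopable_arith loopable_adj_F)

lemma loopable_in_kernel:
  "loopable f \<Longrightarrow> loopable_pred (\<lambda>L s e. in_kernel L s (f L s e))"
  by (rule loopable_pred_comp1[of in_kernel])
     (unfold in_kernel_def, intro loopable_arith loopable_in_ball_kernel loopable_in_twin_kernel
       loopable_max_degree_one_F)

lemma loopable_kernel_size: "loopable (\<lambda>L s e. kernel_size L s)"
  unfolding kernel_size_def by (intro loopable_arith loopable_in_kernel)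

lemma loopable_kernel_vertex: "loopable f \<Longrightarrow> loopable (\<lambda>L s e. kernel_vertex L s (f L s e))"
  by (rule loopable_comp1[of kernel_vertex])
     (unfold kernel_vertex_def element_def, intro loopable_arith loopable_in_kernel)

lemma loopable_selected:
  "loopable f \<Longrightarrow> loopable g \<Longrightarrow> loopable h \<Longrightarrow>
     loopable_pred (\<lambda>L s e. selected L s (f L s e) (g L s e) (h L s e))"
  unfolding selected_def by (intro loopable_arith loopable_kernel_size)

lemma loopable_selected_size: "loopable f \<Longrightarrow> loopable (\<lambda>L s e. selected_size L s (f L s e))"
  by (rule loopable_comp1[of selected_size])
     (unfold selected_size_def, intro loopable_arith loopable_kernel_size loopable_kernel_vertex
       loopable_adj_G loopable_selected)

lemma loopable_coded_copy:
  "loopable f \<Longrightarrow> loopable g \<Longrightarrow> loopable_pred (\<lambda>L s e. coded_copy L s (f L s e) (g L s e))"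
  by (rule loopable_pred_comp2[of coded_copy])
     (unfold coded_copy_def, intro loopable_arith loopable_kernel_size loopable_kernel_vertex
       loopable_adj_F loopable_adj_G loopable_selected)

lemma loopable_kernel_solvable: "loopable_pred (\<lambda>L s e. kernel_solvable L s)"
  unfolding kernel_solvable_def
  by (intro loopable_arith loopable_selected_size loopable_coded_copy)

lemma loopable_decide: "loopable (\<lambda>L s e. decide L s)"
  unfolding decide_def
  by (intro loopable_arith loopable_max_degree_one_F loopable_degree_G loopable_kernel_size
    loopable_kernel_solvable)

subsection \<open>Arithmetic\<close>

lemma rec_nat_clip:
  "m \<le> L \<Longrightarrow> rec_nat z (\<lambda>j a. if j < m then f j a else a) L = rec_nat z f m"
proof (induction L)
  case (Suc L)
  have "rec_nat z (\<lambda>j a. if j < Suc n then f j a else a) i = rec_nat z f i" if "i \<le> Suc n" for i n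
    using that by (induction i) auto
  then show ?case using Suc by (cases "m = Suc L") (auto simp: le_Suc_eq)
qed simp

lemma two_pow_eq: "x \<le> L \<Longrightarrow> two_pow L x = 2 ^ x"
proof -
  have "rec_nat 1 (\<lambda>i a. a + a) x = (2 :: nat) ^ x" by (induction x) auto
  then show "x \<le> L \<Longrightarrow> two_pow L x = 2 ^ x" by (simp add: two_pow_def rec_nat_clip)
qed

lemma count_eq: "count L P = card {v. v < L \<and> P v}"
proof -
  have "count L P = (\<Sum>v \<in> {..<L} \<inter> {v. P v}. 1)"
    unfolding count_def by (subst sum.inter_restrict) auto
  moreover have "{..<L} \<inter> {v. P v} = {v. v < L \<and> P v}" by auto
  ultimately show ?thesis by simp
qed

lemma product_eq: "x \<le> L \<Longrightarrow> product L x y = x * y"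
proof -
  assume x: "x \<le> L"
  have "product L x y = (\<Sum>i \<in> {..<L} \<inter> {..<x}. y)"
    unfolding product_def by (subst sum.inter_restrict) auto
  moreover have "{..<L} \<inter> {..<x} = {..<x}" using x by auto
  ultimately show ?thesis by simp
qed

lemma quot_eq: "0 < m \<Longrightarrow> c \<le> L \<Longrightarrow> quot L c m = c div m"
proof -
  assume m: "0 < m" and c: "c \<le> L"
  have "quot L c m = card {q. q < L \<and> product L q m + m \<le> c}"
    using count_eq[of L] by (simp add: quot_def count_def)
  also have "{q. q < L \<and> product L q m + m \<le> c} = {..<c div m}"
  proof (intro set_eqI iffI)
    fix q assume "q \<in> {q. q < L \<and> product L q m + m \<le> c}"
    then have "Suc q * m \<le> c" using product_eq[of q L m] by simp
    then have "Suc q \<le> c div m" using m by (simp only: less_eq_div_iff_mult_less_eq)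
    then show "q \<in> {..<c div m}" by simp
  next
    fix q assume "q \<in> {..<c div m}"
    then have q: "Suc q \<le> c div m" by simp
    then have "Suc q * m \<le> c" using m by (simp only: less_eq_div_iff_mult_less_eq)
    moreover have "q < L" using q c div_le_dividend[of c m] by linarith
    ultimately show "q \<in> {q. q < L \<and> product L q m + m \<le> c}"
      using product_eq[of q L m] by simp
  qed
  finally show ?thesis by simp
qed

lemma digit_eq:
  assumes "0 < b" "c \<le> L" "i \<le> L" shows "digit L b c i = (c div b ^ i) mod b"
proof -
  have r: "rec_nat c (\<lambda>j a. quot L a b) i = c div b ^ i" for i
  proof (induction i)
    case (Suc i)
    have "c div b ^ i \<le> L" using assms(2) div_le_dividend[of c "b ^ i"] by linarith
    then show ?case using Suc assms(1) by (simp add: quot_eq div_mult2_eq[symmetric] mult.commute)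
  qed simp
  have sh: "shift L b c i = c div b ^ i"
    using assms(3) by (simp add: shift_def rec_nat_clip r)
  have le: "c div b ^ i \<le> L" using assms(2) div_le_dividend[of c "b ^ i"] by linarith
  then have "c div b ^ i div b \<le> L" using div_le_dividend[of "c div b ^ i" b] by linarith
  then show ?thesis
    using le assms(1) by (simp add: digit_def sh quot_eq product_eq minus_div_mult_eq_mod)
qed

text \<open>The new leading digit adds \<open>g m * b ^ m\<close>, a multiple of
  \<open>b ^ (i + 1)\<close> for \<open>i < m\<close>, which leaves the lower digits alone.\<close>

lemma code_exists:
  assumes "0 < b" "\<And>i. i < m \<Longrightarrow> g i < (b :: nat)"
  shows "\<exists>c < b ^ m. \<forall>i<m. (c div b ^ i) mod b = g i"
  using assms(2)
proof (induction m)
  case (Suc m)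
  then obtain c where c: "c < b ^ m" "\<forall>i<m. (c div b ^ i) mod b = g i" by auto
  let ?c = "c + g m * b ^ m"
  have "?c < b ^ Suc m"
  proof -
    have "Suc (g m) * b ^ m \<le> b * b ^ m" using Suc.prems[of m] by (intro mult_le_mono1) simp
    then show ?thesis using c(1) by simp
  qed
  moreover have "(?c div b ^ i) mod b = g i" if "i < Suc m" for i
  proof (cases "i = m")
    case True
    then show ?thesis using c(1) assms(1) Suc.prems[of m] by simp
  next
    case False
    then have i: "i < m" using that by simp
    then obtain d where d: "m = i + Suc d" using less_natE by (metis add_Suc_right)
    have "?c = c + b ^ i * (b * (b ^ d * g m))" by (simp add: d power_add mult_ac)
    then have "?c div b ^ i = b * (b ^ d * g m) + c div b ^ i"
      using assms(1) by (simp only: div_mult_self2[of "b ^ i"]) simp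
    then show ?thesis using c(2) i by (simp only: mod_mult_self4)
  qed
  ultimately show ?case by blast
qed auto

text \<open>\<open>element\<close> inverts the rank \<open>r\<close>, which is strictly increasing
  on the set and hence a bijection onto an initial segment.\<close>

lemma bij_betw_element: "bij_betw (element L P) {..<count L P} {v. v < L \<and> P v}"
proof -
  let ?K = "{v. v < L \<and> P v}"
  define r where "r v = card {w. w < L \<and> w < v \<and> P w}" for v
  have fin: "finite ?K" by simp
  have lt: "r v < r w" if "v \<in> ?K" "w \<in> ?K" "v < w" for v w
  proof -
    have "v \<in> {x. x < L \<and> x < w \<and> P x}" "v \<notin> {x. x < L \<and> x < v \<and> P x}" using that by auto
    moreover have "{x. x < L \<and> x < v \<and> P x} \<subseteq> {x. x < L \<and> x < w \<and> P x}" using that by auto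
    ultimately have "{x. x < L \<and> x < v \<and> P x} \<subset> {x. x < L \<and> x < w \<and> P x}" by blast
    then show ?thesis unfolding r_def by (rule psubset_card_mono[rotated]) simp
  qed
  have inj: "inj_on r ?K"
  proof (rule inj_onI)
    fix v w assume "v \<in> ?K" "w \<in> ?K" "r v = r w"
    then show "v = w" using lt[of v w] lt[of w v] by (cases v w rule: linorder_cases) simp_all
  qed
  have "r v < card ?K" if "v \<in> ?K" for v
  proof -
    have "{w. w < L \<and> w < v \<and> P w} \<subseteq> ?K - {v}" by auto
    then have "r v \<le> card (?K - {v})" unfolding r_def by (rule card_mono[rotated]) simp
    also have "\<dots> < card ?K" by (rule card_Diff1_less[OF fin that])
    finally show ?thesis .
  qed
  then have "r ` ?K \<subseteq> {..<card ?K}" by blast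
  moreover have "card (r ` ?K) = card {..<card ?K}" using card_image[OF inj] by simp
  ultimately have im: "r ` ?K = {..<card ?K}" by (intro card_subset_eq) auto
  have el: "element L P (r v) = v" if v: "v \<in> ?K" for v
  proof -
    have "element L P (r v) = (\<Sum>w<L. if w = v then v else 0)"
      unfolding element_def
    proof (rule sum.cong[OF refl])
      fix w assume "w \<in> {..<L}"
      then have "P w \<and> count L (\<lambda>x. x < w \<and> P x) = r v \<longleftrightarrow> w = v"
        using inj v by (auto simp: count_eq r_def[symmetric] inj_on_def)
      then show "(if P w \<and> count L (\<lambda>x. x < w \<and> P x) = r v then w else 0) = (if w = v then v else 0)"
        by auto
    qed
    then show ?thesis using v by simp
  qed
  have "bij_betw r ?K {..<card ?K}" using inj im by (simp add: bij_betw_def)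
  then have "bij_betw (inv_into ?K r) {..<card ?K} ?K" by (rule bij_betw_inv_into)
  moreover have "inv_into ?K r i = element L P i" if i: "i \<in> {..<card ?K}" for i
  proof -
    obtain v where v: "v \<in> ?K" "i = r v" using i unfolding im[symmetric] by (elim imageE)
    show ?thesis unfolding v(2) el[OF v(1)] by (rule inv_into_f_f[OF inj v(1)])
  qed
  ultimately have "bij_betw (element L P) {..<card ?K} ?K"
    by (rule bij_betw_cong[THEN iffD1, rotated])
  then show ?thesis by (simp only: count_eq)
qed

subsection \<open>Correctness\<close>

lemma two_times_le_exp: "2 * y \<le> 2 ^ (y :: nat)"
proof (induction y)
  case (Suc y)
  then show ?case using less_exp[of y] by (cases y) auto
qed simp

text \<open>A square costs one level, because \<open>2 * y \<le> 2 ^ y\<close> in the exponent.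
  Level 0 is excluded since \<open>3 * 3 > 2 ^ 3\<close>.\<close>

lemma tower_square: "0 < m \<Longrightarrow> j = Suc m \<Longrightarrow> tower m x * tower m x \<le> tower j x"
proof -
  assume "0 < m" and j: "j = Suc m"
  then obtain m' where m: "m = Suc m'" by (cases m) auto
  have "tower m x * tower m x = 2 ^ (2 * tower m' x)"
    by (simp add: m mult_2 power_add[symmetric])
  also have "\<dots> \<le> 2 ^ (2 ^ tower m' x)" using two_times_le_exp by simp
  finally show "tower m x * tower m x \<le> tower j x" by (simp add: m j)
qed

lemma tower_mono_height: "i \<le> j \<Longrightarrow> tower i x \<le> tower j x"
  by (rule lift_Suc_mono_le[of "\<lambda>i. tower i x", OF tower_le_Suc])

lemma tower_less_Suc: "tower m x < tower (Suc m) x"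
  using less_exp by simp

lemma rec_nat_cong: "(\<And>j a. j < m \<Longrightarrow> f j a = g j a) \<Longrightarrow> rec_nat z f m = rec_nat z g m"
  by (induction m) auto

declare tower.simps [simp del]

locale closure_instance =
  fixes F G :: "nat graph" and k L :: nat
  assumes F: "is_input_graph F" and G: "is_input_graph G"
    and L: "L = tower 10 (card (verts F) + k + 3) + card (verts G) + 1"
begin

abbreviation "s \<equiv> encode (F, G, k)"
abbreviation "f \<equiv> card (verts F)"
abbreviation "n \<equiv> card (verts G)"
abbreviation "t i \<equiv> tower i (f + k + 3)"
abbreviation "A i j \<equiv> {i, j} \<in> edges F"
abbreviation "N \<equiv> kernel_size L s"

lemma inputs: "s 0 0 = f" "s 0 1 = n" "s 0 (Suc 0) = n" "s 0 2 = k" "s 1 = adj_matrix F" "s 2 = adj_matrix G"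
  by (auto simp: encode_def)

lemma verts: "verts F = {..<f}" "verts G = {..<n}" and graphs: "is_graph F" "is_graph G"
  using F G by (auto simp: is_input_graph_def)

lemma t_0: "t 0 = f + k + 3"
  by (simp add: tower.simps)

lemma t_exp: "j = Suc i \<Longrightarrow> t j = 2 ^ t i"
  by (simp add: tower.simps)

lemma t_mono: "i \<le> j \<Longrightarrow> t i \<le> t j"
  by (rule tower_mono_height)

lemma t_less: "j = Suc i \<Longrightarrow> t i < t j"
  using tower_less_Suc by simp

lemma t_squares:
  "t 1 * t 1 \<le> t 2" "t 2 * t 2 \<le> t 3" "t 4 * t 4 \<le> t 5" "t 6 * t 6 \<le> t 7" "t 7 * t 7 \<le> t 8"
  "t 8 * t 8 \<le> t 9"
  by (rule tower_square; simp)+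

lemma t_le_L: "i \<le> 10 \<Longrightarrow> t i \<le> L"
  using tower_mono_height[of i 10 "f + k + 3"] by (simp add: L)

lemma f_le_L: "f \<le> L"
  using t_le_L[of 0] by (simp add: t_0)

lemma n_less_L: "n < L"
  by (simp add: L)

lemma level_eq: "i \<le> 10 \<Longrightarrow> level i L s = t i"
proof (induction i)
  case (Suc i)
  then show ?case using t_le_L[of i] by (simp add: two_pow_eq tower.simps)
qed (simp add: inputs t_0)

lemma adj_matrix_eq:
  assumes "is_input_graph H" "i < card (verts H)" "j < card (verts H)"
  shows "adj_matrix H (i * card (verts H) + j) = 1 \<longleftrightarrow> {i, j} \<in> edges H"
proof -
  let ?m = "card (verts H)"
  have "i * ?m + j < ?m * ?m"
  proof -
    have "Suc i * ?m \<le> ?m * ?m" using assms(2) by (intro mult_le_mono1) simp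
    then show ?thesis using assms(3) by simp
  qed
  then show ?thesis using assms by (simp add: adj_matrix_def Let_def)
qed

lemma F_edge_less: "{i, j} \<in> edges F \<Longrightarrow> i < f \<and> j < f"
  using graphs(1) verts(1) unfolding is_graph_def by blast

lemma G_edge_less: "{u, v} \<in> edges G \<Longrightarrow> u < n \<and> v < n"
  using graphs(2) verts(2) unfolding is_graph_def by blast

lemma adj_F_iff: "adj_F L s i j \<longleftrightarrow> A i j"
proof (cases "i < f \<and> j < f")
  case True
  then show ?thesis
    unfolding adj_F_def inputs using adj_matrix_eq[OF F, of i j] f_le_L product_eq[of i L f] by auto
next
  case False
  then show ?thesis unfolding adj_F_def inputs using F_edge_less[of i j] by blast
qed

lemma adj_G_iff: "adj_G L s u v \<longleftrightarrow> {u, v} \<in> edges G"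
proof (cases "u < n \<and> v < n")
  case True
  then show ?thesis
    unfolding adj_G_def inputs using adj_matrix_eq[OF G, of u v] n_less_L product_eq[of u L n] by auto
next
  case False
  then show ?thesis unfolding adj_G_def inputs using G_edge_less[of u v] by blast
qed

sublocale finite_graph "{..<n}" "edges G"
  by unfold_locales (use graphs(2) verts(2) in \<open>auto simp: is_graph_def\<close>)

section \<open>Neighbours, walks and kernels of the input graph\<close>

lemma nbrs_eq: "nbrs u = {v. v < L \<and> adj_G L s u v}"
proof -
  have "v < n \<and> v < L" if "{v, u} \<in> edges G" for v using G_edge_less[OF that] n_less_L by simp
  then show ?thesis by (auto simp: nbrs_def adj_G_iff insert_commute)
qed

lemma degree_G_eq: "degree_G L s u = card (nbrs u)"
  by (simp add: degree_G_def count_eq nbrs_eq)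

lemma neighbour_image: "neighbour L s u ` {..<card (nbrs u)} = nbrs u"
proof -
  have "element L (adj_G L s u) ` {..<count L (adj_G L s u)} = {v. v < L \<and> adj_G L s u v}"
    by (rule bij_betw_imp_surj_on[OF bij_betw_element])
  then have "element L (adj_G L s u) ` {..<card (nbrs u)} = nbrs u"
    by (simp add: nbrs_eq[symmetric] count_eq)
  moreover have "neighbour L s u ` {..<card (nbrs u)} = element L (adj_G L s u) ` {..<card (nbrs u)}"
    by (rule image_cong) (auto simp: neighbour_def degree_G_eq)
  ultimately show ?thesis by simp
qed

lemma neighbour_stay: "card (nbrs u) \<le> j \<Longrightarrow> neighbour L s u j = u"
  by (simp add: neighbour_def degree_G_eq)

lemma neighbour_adjacent: "neighbour L s u j = u \<or> {u, neighbour L s u j} \<in> edges G"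
proof (cases "j < card (nbrs u)")
  case True
  then have "neighbour L s u j \<in> nbrs u" using neighbour_image by blast
  then show ?thesis by (auto simp: in_nbrs_iff insert_commute)
qed (simp add: neighbour_stay)

lemma walk_end_eq:
  assumes "c \<le> L"
  shows "walk_end L s w c = rec_nat w (\<lambda>j a. neighbour L s a ((c div (k + 1) ^ j) mod (k + 1))) (t 2)"
proof -
  have "walk_end L s w c = rec_nat w (\<lambda>j a. neighbour L s a (digit L (k + 1) c j)) (t 2)"
    unfolding walk_end_def inputs level_eq[of 2, simplified]
    using t_le_L[of 2] by (intro rec_nat_clip) simp
  also have "\<dots> = rec_nat w (\<lambda>j a. neighbour L s a ((c div (k + 1) ^ j) mod (k + 1))) (t 2)"
  proof (rule rec_nat_cong)
    fix j a assume "j < t 2"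
    then have "j \<le> L" using t_le_L[of 2] by simp
    then show "neighbour L s a (digit L (k + 1) c j) = neighbour L s a ((c div (k + 1) ^ j) mod (k + 1))"
      using assms by (subst digit_eq) auto
  qed
  finally show ?thesis .
qed

lemma reach_walk: "reach r w (rec_nat w (\<lambda>j a. neighbour L s a (g j)) r)"
proof (induction r)
  case (Suc r)
  let ?a = "rec_nat w (\<lambda>j a. neighbour L s a (g j)) r"
  have "?a = neighbour L s ?a (g r) \<or> {?a, neighbour L s ?a (g r)} \<in> edges G"
    using neighbour_adjacent[of ?a "g r"] by auto
  then show ?case using Suc by auto
qed simp

lemma walk_if_reach:
  assumes "\<And>v. v < n \<Longrightarrow> card (nbrs v) < k" "w < n" "reach r w v"
  shows "\<exists>g. (\<forall>j. g j < k + 1) \<and> rec_nat w (\<lambda>j a. neighbour L s a (g j)) r = v"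
  using assms(3)
proof (induction r arbitrary: v)
  case (Suc r)
  then obtain u where u: "reach r w u" "u = v \<or> {u, v} \<in> edges G" by auto
  then obtain g where g: "\<forall>j. g j < k + 1" "rec_nat w (\<lambda>j a. neighbour L s a (g j)) r = u"
    using Suc.IH by blast
  have un: "u < n" using reach_in_V[OF u(1)] assms(2) by simp
  have "\<exists>i<k + 1. neighbour L s u i = v"
    using u(2)
  proof
    assume "u = v"
    then show ?thesis using neighbour_stay[of u k] assms(1)[OF un] by (intro exI[of _ k]) simp
  next
    assume "{u, v} \<in> edges G"
    then have "v \<in> nbrs u" by (simp add: in_nbrs_iff insert_commute)
    then have "v \<in> neighbour L s u ` {..<card (nbrs u)}" by (simp only: neighbour_image)
    then obtain i where "i < card (nbrs u)" "neighbour L s u i = v" by auto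
    then show ?thesis using assms(1)[OF un] by (intro exI[of _ i]) simp
  qed
  then obtain i where i: "i < k + 1" "neighbour L s u i = v" by blast
  have "rec_nat w (\<lambda>j a. neighbour L s a ((g(r := i)) j)) r = rec_nat w (\<lambda>j a. neighbour L s a (g j)) r"
    by (rule rec_nat_cong) simp
  then have "rec_nat w (\<lambda>j a. neighbour L s a ((g(r := i)) j)) (Suc r) = v" using g(2) i(2) by simp
  moreover have "\<forall>j. (g(r := i)) j < k + 1" using g(1) i(1) by simp
  ultimately show ?case by blast
qed auto

lemma base_bounds: "k + 1 \<le> t 1" "2 * k \<le> t 1" "f + 1 \<le> t 1"
proof -
  have "2 * (f + k + 3) \<le> t 1" using two_times_le_exp[of "f + k + 3"] t_exp[of 1 0] by (simp add: t_0)
  then show "k + 1 \<le> t 1" "2 * k \<le> t 1" "f + 1 \<le> t 1" by simp_all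
qed

lemma walk_codes: "(k + 1) ^ t 2 \<le> t 4"
proof -
  have "k + 1 \<le> 2 ^ k" using Suc_leI[OF less_exp[of k]] by simp
  then have "(k + 1) ^ t 2 \<le> (2 ^ k) ^ t 2" by (rule power_mono) simp
  also have "\<dots> = 2 ^ (k * t 2)" by (simp only: power_mult)
  also have "\<dots> \<le> 2 ^ t 3"
  proof (rule power_increasing)
    have "k * t 2 \<le> t 2 * t 2" using base_bounds(1) t_mono[of 1 2] by (intro mult_le_mono1) linarith
    then show "k * t 2 \<le> t 3" using t_squares(2) by linarith
  qed simp
  finally show ?thesis using t_exp[of 4 3] by simp
qed

text \<open>Surplus codes up to \<open>t 4\<close> also describe walks, and no walk of this length
  leaves the ball; so rounding the number of codes up to a level does no harm.\<close>

lemma walk_image: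
  assumes "\<And>v. v < n \<Longrightarrow> card (nbrs v) < k" "w < n"
  shows "walk_end L s w ` {..<t 4} = {v. reach (t 2) w v}"
proof (intro equalityI subsetI)
  fix v assume "v \<in> walk_end L s w ` {..<t 4}"
  then obtain c where c: "c < t 4" "v = walk_end L s w c" by auto
  then have "c \<le> L" using t_le_L[of 4] by simp
  then show "v \<in> {v. reach (t 2) w v}" using c walk_end_eq reach_walk by simp
next
  fix v assume "v \<in> {v. reach (t 2) w v}"
  then obtain g where g: "\<forall>j. g j < k + 1" "rec_nat w (\<lambda>j a. neighbour L s a (g j)) (t 2) = v"
    using walk_if_reach[OF assms, of "t 2" v] by auto
  obtain c where c: "c < (k + 1) ^ t 2" "\<forall>i<t 2. (c div (k + 1) ^ i) mod (k + 1) = g i"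
    using code_exists[of "k + 1" "t 2" g] g(1) by auto
  have c4: "c < t 4" using c(1) walk_codes by linarith
  then have "walk_end L s w c = rec_nat w (\<lambda>j a. neighbour L s a ((c div (k + 1) ^ j) mod (k + 1))) (t 2)"
    using t_le_L[of 4] by (intro walk_end_eq) simp
  also have "\<dots> = rec_nat w (\<lambda>j a. neighbour L s a (g j)) (t 2)"
    by (rule rec_nat_cong) (use c(2) in simp)
  finally show "v \<in> walk_end L s w ` {..<t 4}" using g(2) c4 by (intro image_eqI[of _ _ c]) auto
qed

lemma twin_kernel_iff: "v < n \<Longrightarrow> in_twin_kernel L s v \<longleftrightarrow> v \<in> twin_kernel (t 6)"
proof -
  assume v: "v < n"
  have "(\<forall>w<L. adj_G L s w u = adj_G L s w v) \<longleftrightarrow> nbrs u = nbrs v" for u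
  proof -
    have "w < n \<and> w < L" if "{w, x} \<in> edges G" for w x using G_edge_less[OF that] n_less_L by simp
    then show ?thesis unfolding adj_G_iff nbrs_def set_eq_iff by blast
  qed
  moreover have "{u. u < L \<and> u < n \<and> P u} = {u \<in> {..<n}. P u}" for P
    using n_less_L by auto
  ultimately show ?thesis
    using v by (simp add: in_twin_kernel_def twin_kernel_def kept_def count_eq level_eq inputs)
qed

lemma bounded_degree:
  assumes "\<And>v. v < n \<Longrightarrow> card (nbrs v) < k"
  shows "bounded_degree_graph {..<n} (edges G) k (t 2) {..<t 4} (walk_end L s)"
proof unfold_locales
  show "walk_end L s w ` {..<t 4} = {v. reach (t 2) w v}" if "w \<in> {..<n}" for w
    using walk_image[OF assms] that by simp
  have "(2 * k) * (2 * k) \<le> t 1 * t 1" using base_bounds(2) by (intro mult_le_mono)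
  then show "(2 * k) * (2 * k) \<le> t 2" using t_squares(1) by linarith
qed (use assms in auto)

lemma ball_kernel_iff:
  assumes deg: "\<And>v. v < n \<Longrightarrow> card (nbrs v) < k" and v: "v < n"
  shows "in_ball_kernel L s v \<longleftrightarrow>
    v \<in> bounded_degree_graph.ball_kernel {..<n} (edges G) {..<t 4} (walk_end L s) ({..<t 4} \<inter> {..<n}) (t 6)"
proof -
  interpret b: bounded_degree_graph "{..<n}" "edges G" k "t 2" "{..<t 4}" "walk_end L s"
    by (rule bounded_degree[OF deg])
  have t4: "c < L" if "c < t 4" for c using that t_le_L[of 4] by simp
  have type: "same_walk_type L s u w \<longleftrightarrow> b.walk_type u = b.walk_type w" for u w
    unfolding same_walk_type_def b.walk_type_eq_iff level_eq[of 4, simplified] adj_G_iff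
    using t4 by blast
  have "{u. u < L \<and> u < n \<and> P u} = {u \<in> {..<n}. P u}" for P
    using n_less_L by auto
  then have kept: "count L (\<lambda>u. u < n \<and> u < w \<and> same_walk_type L s u w) < t 6 \<longleftrightarrow>
    kept b.walk_type (t 6) {..<n} w" for w
    by (simp add: count_eq kept_def type)
  have "in_ball_kernel L s v \<longleftrightarrow> v < t 4 \<or> (\<exists>w<L. w < n \<and> kept b.walk_type (t 6) {..<n} w \<and>
    (\<exists>c<L. c < t 4 \<and> walk_end L s w c = v))"
    by (simp only: in_ball_kernel_def inputs level_eq[of 4, simplified] level_eq[of 6, simplified] kept)
  also have "\<dots> \<longleftrightarrow> v \<in> b.ball_kernel ({..<t 4} \<inter> {..<n}) (t 6)"
  proof -
    have "w < L" if "w < n" for w using that n_less_L by simp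
    then show ?thesis using v t4 unfolding b.ball_kernel_def by blast
  qed
  finally show ?thesis .
qed

section \<open>Exhaustive search over the kernel\<close>

definition "K = {v. v < n \<and> in_kernel L s v}"

lemma K_eq: "K = {v. v < L \<and> in_kernel L s v}"
  using n_less_L by (auto simp: K_def in_kernel_def inputs)

lemma N_eq: "N = card K"
  by (simp add: kernel_size_def count_eq K_eq)

lemma bij_kernel_vertex: "bij_betw (kernel_vertex L s) {..<N} K"
  using bij_betw_element[of L "in_kernel L s"] by (simp add: kernel_size_def kernel_vertex_def[abs_def] K_eq)

lemma N_less_L: "N < L"
proof -
  have "K \<subseteq> {..<n}" by (auto simp: K_def)
  then have "card K \<le> card {..<n}" by (rule card_mono[rotated]) simp
  then show ?thesis using n_less_L by (simp add: N_eq)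
qed

lemma pair_less: "a < m \<Longrightarrow> b < m \<Longrightarrow> a * m + b < m * (m :: nat)"
proof -
  assume "a < m" "b < m"
  then have "Suc a * m \<le> m * m" by (intro mult_le_mono1) simp
  then show ?thesis using \<open>b < m\<close> by simp
qed

context
  assumes small: "N \<le> t 8"
begin

lemma square_le: "N * N \<le> t 9"
proof -
  have "N * N \<le> t 8 * t 8" using small by (intro mult_le_mono)
  then show ?thesis using t_squares(6) by linarith
qed

lemma edge_codes: "2 ^ (N * N) \<le> t 10"
proof -
  have "(2::nat) ^ (N * N) \<le> 2 ^ t 9" using square_le by (intro power_increasing) auto
  then show ?thesis using t_exp[of 10 9] by simp
qed

lemma map_codes: "(N + 1) ^ f \<le> t 10"
proof -
  have "N + 1 \<le> 2 ^ N" using Suc_leI[OF less_exp[of N]] by simp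
  then have "(N + 1) ^ f \<le> (2 ^ N) ^ f" by (rule power_mono) simp
  also have "\<dots> = 2 ^ (N * f)" by (simp only: power_mult)
  also have "\<dots> \<le> 2 ^ t 9"
  proof (rule power_increasing)
    have "N * f \<le> t 8 * t 8" using small base_bounds(3) t_mono[of 1 8] by (intro mult_le_mono) linarith+
    then show "N * f \<le> t 9" using t_squares(6) by linarith
  qed simp
  finally show ?thesis using t_exp[of 10 9] by simp
qed

abbreviation "kv \<equiv> kernel_vertex L s"

lemma selected_iff:
  assumes "h < t 10" "a < N" "b < N"
  shows "selected L s h a b \<longleftrightarrow> (h div 2 ^ (a * N + b)) mod 2 = 1"
proof -
  have "a * N + b \<le> L" using pair_less[OF assms(2,3)] square_le t_le_L[of 9] by simp
  moreover have "h \<le> L" using assms(1) t_le_L[of 10] by simp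
  ultimately show ?thesis
    using assms(2) N_less_L by (simp add: selected_def product_eq digit_eq)
qed

definition "selected_pairs h = {(a, b). a < b \<and> b < N \<and> {kv a, kv b} \<in> edges G \<and> selected L s h a b}"

lemma selected_size_eq: "selected_size L s h = card (selected_pairs h)"
proof -
  let ?B = "\<lambda>a. {b. b < L \<and> a < b \<and> b < N \<and> {kv a, kv b} \<in> edges G \<and> selected L s h a b}"
  have "selected_size L s h = (\<Sum>a<L. card (?B a))"
    by (simp only: selected_size_def count_eq adj_G_iff)
  also have "\<dots> = card (SIGMA a:{..<L}. ?B a)" by (rule card_SigmaI[symmetric]) auto
  also have "(SIGMA a:{..<L}. ?B a) = selected_pairs h"
    using N_less_L by (auto simp: selected_pairs_def)
  finally show ?thesis .
qed

lemma kv_inj: "a < N \<Longrightarrow> b < N \<Longrightarrow> kv a = kv b \<Longrightarrow> a = b"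
  using bij_kernel_vertex by (auto simp: bij_betw_def inj_on_def)

lemma kv_in_K: "a < N \<Longrightarrow> kv a \<in> K"
  using bij_betwE[OF bij_kernel_vertex] by simp

lemma card_selected_edges: "card ((\<lambda>(a, b). {kv a, kv b}) ` selected_pairs h) = card (selected_pairs h)"
proof (rule card_image, rule inj_onI, clarify)
  fix a b a' b'
  assume ab: "(a, b) \<in> selected_pairs h" "(a', b') \<in> selected_pairs h" "{kv a, kv b} = {kv a', kv b'}"
  then have lt: "a < b" "b < N" "a' < b'" "b' < N" by (auto simp: selected_pairs_def)
  from ab(3) have "kv a = kv a' \<and> kv b = kv b' \<or> kv a = kv b' \<and> kv b = kv a'"
    by (simp add: doubleton_eq_iff)
  then show "a = a' \<and> b = b'" using lt kv_inj[of a a'] kv_inj[of b b'] kv_inj[of a b'] kv_inj[of b a'] by auto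
qed

lemma digit_map: "c < t 10 \<Longrightarrow> i < f \<Longrightarrow> digit L (N + 1) c i = (c div (N + 1) ^ i) mod (N + 1)"
  using f_le_L t_le_L[of 10] by (intro digit_eq) auto

lemma coded_copy_iff:
  assumes "c < t 10"
  shows "coded_copy L s h c \<longleftrightarrow> (\<forall>i<f. \<forall>j<f. digit L (N + 1) c i < N \<and>
     (digit L (N + 1) c i = digit L (N + 1) c j \<longrightarrow> i = j) \<and>
     ({kv (digit L (N + 1) c i), kv (digit L (N + 1) c j)} \<in> edges G \<longleftrightarrow> A i j) \<and>
     (A i j \<and> digit L (N + 1) c i < digit L (N + 1) c j \<longrightarrow>
       selected L s h (digit L (N + 1) c i) (digit L (N + 1) c j)))"
  unfolding coded_copy_def adj_F_iff adj_G_iff inputs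
  using f_le_L by (meson less_le_trans)

text \<open>The set coded by \<open>h\<close> may have more than \<open>k\<close> edges; a subset of
  size \<open>k\<close> is then taken. Since \<open>N \<le> t 8\<close>, all edge sets and all maps
  have codes below \<open>t 10\<close>.\<close>

lemma kernel_solvable_iff: "kernel_solvable L s \<longleftrightarrow> solvable {..<f} A (edges G) k K"
proof
  assume "kernel_solvable L s"
  then obtain h where h: "h < t 10" "k \<le> selected_size L s h"
    "\<And>c. c < L \<Longrightarrow> c < t 10 \<Longrightarrow> \<not> coded_copy L s h c"
    unfolding kernel_solvable_def level_eq[of 10, simplified] inputs by blast
  define Mh where "Mh = (\<lambda>(a, b). {kv a, kv b}) ` selected_pairs h"
  have "k \<le> card Mh" using h(2) by (simp add: Mh_def card_selected_edges selected_size_eq)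
  then obtain M where M: "M \<subseteq> Mh" "card M = k" by (meson obtain_subset_with_card_n)
  have "M \<subseteq> {e \<in> edges G. e \<subseteq> K}"
    using M(1) kv_in_K by (fastforce simp: Mh_def selected_pairs_def)
  moreover have "avoids {..<f} A (edges G) K M"
    unfolding avoids_def
  proof
    assume "\<exists>\<phi>. copy {..<f} A (edges G) M K \<phi>"
    then obtain \<phi> where \<phi>: "copy {..<f} A (edges G) M K \<phi>" by auto
    define g where "g i = inv_into {..<N} kv (\<phi> i)" for i
    have g: "g i < N" "kv (g i) = \<phi> i" if "i < f" for i
    proof -
      have "\<phi> i \<in> kv ` {..<N}"
        using \<phi> that bij_betw_imp_surj_on[OF bij_kernel_vertex] by (auto simp: copy_def)
      then show "g i < N" "kv (g i) = \<phi> i"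
        unfolding g_def using inv_into_into[of "\<phi> i" kv "{..<N}"] f_inv_into_f[of "\<phi> i" kv "{..<N}"] by auto
    qed
    obtain c where c: "c < (N + 1) ^ f" "\<forall>i<f. (c div (N + 1) ^ i) mod (N + 1) = g i"
      using code_exists[of "N + 1" f g] g(1) less_SucI by auto
    have c10: "c < t 10" using c(1) map_codes by linarith
    have dg: "digit L (N + 1) c i = g i" if "i < f" for i
      using digit_map[OF c10 that] c(2) that by simp
    have "coded_copy L s h c"
      unfolding coded_copy_iff[OF c10]
    proof (intro allI impI)
      fix i j assume ij: "i < f" "j < f"
      have sel: "selected L s h (g i) (g j)" if a: "A i j" "g i < g j"
      proof -
        have "{kv (g i), kv (g j)} \<in> Mh" using \<phi> ij a(1) g(2) M(1) by (auto simp: copy_def)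
        then obtain a b where ab: "(a, b) \<in> selected_pairs h" "{kv (g i), kv (g j)} = {kv a, kv b}"
          by (auto simp: Mh_def)
        then have lt: "a < b" "b < N" and s: "selected L s h a b" by (auto simp: selected_pairs_def)
        from ab(2) have "kv (g i) = kv a \<and> kv (g j) = kv b \<or> kv (g i) = kv b \<and> kv (g j) = kv a"
          by (simp add: doubleton_eq_iff)
        then have "g i = a \<and> g j = b"
          using lt a(2) g(1) ij kv_inj[of "g i" a] kv_inj[of "g j" b] kv_inj[of "g i" b] kv_inj[of "g j" a]
          by auto
        then show ?thesis using s by simp
      qed
      have "\<phi> i = \<phi> j \<Longrightarrow> i = j" using \<phi> ij by (auto simp: copy_def inj_on_def)
      then have inj: "g i = g j \<Longrightarrow> i = j" using g(2) ij by metis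
      have "{\<phi> i, \<phi> j} \<in> edges G \<longleftrightarrow> A i j" using \<phi> ij by (simp add: copy_def)
      then show "digit L (N + 1) c i < N \<and> (digit L (N + 1) c i = digit L (N + 1) c j \<longrightarrow> i = j) \<and>
        ({kv (digit L (N + 1) c i), kv (digit L (N + 1) c j)} \<in> edges G \<longleftrightarrow> A i j) \<and>
        (A i j \<and> digit L (N + 1) c i < digit L (N + 1) c j \<longrightarrow>
           selected L s h (digit L (N + 1) c i) (digit L (N + 1) c j))"
        unfolding dg[OF ij(1)] dg[OF ij(2)] using g ij inj sel by simp
    qed
    moreover have "c < L" using c10 t_le_L[of 10] by simp
    ultimately show False using h(3) c10 by blast
  qed
  ultimately show "solvable {..<f} A (edges G) k K" using M(2) by (auto simp: solvable_def)
next
  assume "solvable {..<f} A (edges G) k K"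
  then obtain M where M: "M \<subseteq> {e \<in> edges G. e \<subseteq> K}" "card M = k" "avoids {..<f} A (edges G) K M"
    by (auto simp: solvable_def)
  define g :: "nat \<Rightarrow> nat" where "g p = (if {kv (p div N), kv (p mod N)} \<in> M then 1 else 0)" for p
  obtain h where h: "h < 2 ^ (N * N)" "\<forall>p<N * N. (h div 2 ^ p) mod 2 = g p"
    using code_exists[of 2 "N * N" g] unfolding g_def by fastforce
  have h10: "h < t 10" using h(1) edge_codes by linarith
  have sel: "selected L s h a b \<longleftrightarrow> {kv a, kv b} \<in> M" if "a < N" "b < N" for a b
    using selected_iff[OF h10 that] h(2) pair_less[OF that] that by (simp add: g_def)
  have "M = (\<lambda>(a, b). {kv a, kv b}) ` selected_pairs h"
  proof (intro equalityI subsetI)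
    fix e assume e: "e \<in> M"
    then have "e \<in> edges G" "e \<subseteq> K" using M(1) by auto
    then obtain u v where uv: "e = {u, v}" "u \<noteq> v" "u \<in> kv ` {..<N}" "v \<in> kv ` {..<N}"
      using bij_betw_imp_surj_on[OF bij_kernel_vertex] by (metis edgeE insert_subset)
    then obtain a b where ab: "u = kv a" "v = kv b" "a < N" "b < N" "a \<noteq> b" by auto
    then have "(if a < b then (a, b) else (b, a)) \<in> selected_pairs h"
      using sel[of a b] sel[of b a] e uv(1) \<open>e \<in> edges G\<close>
      by (auto simp: selected_pairs_def insert_commute)
    then show "e \<in> (\<lambda>(a, b). {kv a, kv b}) ` selected_pairs h"
      using ab uv(1) by (intro image_eqI[of _ _ "if a < b then (a, b) else (b, a)"]) auto
  next
    fix e assume "e \<in> (\<lambda>(a, b). {kv a, kv b}) ` selected_pairs h"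
    then obtain a b where "e = {kv a, kv b}" "a < b" "b < N" "selected L s h a b"
      by (auto simp: selected_pairs_def)
    then show "e \<in> M" using sel[of a b] by simp
  qed
  then have "k \<le> selected_size L s h" using M(2) card_selected_edges[of h] by (simp add: selected_size_eq)
  moreover have "\<not> coded_copy L s h c" if c: "c < t 10" for c
  proof
    assume "coded_copy L s h c"
    note cc = this[unfolded coded_copy_iff[OF c], rule_format]
    have "copy {..<f} A (edges G) M K (\<lambda>i. kv (digit L (N + 1) c i))"
      unfolding copy_def
    proof (intro conjI ballI impI)
      show "(\<lambda>i. kv (digit L (N + 1) c i)) ` {..<f} \<subseteq> K" using cc kv_in_K by blast
      show "inj_on (\<lambda>i. kv (digit L (N + 1) c i)) {..<f}"
      proof (rule inj_onI)
        fix i j assume "i \<in> {..<f}" "j \<in> {..<f}" "kv (digit L (N + 1) c i) = kv (digit L (N + 1) c j)"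
        then show "i = j" using cc[of i j] cc[of j i] kv_inj by auto
      qed
    next
      fix i j assume ij: "i \<in> {..<f}" "j \<in> {..<f}"
      then show "{kv (digit L (N + 1) c i), kv (digit L (N + 1) c j)} \<in> edges G \<longleftrightarrow> A i j"
        using cc[of i j] by simp
      assume a: "A i j"
      then have a': "A j i" by (simp add: insert_commute)
      \<comment> \<open>Adjacent vertices get different positions, so one of the two orders is the
        increasing one that \<open>coded_copy\<close> tests.\<close>
      have "i \<noteq> j" using a graphs(1) by (auto simp: is_graph_def)
      then have "digit L (N + 1) c i \<noteq> digit L (N + 1) c j" using cc[of i j] ij by auto
      then show "{kv (digit L (N + 1) c i), kv (digit L (N + 1) c j)} \<in> M"
        using cc[of i j] cc[of j i] ij a a' sel
        by (cases "digit L (N + 1) c i" "digit L (N + 1) c j" rule: linorder_cases) (auto simp: insert_commute)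
    qed
    then show False using M(3) by (auto simp: avoids_def)
  qed
  moreover have "h < L" using h10 t_le_L[of 10] by simp
  ultimately show "kernel_solvable L s"
    unfolding kernel_solvable_def level_eq[of 10, simplified] inputs using h10 by blast
qed

end

lemma max_degree_one_F_iff: "max_degree_one_F L s \<longleftrightarrow> (\<forall>i j j'. A i j \<and> A i j' \<longrightarrow> j = j')"
  unfolding max_degree_one_F_def adj_F_iff
  using F_edge_less f_le_L by (meson less_le_trans)

lemma t_cube: "t 6 * (t 6 * t 6) * t 6 \<le> t 8"
proof -
  have 6: "t 6 * t 6 \<le> t 7" and 7: "t 7 * t 7 \<le> t 8"
    by (rule t_squares)+
  have "t 6 * (t 6 * t 6) * t 6 = (t 6 * t 6) * (t 6 * t 6)" by (simp only: mult.assoc)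
  also have "\<dots> \<le> t 7 * t 7" by (intro mult_le_mono 6)
  finally show ?thesis using 7 by linarith
qed

lemma decide_correct:
  assumes "\<forall>p\<ge>1. \<not> F \<simeq> pK1 p" "\<forall>p. \<not> F \<simeq> pK1_plus_K2 p"
  shows "decide L s = (if strong_closure F G k then 1 else 0)"
proof -
  have sc: "strong_closure F G k \<longleftrightarrow> solvable {..<f} A (edges G) k {..<n}"
    unfolding verts[symmetric] by (rule strong_closure_iff_solvable[OF graphs])
  show ?thesis
  proof (cases "f = 0")
    case True
    \<comment> \<open>The empty map is a copy with respect to every edge set.\<close>
    then have "\<not> solvable {..<f} A (edges G) k {..<n}"
      by (auto simp: solvable_def avoids_def copy_def)
    then show ?thesis using True by (simp add: sc decide_def inputs)
  next
    case f0: False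
    have sym: "A i j \<Longrightarrow> A j i" for i j by (simp add: insert_commute)
    have D: "card {..<f} \<le> t 6" "2 * k \<le> t 6" using base_bounds t_mono[of 1 6] by simp_all
    show ?thesis
    proof (cases "max_degree_one_F L s")
      case deg1: True
      then have deg1': "\<And>i j j'. A i j \<Longrightarrow> A i j' \<Longrightarrow> j = j'" unfolding max_degree_one_F_iff by blast
      show ?thesis
      proof (cases "\<exists>u<n. k \<le> card (nbrs u)")
        case True
        then obtain u where u: "u < n" "k \<le> card (nbrs u)" by blast
        obtain e e' where e: "e \<in> edges F" "e' \<in> edges F" "e \<noteq> e'"
          using two_edges_if_excluded[OF F f0 assms] by blast
        have "card e = 2" "card e' = 2" using e graphs(1) unfolding is_graph_def by blast+
        then obtain i j i' j' where ij: "e = {i, j}" "e' = {i', j'}" by (auto simp: card_2_iff)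
        have "solvable {..<f} A (edges G) k {..<n}"
        proof (rule solvable_if_large_degree)
          show "u \<in> {..<n}" "k \<le> card (nbrs u)" using u by auto
          show "i \<in> {..<f}" "j \<in> {..<f}" "i' \<in> {..<f}" "j' \<in> {..<f}"
            using e ij F_edge_less[of i j] F_edge_less[of i' j'] by auto
          show "A i j" "A i' j'" "{i, j} \<noteq> {i', j'}" using e ij by auto
        qed (use deg1' sym in blast)+
        moreover have "\<exists>u<L. u < n \<and> k \<le> degree_G L s u" 
          using u n_less_L by (intro exI[of _ u]) (simp add: degree_G_eq)
        ultimately show ?thesis using deg1 f0 unfolding decide_def sc inputs by simp
      next
        case False
        then have deg: "\<And>v. v < n \<Longrightarrow> card (nbrs v) < k" by (auto simp: not_le)
        interpret b: bounded_degree_graph "{..<n}" "edges G" k "t 2" "{..<t 4}" "walk_end L s"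
          by (rule bounded_degree[OF deg])
        have K: "K = b.ball_kernel ({..<t 4} \<inter> {..<n}) (t 6)"
          using ball_kernel_iff[OF deg] deg1 by (auto simp: K_def in_kernel_def inputs b.ball_kernel_def)
        have 46: "t 4 < t 5" "t 5 < t 6" "t 4 * t 4 \<le> t 5"
          using t_less[of 5 4] t_less[of 6 5] t_squares(3) by simp_all
        \<comment> \<open>The \<open>t 4\<close> codes give at most \<open>t 6 * t 6\<close> types.
          So the large-kernel answer of \<open>decide\<close> does not occur here.\<close>
        have "N \<le> t 8"
        proof -
          have "N \<le> card ({..<t 4} \<inter> {..<n} \<inter> {..<n}) +
            t 6 * (2 ^ (t 4 * t 4) * 2 ^ (t 4 * t 4)) * t 4"
            using b.card_ball_kernel[of "{..<t 4} \<inter> {..<n}" "t 6"] by (simp add: N_eq K)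
          also have "\<dots> \<le> t 4 + t 6 * (t 6 * t 6) * t 4"
          proof (rule add_mono)
            have "card ({..<t 4} \<inter> {..<n} \<inter> {..<n}) \<le> card {..<t 4}" by (rule card_mono) auto
            then show "card ({..<t 4} \<inter> {..<n} \<inter> {..<n}) \<le> t 4" by simp
            have "(2::nat) ^ (t 4 * t 4) \<le> 2 ^ t 5" using 46(3) by (rule power_increasing) simp
            then have "2 ^ (t 4 * t 4) \<le> t 6" using t_exp[of 6 5] by simp
            then show "t 6 * (2 ^ (t 4 * t 4) * 2 ^ (t 4 * t 4)) * t 4 \<le> t 6 * (t 6 * t 6) * t 4"
              by (intro mult_le_mono order_refl)
          qed
          also have "\<dots> \<le> t 6 * (t 6 * t 6) * t 6"
          proof -
            have "t 4 + 1 \<le> t 6" using 46 by linarith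
            have p: "1 \<le> t 6" using 46 by linarith
            have "1 * t 6 \<le> t 6 * (t 6 * t 6)" using p by (intro mult_le_mono) (simp_all add: Suc_leI)
            then have "t 4 \<le> t 6 * (t 6 * t 6)" using 46 by linarith
            then have "t 4 + t 6 * (t 6 * t 6) * t 4 \<le> t 6 * (t 6 * t 6) * (t 4 + 1)"
              by (simp only: distrib_left)
            also have "\<dots> \<le> t 6 * (t 6 * t 6) * t 6"
              using \<open>t 4 + 1 \<le> t 6\<close> by (rule mult_le_mono2)
            finally show ?thesis .
          qed
          also note t_cube
          finally show ?thesis .
        qed
        moreover have "solvable {..<f} A (edges G) k K \<longleftrightarrow> solvable {..<f} A (edges G) k {..<n}"
          unfolding K
        proof (rule b.ball_kernel_solvable_iff)
          have "2 * k \<le> t 4" using base_bounds(2) t_mono[of 1 4] by simp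
          then have "2 * k * t 4 \<le> t 4 * t 4" by (rule mult_le_mono1)
          then show "2 * k * card {..<t 4} < t 6" unfolding card_lessThan using 46 by linarith
          \<comment> \<open>If \<open>V0\<close> is not the whole vertex set, it has
            \<open>t 4\<close> elements, more than \<open>f * k\<close>.\<close>
          show "{..<t 4} \<inter> {..<n} = {..<n} \<or> card {..<f} * k < card ({..<t 4} \<inter> {..<n})"
          proof (cases "n \<le> t 4")
            case False
            have "f * k \<le> t 1 * t 1" using base_bounds by (intro mult_le_mono) linarith+
            also have "\<dots> \<le> t 2" by (rule t_squares(1))
            also have "\<dots> < t 3" by (rule t_less) simp
            also have "\<dots> \<le> t 4" by (rule t_mono) simp
            finally have "f * k < t 4" .
            moreover have "{..<t 4} \<inter> {..<n} = {..<t 4}" using False by auto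
            ultimately show ?thesis by simp
          qed auto
        qed (use sym in auto)
        ultimately have "level 8 L s < N \<or> kernel_solvable L s \<longleftrightarrow> solvable {..<f} A (edges G) k {..<n}"
          using kernel_solvable_iff by (simp add: level_eq)
        moreover have "\<not> (\<exists>u<L. u < n \<and> k \<le> degree_G L s u)" using False by (auto simp: degree_G_eq)
        ultimately show ?thesis using f0 unfolding decide_def sc inputs by auto
      qed
    next
      case deg2: False
      then obtain i j j' where ij: "A i j" "A i j'" "j \<noteq> j'" by (auto simp: max_degree_one_F_iff)
      then have ijf: "i \<in> {..<f}" "j \<in> {..<f}" "j' \<in> {..<f}" using F_edge_less by auto
      have K: "K = twin_kernel (t 6)"
        using twin_kernel_iff deg2 by (auto simp: K_def in_kernel_def inputs twin_kernel_def)
      have "level 8 L s < N \<or> kernel_solvable L s \<longleftrightarrow> solvable {..<f} A (edges G) k {..<n}"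
      proof (cases "N \<le> t 8")
        case True
        then show ?thesis
          using kernel_solvable_iff[OF True] twin_kernel_solvable_iff[of "{..<f}" "t 6" k A] D
          by (simp add: K level_eq)
      next
        case False
        \<comment> \<open>With \<open>D = t 6\<close>, a kernel of more than \<open>t 8\<close>
          vertices exceeds the number of twin classes times \<open>D\<close> that a small maximum
          matching allows.\<close>
        have "t 6 * (2 * k + 2 ^ (2 * k)) < card (twin_kernel (t 6))"
        proof -
          have "(2::nat) ^ (2 * k) \<le> 2 ^ t 1" using base_bounds(2) by (rule power_increasing) simp
          also have "\<dots> = t 2" by (rule t_exp[symmetric]) simp
          also have "\<dots> \<le> t 6" by (rule t_mono) simp
          finally have "2 * k + 2 ^ (2 * k) \<le> 2 * t 6" using D(2) by simp
          also have "\<dots> \<le> t 6 * t 6"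
          proof (rule mult_le_mono1)
            have "f + 1 \<le> t 5" using base_bounds(3) t_mono[of 1 5] by simp
            then show "2 \<le> t 6" using t_less[of 6 5] by simp
          qed
          finally have "t 6 * (2 * k + 2 ^ (2 * k)) \<le> t 6 * (t 6 * t 6) * 1" by simp
          also have "\<dots> \<le> t 6 * (t 6 * t 6) * t 6"
            using base_bounds(3) t_mono[of 1 6] by (intro mult_le_mono2) simp
          also note t_cube
          finally show ?thesis using False by (simp add: N_eq K)
        qed
        then have "solvable {..<f} A (edges G) k {..<n}"
          by (rule solvable_if_large_twin_kernel[where A = "\<lambda>i j. A i j", OF _ ijf ij])
        then show ?thesis using False by (simp add: level_eq)
      qed
      then show ?thesis using f0 deg2 unfolding decide_def sc inputs by simp
    qed
  qed
qed

end

theorem theorem9: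
  shows "fpt
    {(F :: nat graph, G :: nat graph, k :: nat).
       is_input_graph F \<and> is_input_graph G \<and>
       (\<forall>p\<ge>1. \<not> F \<simeq> pK1 p) \<and> (\<forall>p. \<not> F \<simeq> pK1_plus_K2 p)}
    (\<lambda>(F, G, k). strong_closure F G k)
    encode
    (\<lambda>(F, G, k). card (verts F) + k)
    (\<lambda>(F, G, k). card (verts G))"
\<comment> \<open>Height 10 and offset 3 are those of \<open>level\<close>, so that
  \<open>level 10\<close> fits into the loop length.\<close>
proof (rule fpt_loopable[OF loopable_decide, where m = 10 and ?c0.0 = 3], goal_cases)
  case (1 x)
  then show ?case by (auto simp: encode_def)
next
  case (2 x)
  then show ?case by (auto simp: encode_def)
next
  case (3 x)
  then obtain F G k where x: "x = (F, G, k)" "is_input_graph F" "is_input_graph G"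
    "\<forall>p\<ge>1. \<not> F \<simeq> pK1 p" "\<forall>p. \<not> F \<simeq> pK1_plus_K2 p" by auto
  interpret closure_instance F G k "tower 10 (card (verts F) + k + 3) + card (verts G) + 1"
    by unfold_locales (use x in auto)
  show ?case using decide_correct[OF x(4,5)] by (simp add: x(1))
qed

end
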